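(* Let $d=3$ and $\kappa=2$, and write $\Delta=\Delta[3]$. Let $\{\mathcal{E}_n\}_{n\ge1}=\{\mathcal{E}_n(\kappa=2)\}_{n\ge1}$ be the sequence defined in the context. Then: (1) $(2,3)\subset\boldsymbol{\mu}_\kappa(\Delta)$; (2) $0,1,2,3\in\boldsymbol{\theta}_{0,\kappa}(\Delta)$; (3) $\{\mathcal{E}_n+1\}\subset(1,2)\cap\boldsymbol{\Theta}_\kappa(\Delta)$, with $\mathcal{E}_n+1\searrow1$; (4) $\{\mathcal{E}_n\}\subset(0,1)\cap\boldsymbol{\Theta}_\kappa(\Delta)$, with $\mathcal{E}_n\searrow0$; (5) $\{-\mathcal{E}_n+1\}\subset(0,1)\cap\boldsymbol{\Theta}_\kappa(\Delta)$, with $-\mathcal{E}_n+1\nearrow1$.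
   Context: For $d\ge1$, on $\mathscr{H}=\ell^2(\mathbb{Z}^d)$ let $(S_i^{\pm1}u)(n)=u(n_1,\dots,n_i\mp1,\dots,n_d)$, $\Delta=\Delta[d]=\sum_{i=1}^d\frac12(S_i+S_i^{*})$ (so $\sigma(\Delta)=[-d,d]$), and $(N_iu)(n)=n_iu(n)$. For integers $j,\kappa\ge1$ let $A_i(j,\kappa)$ be the closure of the operator $\frac{1}{4\mathrm{i}}\left[(S_i^{j\kappa}-S_i^{-j\kappa})N_i+N_i(S_i^{j\kappa}-S_i^{-j\kappa})\right]$ defined on compactly supported sequences, and $A_{j\kappa}=\sum_{i=1}^dA_i(j,\kappa)$ (self-adjoint). The conjugate operators considered are the self-adjoint linear combinations (finite or infinite) $\mathbb{A}=\sum_{j\ge1}\rho_{j\kappa}A_{j\kappa}$, $\rho_{j\kappa}\in\mathbb{R}$; $[\Delta,\mathrm{i}\mathbb{A}]_\circ$ is the bounded extension to $\mathscr{H}$ of the commutator initially defined on compactly supported sequences. $\boldsymbol{\mu}_\kappa(\Delta)$ is the set of $E\in\sigma(\Delta)$ for which there exist such an $\mathbb{A}$, an open interval $I\ni E$ and $\gamma>0$ with $1_I(\Delta)[\Delta,\mathrm{i}\mathbb{A}]_\circ1_I(\Delta)\ge\gamma1_I(\Delta)$ ($1_I(\Delta)$ is the spectral projection). $\boldsymbol{\Theta}_\kappa(\Delta)=\sigma(\Delta)\setminus\boldsymbol{\mu}_\kappa(\Delta)$. $\boldsymbol{\theta}_{0,\kappa}(\Delta[d])=\left\{\sum_{q=1}^d\cos(j_q\pi/\kappa):(j_1,\dots,j_d)\in\{0,\dots,\kappa\}^d\right\}$.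 The sequence $\mathcal{E}_n=\mathcal{E}_n(\kappa)$, $n\ge1$: let $T_\kappa$ be the Chebyshev polynomial of the first kind of degree $\kappa$ and $J_2(\kappa)=(2\cos(\pi/\kappa),1+\cos(\pi/\kappa))$. $\mathcal{E}_n$ is the energy component of the unique real solution $(\mathcal{E}_n,X_0,\dots,X_{n+1})$ with $\mathcal{E}_n\in J_2(\kappa)$ of the following system. If $n$ is odd: $T_\kappa(X_q)=T_\kappa(X_{n-q})$ for $q=0,\dots,(n-1)/2$; $X_{n-q}=\mathcal{E}_n-X_{1+q}$ for $q=-1,0,\dots,(n-1)/2$; and $\mathcal{E}_n-1=X_0<X_1<\dots<X_{(n-1)/2}<\cos(\pi/\kappa)<X_{(n+1)/2}<\dots<X_n<X_{n+1}=1$. If $n$ is even: $T_\kappa(X_q)=T_\kappa(X_{n-q})$ for $q=0,\dots,n/2-1$; $X_{n-q}=\mathcal{E}_n-X_{1+q}$ for $q=-1,0,\dots,n/2-1$; and $\mathcal{E}_n-1=X_0<X_1<\dots<X_{n/2}=\cos(\pi/\kappa)<X_{n/2+1}<\dots<X_n<X_{n+1}=1$. *)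

theory Defs
  imports "HOL-Analysis.Analysis"
begin

section \<open>The Hilbert space of square-summable families\<close>

typedef 'i ell2 = "{u :: 'i \<Rightarrow> complex. (\<lambda>n. (cmod (u n))\<^sup>2) summable_on UNIV}"
  morphisms seq Abs_ell2
  by (rule exI[of _ "\<lambda>_. 0"]) simp

setup_lifting type_definition_ell2

lemma ell2_abs_summable_mult:
  assumes "(\<lambda>n. (cmod (u n))\<^sup>2) summable_on UNIV" "(\<lambda>n. (cmod (v n))\<^sup>2) summable_on UNIV"
  shows "(\<lambda>n. norm (cnj (u n) * v n)) summable_on UNIV"
proof (rule summable_on_comparison_test)
  show "(\<lambda>n. (cmod (u n))\<^sup>2 + (cmod (v n))\<^sup>2) summable_on UNIV"
    by (intro summable_on_add assms)
  show "norm (cnj (u n) * v n) \<le> (cmod (u n))\<^sup>2 + (cmod (v n))\<^sup>2" for n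
  proof -
    have "0 \<le> (cmod (u n) - cmod (v n))\<^sup>2" "0 \<le> cmod (u n) * cmod (v n)" by auto
    then show ?thesis unfolding power2_diff norm_mult complex_mod_cnj by linarith
  qed
qed auto

lemma ell2_summable_add:
  assumes "(\<lambda>n. (cmod (u n))\<^sup>2) summable_on UNIV" "(\<lambda>n. (cmod (v n))\<^sup>2) summable_on UNIV"
  shows "(\<lambda>n. (cmod (u n + v n))\<^sup>2) summable_on UNIV"
proof (rule summable_on_comparison_test)
  show "(\<lambda>n. 2 * (cmod (u n))\<^sup>2 + 2 * (cmod (v n))\<^sup>2) summable_on UNIV"
    by (intro summable_on_add summable_on_cmult_right assms)
  show "(cmod (u n + v n))\<^sup>2 \<le> 2 * (cmod (u n))\<^sup>2 + 2 * (cmod (v n))\<^sup>2" for n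
  proof -
    have "(cmod (u n + v n))\<^sup>2 \<le> (cmod (u n) + cmod (v n))\<^sup>2"
      by (intro power_mono norm_triangle_ineq) auto
    moreover have "0 \<le> (cmod (u n) - cmod (v n))\<^sup>2" by auto
    ultimately show ?thesis by (simp add: power2_diff power2_sum)
  qed
qed auto

lift_definition scaleC :: "complex \<Rightarrow> 'i ell2 \<Rightarrow> 'i ell2"  (infixr \<open>*\<^sub>C\<close> 75)
  is "\<lambda>c u n. c * u n"
  by (simp add: norm_mult power_mult_distrib summable_on_cmult_right)

definition cinner :: "'i ell2 \<Rightarrow> 'i ell2 \<Rightarrow> complex"
  where "cinner u v = (\<Sum>\<^sub>\<infinity>n. cnj (seq u n) * seq v n)"

lemma cinner_summable: "(\<lambda>n. cnj (seq u n) * seq v n) summable_on UNIV"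
  using ell2_abs_summable_mult[of "seq u" "seq v"] seq[of u] seq[of v]
  by (auto intro: abs_summable_summable)

text \<open>The real structure underlying the complex Hilbert space: the inner product of
  \<^class>\<open>real_inner\<close> is the real part of \<^const>\<open>cinner\<close>, so norm and topology are the usual ones.\<close>

instantiation ell2 :: (type) real_inner
begin

lift_definition zero_ell2 :: "'a ell2" is "\<lambda>_. 0" by simp

lift_definition plus_ell2 :: "'a ell2 \<Rightarrow> 'a ell2 \<Rightarrow> 'a ell2" is "\<lambda>u v n. u n + v n"
  by (simp add: ell2_summable_add)

lift_definition uminus_ell2 :: "'a ell2 \<Rightarrow> 'a ell2" is "\<lambda>u n. - u n" by simp

lift_definition minus_ell2 :: "'a ell2 \<Rightarrow> 'a ell2 \<Rightarrow> 'a ell2" is "\<lambda>u v n. u n - v n"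
proof -
  fix u v :: "'a \<Rightarrow> complex"
  assume "(\<lambda>n. (cmod (u n))\<^sup>2) summable_on UNIV" "(\<lambda>n. (cmod (v n))\<^sup>2) summable_on UNIV"
  then show "(\<lambda>n. (cmod (u n - v n))\<^sup>2) summable_on UNIV"
    using ell2_summable_add[of u "\<lambda>n. - v n"] by simp
qed

definition scaleR_ell2 :: "real \<Rightarrow> 'a ell2 \<Rightarrow> 'a ell2"
  where "scaleR_ell2 r u = complex_of_real r *\<^sub>C u"

definition inner_ell2 :: "'a ell2 \<Rightarrow> 'a ell2 \<Rightarrow> real"
  where "inner_ell2 u v = Re (cinner u v)"

definition norm_ell2 :: "'a ell2 \<Rightarrow> real"
  where "norm_ell2 u = sqrt (inner u u)"

definition sgn_ell2 :: "'a ell2 \<Rightarrow> 'a ell2"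
  where "sgn_ell2 u = inverse (norm u) *\<^sub>R u"

definition dist_ell2 :: "'a ell2 \<Rightarrow> 'a ell2 \<Rightarrow> real"
  where "dist_ell2 u v = norm (u - v)"

definition uniformity_ell2 :: "('a ell2 \<times> 'a ell2) filter"
  where "uniformity_ell2 = (INF e\<in>{0<..}. principal {(x, y). dist x y < e})"

definition open_ell2 :: "'a ell2 set \<Rightarrow> bool"
  where "open_ell2 U = (\<forall>x\<in>U. eventually (\<lambda>(x', y). x' = x \<longrightarrow> y \<in> U) uniformity)"

instance
proof
  fix u v w :: "'a ell2" and r s :: real
  show "u + v + w = u + (v + w)" "u + v = v + u" "0 + u = u" "- u + u = 0" "u - v = u + - v"
    by (transfer; simp add: algebra_simps)+
  show "r *\<^sub>R (u + v) = r *\<^sub>R u + r *\<^sub>R v" "(r + s) *\<^sub>R u = r *\<^sub>R u + s *\<^sub>R u"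
    "r *\<^sub>R s *\<^sub>R u = (r * s) *\<^sub>R u" "1 *\<^sub>R u = u"
    unfolding scaleR_ell2_def by (transfer; simp add: algebra_simps)+
  show "dist u v = norm (u - v)" "sgn u = inverse (norm u) *\<^sub>R u" "norm u = sqrt (inner u u)"
    by (simp_all add: dist_ell2_def sgn_ell2_def norm_ell2_def)
  show "uniformity = (INF e\<in>{0<..}. principal {(x, y :: 'a ell2). dist x y < e})"
    by (rule uniformity_ell2_def)
  show "open U = (\<forall>x\<in>U. eventually (\<lambda>(x', y). x' = x \<longrightarrow> y \<in> U) uniformity)" for U :: "'a ell2 set"
    by (rule open_ell2_def)
  have cnj: "cinner u v = cnj (cinner v u)" for u v :: "'a ell2"
    unfolding cinner_def by (subst infsum_cnj[symmetric]) (simp add: mult.commute)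
  then show "inner u v = inner v u"
    unfolding inner_ell2_def by (metis cnj.simps(1))
  show "inner (u + v) w = inner u w + inner v w"
    unfolding inner_ell2_def cinner_def
    using infsum_add[OF cinner_summable[of u w] cinner_summable[of v w]]
    by (simp add: plus_ell2.rep_eq distrib_right)
  show "inner (r *\<^sub>R u) v = r * inner u v"
    unfolding inner_ell2_def cinner_def
    using infsum_cmult_right[where c = "complex_of_real r", OF cinner_summable[of u v]]
    by (simp add: scaleR_ell2_def scaleC.rep_eq mult.assoc)
  have summ: "(\<lambda>n. (cmod (seq u n))\<^sup>2) summable_on UNIV"
    using seq[of u] by simp
  have eq: "cinner u u = complex_of_real (\<Sum>\<^sub>\<infinity>n. (cmod (seq u n))\<^sup>2)"
    unfolding cinner_def using has_sum_of_real[OF has_sum_infsum[OF summ], where 'a = complex]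
    by (intro infsumI) (simp only: complex_norm_square mult.commute)
  show "0 \<le> inner u u"
    unfolding inner_ell2_def eq by (simp add: infsum_nonneg)
  show "(inner u u = 0) = (u = 0)"
  proof
    assume "inner u u = 0"
    then have "(\<Sum>\<^sub>\<infinity>n. (cmod (seq u n))\<^sup>2) = 0" unfolding inner_ell2_def eq by simp
    then have "(cmod (seq u n))\<^sup>2 = 0" for n
      using nonneg_infsum_le_0D[of "\<lambda>n. (cmod (seq u n))\<^sup>2" UNIV n] summ by simp
    then show "u = 0" by (transfer; auto)
  next
    assume "u = 0"
    then show "inner u u = 0" unfolding inner_ell2_def cinner_def by (simp add: zero_ell2.rep_eq)
  qed
qed

end


section \<open>Operators\<close>

text \<open>Bounded operators are total functions; unbounded operators are identified with their graphs,
  so that the closure of an operator is the topological closure of its graph.\<close>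

definition bounded_clinear :: "('i ell2 \<Rightarrow> 'i ell2) \<Rightarrow> bool"
  where "bounded_clinear T \<longleftrightarrow> bounded_linear T \<and> (\<forall>c u. T (c *\<^sub>C u) = c *\<^sub>C T u)"

definition spectrum :: "('i ell2 \<Rightarrow> 'i ell2) \<Rightarrow> complex set"
  where "spectrum T = {z. \<not> (\<exists>R. bounded_clinear R \<and>
    (\<forall>u. R (T u - z *\<^sub>C u) = u) \<and> (\<forall>u. T (R u) - z *\<^sub>C R u = u))}"

definition op_le :: "('i ell2 \<Rightarrow> 'i ell2) \<Rightarrow> ('i ell2 \<Rightarrow> 'i ell2) \<Rightarrow> bool"
  where "op_le S T \<longleftrightarrow> (\<forall>u. cinner u (T u - S u) \<in> \<real>\<^sub>\<ge>\<^sub>0)"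

definition orthogonal_projection :: "('i ell2 \<Rightarrow> 'i ell2) \<Rightarrow> bool"
  where "orthogonal_projection Q \<longleftrightarrow> bounded_clinear Q \<and> (\<forall>u. Q (Q u) = Q u) \<and>
    (\<forall>u v. cinner u (Q v) = cinner (Q u) v)"

definition projection_valued_measure :: "(real set \<Rightarrow> 'i ell2 \<Rightarrow> 'i ell2) \<Rightarrow> bool"
  where "projection_valued_measure P \<longleftrightarrow>
    (\<forall>B\<in>sets borel. orthogonal_projection (P B)) \<and>
    P UNIV = (\<lambda>u. u) \<and>
    (\<forall>F :: nat \<Rightarrow> real set. range F \<subseteq> sets borel \<longrightarrow> disjoint_family F \<longrightarrow>
      (\<forall>u. (\<lambda>k. P (F k) u) sums P (\<Union>k. F k) u))"

definition diagonal_measure :: "(real set \<Rightarrow> 'i ell2 \<Rightarrow> 'i ell2) \<Rightarrow> 'i ell2 \<Rightarrow> real measure"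
  where "diagonal_measure P u = measure_of UNIV (sets borel) (\<lambda>B. ennreal (Re (cinner u (P B u))))"

text \<open>\<open>T = \<integral> \<lambda> dP(\<lambda>)\<close> for a bounded self-adjoint \<open>T\<close>; by polarization the diagonal matrix elements
  suffice.\<close>

definition is_spectral_measure ::
    "('i ell2 \<Rightarrow> 'i ell2) \<Rightarrow> (real set \<Rightarrow> 'i ell2 \<Rightarrow> 'i ell2) \<Rightarrow> bool"
  where "is_spectral_measure T P \<longleftrightarrow> projection_valued_measure P \<and>
    (\<forall>u. integrable (diagonal_measure P u) (\<lambda>x. x) \<and>
      cinner u (T u) = complex_of_real (\<integral>x. x \<partial>diagonal_measure P u))"

text \<open>\<open>1\<^sub>B(T)\<close>. By the spectral theorem the spectral measure of a bounded self-adjoint \<open>T\<close> exists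
  and is unique on Borel sets, so for Borel \<open>B\<close> the choice is immaterial.\<close>

definition spectral_projection :: "('i ell2 \<Rightarrow> 'i ell2) \<Rightarrow> real set \<Rightarrow> 'i ell2 \<Rightarrow> 'i ell2"
  where "spectral_projection T B = (SOME P. is_spectral_measure T P) B"

definition adjoint_graph :: "('i ell2 \<times> 'i ell2) set \<Rightarrow> ('i ell2 \<times> 'i ell2) set"
  where "adjoint_graph T = {(v, w). \<forall>(u, z)\<in>T. cinner v z = cinner w u}"

definition self_adjoint :: "('i ell2 \<times> 'i ell2) set \<Rightarrow> bool"
  where "self_adjoint T \<longleftrightarrow> closure (Domain T) = UNIV \<and> adjoint_graph T = T"

definition compactly_supported :: "'i ell2 set"
  where "compactly_supported = {u. finite {n. seq u n \<noteq> 0}}"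

text \<open>\<open>B\<close> is \<open>[T, iA]\<^sub>\<circ>\<close>. In particular compactly supported sequences and their images
  under \<open>T\<close> are required to lie in the domain of \<open>A\<close>. By density there is at most one such \<open>B\<close>.\<close>

definition is_bounded_commutator ::
    "('i ell2 \<Rightarrow> 'i ell2) \<Rightarrow> ('i ell2 \<times> 'i ell2) set \<Rightarrow> ('i ell2 \<Rightarrow> 'i ell2) \<Rightarrow> bool"
  where "is_bounded_commutator T A B \<longleftrightarrow> bounded_clinear B \<and>
    (\<forall>u\<in>compactly_supported. \<exists>v w. (u, v) \<in> A \<and> (T u, w) \<in> A \<and>
      B u = T (\<i> *\<^sub>C v) - \<i> *\<^sub>C w)"


section \<open>The discrete Laplacian and the conjugate operators\<close>

text \<open>\<open>shift i k\<close> is \<open>S\<^sub>i\<close> to the integer power \<open>k\<close>, on arbitrary sequences.\<close>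

definition shift :: "'d::finite \<Rightarrow> int \<Rightarrow> (int ^ 'd \<Rightarrow> complex) \<Rightarrow> int ^ 'd \<Rightarrow> complex"
  where "shift i k f = (\<lambda>n. f (n - axis i k))"

definition position :: "'d::finite \<Rightarrow> (int ^ 'd \<Rightarrow> complex) \<Rightarrow> int ^ 'd \<Rightarrow> complex"
  where "position i f = (\<lambda>n. of_int (n $ i) * f n)"

lift_definition shift_ell2 :: "'d::finite \<Rightarrow> int \<Rightarrow> (int ^ 'd) ell2 \<Rightarrow> (int ^ 'd) ell2"
  is shift
proof -
  fix i :: 'd and k :: int and u :: "int ^ 'd \<Rightarrow> complex"
  assume u: "(\<lambda>n. (cmod (u n))\<^sup>2) summable_on UNIV"
  have "bij_betw (\<lambda>n :: int ^ 'd. n - axis i k) UNIV UNIV"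
    by (rule bij_betw_byWitness[where f' = "\<lambda>n. n + axis i k"]) auto
  from summable_on_reindex_bij_betw[OF this, of "\<lambda>n. (cmod (u n))\<^sup>2"] u
  show "(\<lambda>n. (cmod (shift i k u n))\<^sup>2) summable_on UNIV"
    by (simp add: shift_def)
qed

text \<open>\<open>\<Delta>[d]\<close> with \<open>d = CARD('d)\<close>; the shifts are unitary, so \<open>S\<^sub>i\<^sup>*\<close> is the inverse shift.\<close>

definition laplacian :: "(int ^ 'd::finite) ell2 \<Rightarrow> (int ^ 'd) ell2"
  where "laplacian u = (\<Sum>i\<in>UNIV. (1/2) *\<^sub>R (shift_ell2 i 1 u + shift_ell2 i (-1) u))"

text \<open>The formal expression for \<open>A\<^sub>i(j,\<kappa>)\<close>, depending only on the product \<open>m = j\<kappa>\<close>.\<close>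

definition A_formal :: "'d::finite \<Rightarrow> nat \<Rightarrow> (int ^ 'd \<Rightarrow> complex) \<Rightarrow> int ^ 'd \<Rightarrow> complex"
  where "A_formal i m f = (\<lambda>n. 1 / (4 * \<i>) *
    ((shift i (int m) (position i f) n - shift i (- int m) (position i f) n)
     + position i (\<lambda>n'. shift i (int m) f n' - shift i (- int m) f n') n))"

definition A_coord :: "'d::finite \<Rightarrow> nat \<Rightarrow> nat \<Rightarrow> ((int ^ 'd) ell2 \<times> (int ^ 'd) ell2) set"
  where "A_coord i j \<kappa> =
    closure {(u, v). u \<in> compactly_supported \<and> seq v = A_formal i (j * \<kappa>) (seq u)}"

text \<open>A sum of unbounded operators, taken on the intersection of their domains (and, for a
  series, where it converges in norm), is in general not closed even if it is essentially
  self-adjoint. So the self-adjoint operators \<open>A\<^bsub>j\<kappa>\<^esub>\<close> and \<open>\<A>\<close> are the closures of the sums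
  \<open>\<Sum>\<^sub>i A\<^sub>i(j,\<kappa>)\<close> and \<open>\<Sum>\<^bsub>j\<ge>1\<^esub> \<rho>\<^bsub>j\<kappa>\<^esub> A\<^bsub>j\<kappa>\<^esub>\<close>. The latter sum itself, without closure, is \<open>lin_comb\<close>: it must be
  defined on compactly supported sequences, where the commutator is computed.\<close>

definition A_sum :: "nat \<Rightarrow> nat \<Rightarrow> ((int ^ 'd::finite) ell2 \<times> (int ^ 'd) ell2) set"
  where "A_sum j \<kappa> = closure {(u, \<Sum>i\<in>UNIV. v i) |u v. \<forall>i. (u, v i) \<in> A_coord i j \<kappa>}"

definition lin_comb :: "nat \<Rightarrow> (nat \<Rightarrow> real) \<Rightarrow> ((int ^ 'd::finite) ell2 \<times> (int ^ 'd) ell2) set"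
  where "lin_comb \<kappa> \<rho> = {(u, w). \<exists>v.
    (\<forall>j\<ge>1. \<rho> (j * \<kappa>) \<noteq> 0 \<longrightarrow> (u, v j) \<in> A_sum j \<kappa>) \<and>
    (\<lambda>k. \<rho> (Suc k * \<kappa>) *\<^sub>R v (Suc k)) sums w}"

definition mourre_set :: "nat \<Rightarrow> ((int ^ 'd::finite) ell2 \<Rightarrow> (int ^ 'd) ell2) \<Rightarrow> real set"
  where "mourre_set \<kappa> T = {E. complex_of_real E \<in> spectrum T \<and>
    (\<exists>\<rho> A B a b \<gamma>. A = lin_comb \<kappa> \<rho> \<and> self_adjoint (closure A) \<and> is_bounded_commutator T A B \<and>
      a < E \<and> E < b \<and> 0 < \<gamma> \<and>
      op_le (\<lambda>u. \<gamma> *\<^sub>R spectral_projection T {a<..<b} u)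
        (\<lambda>u. spectral_projection T {a<..<b} (B (spectral_projection T {a<..<b} u))))}"

definition threshold_set :: "nat \<Rightarrow> ((int ^ 'd::finite) ell2 \<Rightarrow> (int ^ 'd) ell2) \<Rightarrow> real set"
  where "threshold_set \<kappa> T = {E. complex_of_real E \<in> spectrum T} - mourre_set \<kappa> T"

definition theta0 :: "'d::finite itself \<Rightarrow> nat \<Rightarrow> real set"
  where "theta0 _ \<kappa> = {\<Sum>q\<in>UNIV. cos (real (j q) * pi / real \<kappa>) |j :: 'd \<Rightarrow> nat. \<forall>q. j q \<le> \<kappa>}"


section \<open>The energies \<open>\<E>\<^sub>n(\<kappa>)\<close>\<close>

fun chebyshev_T :: "nat \<Rightarrow> real \<Rightarrow> real"
  where
    "chebyshev_T 0 x = 1"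
  | "chebyshev_T (Suc 0) x = x"
  | "chebyshev_T (Suc (Suc n)) x = 2 * x * chebyshev_T (Suc n) x - chebyshev_T n x"

text \<open>\<open>X\<close> is indexed by integers because \<open>q\<close> starts at \<open>-1\<close>; only \<open>X 0, \<dots>, X (n+1)\<close> matter. The chain of
  strict inequalities is \<^term>\<open>strict_mono_on {0..int n + 1} X\<close> together with the position of
  \<^term>\<open>cos (pi / real \<kappa>)\<close> in it.\<close>

definition energy_system :: "nat \<Rightarrow> nat \<Rightarrow> real \<Rightarrow> (int \<Rightarrow> real) \<Rightarrow> bool"
  where "energy_system \<kappa> n E X \<longleftrightarrow>
    E \<in> {2 * cos (pi / real \<kappa>) <..< 1 + cos (pi / real \<kappa>)} \<and>
    X 0 = E - 1 \<and> X (int n + 1) = 1 \<and> strict_mono_on {0..int n + 1} X \<and>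
    (if odd n then
      (\<forall>q\<in>{0..(int n - 1) div 2}. chebyshev_T \<kappa> (X q) = chebyshev_T \<kappa> (X (int n - q))) \<and>
      (\<forall>q\<in>{-1..(int n - 1) div 2}. X (int n - q) = E - X (1 + q)) \<and>
      X ((int n - 1) div 2) < cos (pi / real \<kappa>) \<and> cos (pi / real \<kappa>) < X ((int n + 1) div 2)
    else
      (\<forall>q\<in>{0..int n div 2 - 1}. chebyshev_T \<kappa> (X q) = chebyshev_T \<kappa> (X (int n - q))) \<and>
      (\<forall>q\<in>{-1..int n div 2 - 1}. X (int n - q) = E - X (1 + q)) \<and>
      X (int n div 2) = cos (pi / real \<kappa>))"

definition energy :: "nat \<Rightarrow> nat \<Rightarrow> real"
  where "energy \<kappa> n = (THE E. \<exists>X. energy_system \<kappa> n E X)"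

end

theory Submission
  imports Defs
begin

text \<open>In Fourier space the Laplacian is multiplication by \<open>h(\<theta>) = cos \<theta>\<^sub>1 + cos \<theta>\<^sub>2 + cos \<theta>\<^sub>3\<close>, and
  the commutator with \<open>A\<^sub>m\<close> is multiplication by \<open>\<Sum>\<^sub>i sin \<theta>\<^sub>i sin (m \<theta>\<^sub>i)\<close>. For even \<open>m\<close> each summand is an
  odd function of \<open>x\<^sub>i = cos \<theta>\<^sub>i\<close> that vanishes at \<open>x\<^sub>i = 0\<close> and \<open>x\<^sub>i = \<plusminus>1\<close>.

  The energies. \<open>T\<^sub>2(x) = 2x\<^sup>2 - 1\<close> identifies exactly \<open>x\<close> with \<open>-x\<close>, so the defining system forces the
  arithmetic progression \<open>X\<^sub>q = (q + 1) \<E>\<^sub>n - 1\<close> that runs from \<open>\<E>\<^sub>n - 1\<close> to \<open>1\<close>; hence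
  \<open>\<E>\<^sub>n = 2 / (n + 2)\<close> (\<open>energy_two\<close>).

  The thresholds. A Mourre estimate at \<open>E\<close> for a combination \<open>\<Sum>\<^sub>m \<rho>\<^sub>m A\<^sub>m\<close> forces the symbol
  \<open>\<Sum>\<^sub>m \<rho>\<^sub>m \<Sum>\<^sub>i sin \<theta>\<^sub>i sin (m \<theta>\<^sub>i)\<close> to be at least some \<open>\<gamma> > 0\<close> on all of \<open>h = E\<close>
  (\<open>mourre_estimate_symbol\<close>): plane waves cut off to large boxes are approximate eigenvectors, so they
  asymptotically lie in the range of the spectral projection, and the expectation of the commutator
  in them tends to its symbol. The series of symbols converges absolutely, because the unit sequence
  at the origin is in the domain of the combination only if \<open>m \<rho>\<^sub>m\<close> is square-summable
  (\<open>bounded_commutator_expansion\<close>). For \<open>y\<^sub>p = p \<E>\<^sub>n - 1\<close>, the points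
  \<open>(s y\<^bsub>p+1\<^esub>, - s y\<^sub>p, c)\<close> with \<open>0 \<le> p \<le> n + 1\<close>, \<open>s = \<plusminus>1\<close> and \<open>c \<in> {0, 1}\<close> all have energy
  \<open>s \<E>\<^sub>n + c\<close>. By oddness the sum of the symbol over them telescopes from \<open>y\<^sub>0 = -1\<close> to
  \<open>y\<^bsub>n+2\<^esub> = 1\<close>, where the summands vanish. So it is zero, which contradicts the lower bound \<open>\<gamma>\<close>
  at each point (\<open>threshold_energies\<close>).

  The Mourre estimate for \<open>2 < E < 3\<close>. The operator \<open>A\<^sub>2\<close> alone suffices. Its symbol
  \<open>\<Sum>\<^sub>i 2 x\<^sub>i (1 - x\<^sub>i\<^sup>2)\<close> dominates, on the whole cube, a quadratic polynomial in \<open>h\<close> that is positive at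
  \<open>h = E\<close> (\<open>cubic_lower_bound\<close>). So the commutator dominates a quadratic polynomial in the
  Laplacian, and near \<open>E\<close> the spectral projection makes that polynomial positive
  (\<open>mourre_above_two\<close>).

  Three analytic facts carry the translation between operators and symbols. The Laplacian has a
  spectral measure (\<open>spectral_measure_laplacian\<close>), built from multiplication by indicator functions of
  \<open>h\<close>. For any spectral measure, vectors in a spectral subspace obey the expected bounds
  (\<open>norm_T_minus_le\<close>, \<open>norm_minus_P_le\<close>). The operators \<open>A\<^sub>m\<close> are self-adjoint and act on their whole
  domain by the formal expression (\<open>A_sum_eq_A_max\<close>, \<open>self_adjoint_A_max\<close>).\<close>

section \<open>Hilbert space calculus in \<open>\<ell>\<^sup>2\<close>\<close>

lemmas seq_simps [simp] =
  zero_ell2.rep_eq plus_ell2.rep_eq uminus_ell2.rep_eq minus_ell2.rep_eq scaleC.rep_eq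

lemma seq_scaleR [simp]: "seq (r *\<^sub>R u) n = of_real r * seq u n"
  by (simp add: scaleR_ell2_def)

lemma ell2_eqI: "(\<And>n. seq u n = seq v n) \<Longrightarrow> u = v"
  by (simp add: seq_inject[symmetric] fun_eq_iff)

lemma seq_sum [simp]: "seq (\<Sum>i\<in>I. u i) n = (\<Sum>i\<in>I. seq (u i) n)"
  by (induction I rule: infinite_finite_induct) auto

lemma scaleC_of_real: "complex_of_real r *\<^sub>C u = r *\<^sub>R u"
  by (simp add: scaleR_ell2_def)

lemma scaleC_algebra [simp]:
  "1 *\<^sub>C u = u" "0 *\<^sub>C u = 0" "c *\<^sub>C (0 :: 'i ell2) = 0" "c *\<^sub>C d *\<^sub>C u = (c * d) *\<^sub>C u"
  "c *\<^sub>C (r *\<^sub>R u) = r *\<^sub>R (c *\<^sub>C u)"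
  by (rule ell2_eqI; simp)+

lemma scaleC_add: "c *\<^sub>C (u + v) = c *\<^sub>C u + c *\<^sub>C v" "(c + d) *\<^sub>C u = c *\<^sub>C u + d *\<^sub>C u"
  by (rule ell2_eqI; simp add: algebra_simps)+

lemma scaleC_diff: "c *\<^sub>C (u - v) = c *\<^sub>C u - c *\<^sub>C v" "(c - d) *\<^sub>C u = c *\<^sub>C u - d *\<^sub>C u"
  by (rule ell2_eqI; simp add: algebra_simps)+

subsection \<open>The sesquilinear inner product\<close>

lemma cinner_commute: "cinner u v = cnj (cinner v u)"
  unfolding cinner_def by (subst infsum_cnj[symmetric]) (simp add: mult.commute)

lemma cinner_add: "cinner u (v + w) = cinner u v + cinner u w"
    "cinner (u + v) w = cinner u w + cinner v w"
proof -
  have *: "cinner u (v + w) = cinner u v + cinner u w" for u v w :: "'a ell2"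
    unfolding cinner_def using infsum_add[OF cinner_summable[of u v] cinner_summable[of u w]]
    by (simp add: algebra_simps)
  show "cinner u (v + w) = cinner u v + cinner u w" by (rule *)
  show "cinner (u + v) w = cinner u w + cinner v w"
    using arg_cong[OF *[of w u v], of cnj] by (simp add: cinner_commute[symmetric])
qed

lemma cinner_scaleC [simp]: "cinner u (c *\<^sub>C v) = c * cinner u v"
    "cinner (c *\<^sub>C u) v = cnj c * cinner u v"
proof -
  have *: "cinner u (c *\<^sub>C v) = c * cinner u v" for c and u v :: "'a ell2"
    unfolding cinner_def using infsum_cmult_right[where c = c, OF cinner_summable[of u v]]
    by (simp add: algebra_simps)
  show "cinner u (c *\<^sub>C v) = c * cinner u v" by (rule *)
  show "cinner (c *\<^sub>C u) v = cnj c * cinner u v"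
    using arg_cong[OF *[of v c u], of cnj] by (simp add: cinner_commute[symmetric])
qed

lemma cinner_scaleR [simp]: "cinner u (r *\<^sub>R v) = r * cinner u v"
    "cinner (r *\<^sub>R u) v = r * cinner u v"
  by (simp_all add: scaleC_of_real[symmetric])

lemma cinner_zero [simp]: "cinner u 0 = 0" "cinner 0 v = 0"
  by (simp_all add: cinner_def)

lemma cinner_minus [simp]: "cinner u (- v) = - cinner u v" "cinner (- u) v = - cinner u v"
  using cinner_scaleR(1)[of u "-1" v] cinner_scaleR(2)[of "-1" u v] by simp_all

lemma cinner_diff: "cinner u (v - w) = cinner u v - cinner u w"
    "cinner (u - v) w = cinner u w - cinner v w"
  using cinner_add(1)[of u v "- w"] cinner_add(2)[of u "- v" w] by simp_all

lemma cinner_sum: "cinner u (\<Sum>i\<in>I. v i) = (\<Sum>i\<in>I. cinner u (v i))"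
    "cinner (\<Sum>i\<in>I. w i) u = (\<Sum>i\<in>I. cinner (w i) u)"
  by (induction I rule: infinite_finite_induct) (auto simp: cinner_add)

lemma inner_eq_Re_cinner: "u \<bullet> v = Re (cinner u v)"
  by (rule inner_ell2_def)

lemma cinner_self: "cinner u u = complex_of_real ((norm u)\<^sup>2)"
proof (rule complex_eqI)
  show "Re (cinner u u) = Re (complex_of_real ((norm u)\<^sup>2))"
    by (simp add: power2_norm_eq_inner inner_eq_Re_cinner)
  show "Im (cinner u u) = Im (complex_of_real ((norm u)\<^sup>2))"
    using arg_cong[OF cinner_commute[of u u], of Im] by simp
qed

lemma norm_square_eq: "(norm u)\<^sup>2 = Re (cinner u u)"
  by (simp add: cinner_self)

lemma norm_scaleC [simp]: "norm (c *\<^sub>C u) = cmod c * norm u"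
proof -
  have "(norm (c *\<^sub>C u))\<^sup>2 = (cmod c * norm u)\<^sup>2"
  proof -
    have "cinner (c *\<^sub>C u) (c *\<^sub>C u) = (c * cnj c) * cinner u u" by simp
    also have "\<dots> = complex_of_real ((cmod c * norm u)\<^sup>2)"
      by (simp only: complex_norm_square[symmetric] cinner_self of_real_mult[symmetric] power_mult_distrib)
    finally show ?thesis by (simp only: norm_square_eq Re_complex_of_real)
  qed
  then show ?thesis by (simp add: power2_eq_iff_nonneg)
qed

lemma Cauchy_Schwarz_cinner: "cmod (cinner u v) \<le> norm u * norm v"
proof (cases "cinner u v = 0")
  case False
  define c where "c = cnj (cinner u v) / cmod (cinner u v)"
  have c: "cmod c = 1" using False by (simp add: c_def norm_divide)
  have "c * cinner u v = of_real (cmod (cinner u v))"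
    using False complex_norm_square[of "cinner u v"]
    by (simp add: c_def field_simps power2_eq_square)
  then have "cmod (cinner u v) = u \<bullet> (c *\<^sub>C v)"
    by (simp add: inner_eq_Re_cinner)
  also have "\<dots> \<le> norm u * norm (c *\<^sub>C v)" by (rule norm_cauchy_schwarz)
  finally show ?thesis by (simp add: c)
qed simp

lemma bounded_linear_cinner_right: "bounded_linear (cinner u)"
  by (rule bounded_linear_intro[of _ "norm u"])
    (use Cauchy_Schwarz_cinner[of u] in \<open>auto simp: cinner_add scaleR_conv_of_real mult.commute\<close>)

lemma tendsto_cinner [tendsto_intros]:
  assumes f: "(f \<longlongrightarrow> u) F" and g: "(g \<longlongrightarrow> v) F"
  shows "((\<lambda>x. cinner (f x) (g x)) \<longlongrightarrow> cinner u v) F"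
proof -
  have "((\<lambda>x. norm (f x) * norm (g x - v) + norm (f x - u) * norm v) \<longlongrightarrow> norm u * 0 + 0 * norm v) F"
    using LIM_zero[OF f] LIM_zero[OF g]
    by (intro tendsto_intros f) (auto dest: tendsto_norm_zero)
  then have "((\<lambda>x. norm (f x) * norm (g x - v) + norm (f x - u) * norm v) \<longlongrightarrow> 0) F" by simp
  then have "((\<lambda>x. cinner (f x) (g x) - cinner u v) \<longlongrightarrow> 0) F"
  proof (rule Lim_null_comparison[rotated])
    show "\<forall>\<^sub>F x in F. norm (cinner (f x) (g x) - cinner u v)
        \<le> norm (f x) * norm (g x - v) + norm (f x - u) * norm v"
    proof (rule always_eventually, rule allI)
      fix x
      have "cinner (f x) (g x) - cinner u v = cinner (f x) (g x - v) + cinner (f x - u) v"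
        by (simp add: cinner_diff)
      then show "norm (cinner (f x) (g x) - cinner u v)
          \<le> norm (f x) * norm (g x - v) + norm (f x - u) * norm v"
        using Cauchy_Schwarz_cinner[of "f x" "g x - v"] Cauchy_Schwarz_cinner[of "f x - u" v]
          norm_triangle_ineq[of "cinner (f x) (g x - v)" "cinner (f x - u) v"] by simp
    qed
  qed
  then show ?thesis by (simp add: LIM_zero_iff)
qed

lemma continuous_on_cinner [continuous_intros]:
  "continuous_on S f \<Longrightarrow> continuous_on S g \<Longrightarrow> continuous_on S (\<lambda>x. cinner (f x) (g x))"
  unfolding continuous_on_def by (auto intro: tendsto_cinner)

lemma bounded_linear_scaleC: "bounded_linear (\<lambda>u. c *\<^sub>C u)"
  by (rule bounded_linear_intro[of _ "cmod c"]) (auto simp: scaleC_add mult.commute)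

subsection \<open>Coordinates and finitely supported sequences\<close>

lemma norm_square_seq: "((\<lambda>n. (cmod (seq u n))\<^sup>2) has_sum (norm u)\<^sup>2) UNIV"
proof -
  have summ: "(\<lambda>n. (cmod (seq u n))\<^sup>2) summable_on UNIV"
    using seq[of u] by simp
  have "cinner u u = complex_of_real (\<Sum>\<^sub>\<infinity>n. (cmod (seq u n))\<^sup>2)"
    unfolding cinner_def using has_sum_of_real[OF has_sum_infsum[OF summ], where 'a = complex]
    by (intro infsumI) (simp only: complex_norm_square mult.commute)
  then show ?thesis using has_sum_infsum[OF summ]
    by (simp only: cinner_self of_real_eq_iff)
qed

lemma finite_sum_le_norm_square: "finite F \<Longrightarrow> (\<Sum>n\<in>F. (cmod (seq u n))\<^sup>2) \<le> (norm u)\<^sup>2"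
  using norm_square_seq[of u] by (intro finite_sum_le_has_sum) auto

lemma norm_square_finite:
  assumes "finite F" "\<And>n. n \<notin> F \<Longrightarrow> seq u n = 0"
  shows "(norm u)\<^sup>2 = (\<Sum>n\<in>F. (cmod (seq u n))\<^sup>2)"
proof -
  have "((\<lambda>n. (cmod (seq u n))\<^sup>2) has_sum (\<Sum>n\<in>F. (cmod (seq u n))\<^sup>2)) UNIV"
    using assms by (intro has_sum_finite_neutralI) auto
  then show ?thesis using norm_square_seq[of u] infsumI by metis
qed

lemma cinner_finite_left:
  assumes "finite F" "\<And>n. n \<notin> F \<Longrightarrow> seq u n = 0"
  shows "cinner u v = (\<Sum>n\<in>F. cnj (seq u n) * seq v n)"
proof -
  have "((\<lambda>n. cnj (seq u n) * seq v n) has_sum (\<Sum>n\<in>F. cnj (seq u n) * seq v n)) UNIV"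
    using assms by (intro has_sum_finite_neutralI) auto
  then show ?thesis unfolding cinner_def by (rule infsumI)
qed

lemma norm_coord_le: "cmod (seq u n) \<le> norm u"
  by (rule power2_le_imp_le) (use finite_sum_le_norm_square[of "{n}" u] in auto)

lemma bounded_linear_coord: "bounded_linear (\<lambda>u. seq u n)"
  by (rule bounded_linear_intro[of _ 1]) (auto simp: scaleR_conv_of_real norm_coord_le)

lemma seq_Abs_ell2: "(\<lambda>n. (cmod (f n))\<^sup>2) summable_on UNIV \<Longrightarrow> seq (Abs_ell2 f) = f"
  by (simp add: Abs_ell2_inverse)

lemma seq_Abs_ell2_finite:
  assumes "finite {n. f n \<noteq> 0}"
  shows "seq (Abs_ell2 f) = f"
proof (rule seq_Abs_ell2)
  have "(\<lambda>n. (cmod (f n))\<^sup>2) summable_on {n. f n \<noteq> 0}" by (intro summable_on_finite assms)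
  then show "(\<lambda>n. (cmod (f n))\<^sup>2) summable_on UNIV"
    by (rule summable_on_cong_neutral[THEN iffD1, rotated -1]) auto
qed

text \<open>Vectors that are given by a formula for their coordinates are obtained, together with a norm
  bound, from a bound on finite partial sums.\<close>

lemma ell2_of_bounded_sums:
  assumes "\<And>F. finite F \<Longrightarrow> (\<Sum>n\<in>F. (cmod (f n))\<^sup>2) \<le> C\<^sup>2" "0 \<le> C"
  obtains u where "seq u = f" "norm u \<le> C"
proof -
  have s: "(\<lambda>n. (cmod (f n))\<^sup>2) summable_on UNIV"
    using assms(1) by (intro nonneg_bdd_above_summable_on bdd_aboveI[of _ "C\<^sup>2"]) auto
  define u where "u = Abs_ell2 f"
  have u: "seq u = f" using seq_Abs_ell2[OF s] by (simp add: u_def)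
  have "(norm u)\<^sup>2 \<le> C\<^sup>2"
    using norm_square_seq[of u] unfolding u
    by (rule has_sum_le_finite_sums) (use assms in auto)
  then have "norm u \<le> C" using assms(2) by (rule power2_le_imp_le)
  with u that show ?thesis by blast
qed

definition unit_seq :: "'i \<Rightarrow> 'i ell2"
  where "unit_seq m = Abs_ell2 (\<lambda>n. if n = m then 1 else 0)"

lemma seq_unit_seq [simp]: "seq (unit_seq m) n = (if n = m then 1 else 0)"
  by (simp add: unit_seq_def seq_Abs_ell2_finite)

lemma unit_seq_compactly_supported [simp]: "unit_seq m \<in> compactly_supported"
  by (simp add: compactly_supported_def)

lemma cinner_unit_seq [simp]: "cinner (unit_seq m) v = seq v m" "cinner v (unit_seq m) = cnj (seq v m)"
proof -
  show "cinner (unit_seq m) v = seq v m" for v :: "'a ell2"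
    by (subst cinner_finite_left[of "{m}"]) auto
  then show "cinner v (unit_seq m) = cnj (seq v m)"
    by (subst cinner_commute) simp
qed

lemma compactly_supported_closed:
  "0 \<in> compactly_supported"
  "u \<in> compactly_supported \<Longrightarrow> v \<in> compactly_supported \<Longrightarrow> u + v \<in> compactly_supported"
  "u \<in> compactly_supported \<Longrightarrow> v \<in> compactly_supported \<Longrightarrow> u - v \<in> compactly_supported"
  "u \<in> compactly_supported \<Longrightarrow> c *\<^sub>C u \<in> compactly_supported"
  "u \<in> compactly_supported \<Longrightarrow> r *\<^sub>R u \<in> compactly_supported"
proof -
  assume "u \<in> compactly_supported" "v \<in> compactly_supported"
  then have "finite ({n. seq u n \<noteq> 0} \<union> {n. seq v n \<noteq> 0})" by (simp add: compactly_supported_def)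
  then show "u + v \<in> compactly_supported" "u - v \<in> compactly_supported"
    unfolding compactly_supported_def by (auto intro: rev_finite_subset)
qed (auto simp: compactly_supported_def intro: rev_finite_subset)

lemma compactly_supported_sum:
  "(\<And>i. i \<in> I \<Longrightarrow> u i \<in> compactly_supported) \<Longrightarrow> (\<Sum>i\<in>I. u i) \<in> compactly_supported"
  by (induction I rule: infinite_finite_induct) (auto intro: compactly_supported_closed)

lemma compactly_supported_expansion:
  assumes "u \<in> compactly_supported"
  shows "u = (\<Sum>n | seq u n \<noteq> 0. seq u n *\<^sub>C unit_seq n)"
  by (rule ell2_eqI) (use assms in \<open>auto simp: compactly_supported_def if_distrib sum.If_cases cong: if_cong\<close>)

definition truncate :: "'i set \<Rightarrow> 'i ell2 \<Rightarrow> 'i ell2"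
  where "truncate F u = Abs_ell2 (\<lambda>n. if n \<in> F then seq u n else 0)"

lemma seq_truncate [simp]: "seq (truncate F u) n = (if n \<in> F then seq u n else 0)"
proof -
  have "(\<lambda>n. (cmod (if n \<in> F then seq u n else 0))\<^sup>2) summable_on UNIV"
    by (rule summable_on_comparison_test[where f = "\<lambda>n. (cmod (seq u n))\<^sup>2"]) (use seq[of u] in auto)
  then show ?thesis unfolding truncate_def by (subst seq_Abs_ell2) auto
qed

lemma truncate_compactly_supported: "finite F \<Longrightarrow> truncate F u \<in> compactly_supported"
  by (simp add: compactly_supported_def)

lemma norm_square_truncate: "finite F \<Longrightarrow> (norm (truncate F u))\<^sup>2 = (\<Sum>n\<in>F. (cmod (seq u n))\<^sup>2)"
  by (subst norm_square_finite[of F]) auto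

lemma truncate_tendsto: "((\<lambda>F. truncate F u) \<longlongrightarrow> u) (finite_subsets_at_top UNIV)"
proof -
  have "((\<lambda>F. (norm u)\<^sup>2 - (\<Sum>n\<in>F. (cmod (seq u n))\<^sup>2)) \<longlongrightarrow> 0) (finite_subsets_at_top UNIV)"
    using tendsto_diff[OF tendsto_const norm_square_seq[of u, unfolded has_sum_def], of "(norm u)\<^sup>2"]
    by simp
  moreover have "\<forall>\<^sub>F F in finite_subsets_at_top UNIV.
      (norm u)\<^sup>2 - (\<Sum>n\<in>F. (cmod (seq u n))\<^sup>2) = (norm (truncate F u - u))\<^sup>2"
  proof (rule eventually_finite_subsets_at_top_weakI)
    fix F :: "'a set" assume F: "finite F"
    have o: "(u - truncate F u) \<bullet> truncate F u = 0"
      using cinner_commute[of "u - truncate F u" "truncate F u"]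
      by (simp add: inner_eq_Re_cinner cinner_finite_left[OF F])
    have "(norm u)\<^sup>2 = (norm (truncate F u))\<^sup>2 + (norm (u - truncate F u))\<^sup>2"
      using o unfolding power2_norm_eq_inner by (simp add: inner_diff_left inner_diff_right inner_commute)
    then show "(norm u)\<^sup>2 - (\<Sum>n\<in>F. (cmod (seq u n))\<^sup>2) = (norm (truncate F u - u))\<^sup>2"
      using F by (simp add: norm_square_truncate norm_minus_commute)
  qed
  ultimately have "((\<lambda>F. (norm (truncate F u - u))\<^sup>2) \<longlongrightarrow> 0) (finite_subsets_at_top UNIV)"
    by (rule Lim_transform_eventually)
  then have "((\<lambda>F. norm (truncate F u - u)) \<longlongrightarrow> 0) (finite_subsets_at_top UNIV)"
    using tendsto_real_sqrt by fastforce
  then show ?thesis by (simp add: LIM_zero_iff tendsto_norm_zero_iff)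
qed

lemma compactly_supported_approx:
  obtains X where "\<And>k :: nat. X k \<in> compactly_supported" "X \<longlonglongrightarrow> (u :: 'i ell2)"
proof -
  have "u \<in> closure compactly_supported"
    unfolding closure_approachable
  proof (intro allI impI)
    fix e :: real assume "0 < e"
    then have "\<forall>\<^sub>F F in finite_subsets_at_top UNIV. dist (truncate F u) u < e \<and> finite F"
      using truncate_tendsto[of u] by (intro eventually_conj) (auto simp: tendsto_iff eventually_finite_subsets_at_top_finite)
    then obtain F :: "'i set" where "dist (truncate F u) u < e" "finite F"
      using eventually_happens'[OF finite_subsets_at_top_neq_bot] by blast
    then show "\<exists>y\<in>compactly_supported. dist y u < e"
      by (auto intro: truncate_compactly_supported)
  qed
  then show ?thesis using that unfolding closure_sequential by blast
qed

lemma compactly_supported_dense: "closure compactly_supported = (UNIV :: 'i ell2 set)"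
  unfolding closure_sequential set_eq_iff using compactly_supported_approx by blast

text \<open>A closed condition holds everywhere once it holds for finitely supported sequences. Formulas that
  only make sense on finite supports, such as Fourier integrals, reach all of \<open>\<ell>\<^sup>2\<close> in this way.\<close>

lemma ell2_eq_on_dense:
  fixes f g :: "'i ell2 \<Rightarrow> 'b::t2_space"
  assumes "continuous_on UNIV f" "continuous_on UNIV g"
    and "\<And>u. u \<in> compactly_supported \<Longrightarrow> f u = g u"
  shows "f u = g u"
proof -
  have "closed {u. f u = g u}" by (rule closed_Collect_eq[OF assms(1,2)])
  then have "closure compactly_supported \<subseteq> {u. f u = g u}"
    using assms(3) by (intro closure_minimal) auto
  then show ?thesis unfolding compactly_supported_dense by auto
qed

lemma ell2_le_on_dense:
  fixes f g :: "'i ell2 \<Rightarrow> real"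
  assumes "continuous_on UNIV f" "continuous_on UNIV g"
    and "\<And>u. u \<in> compactly_supported \<Longrightarrow> f u \<le> g u"
  shows "f u \<le> g u"
proof -
  have "closed {u. f u \<le> g u}" by (rule closed_Collect_le[OF assms(1,2)])
  then have "closure compactly_supported \<subseteq> {u. f u \<le> g u}"
    using assms(3) by (intro closure_minimal) auto
  then show ?thesis unfolding compactly_supported_dense by auto
qed

subsection \<open>Bounded operators\<close>

lemma bounded_clinearD:
  assumes "bounded_clinear T"
  shows "bounded_linear T" "T (c *\<^sub>C u) = c *\<^sub>C T u" "T (u + v) = T u + T v" "T (u - v) = T u - T v"
    "T (r *\<^sub>R u) = r *\<^sub>R T u" "T 0 = 0"
proof -
  show T: "bounded_linear T" and "T (c *\<^sub>C u) = c *\<^sub>C T u" using assms by (auto simp: bounded_clinear_def)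
  interpret bounded_linear T by fact
  show "T (u + v) = T u + T v" "T (u - v) = T u - T v" "T (r *\<^sub>R u) = r *\<^sub>R T u" "T 0 = 0"
    by (simp_all add: add diff scaleR)
qed

lemma bounded_clinearI:
  assumes "\<And>u v. T (u + v) = T u + T v" "\<And>c u. T (c *\<^sub>C u) = c *\<^sub>C T u" "\<And>u. norm (T u) \<le> C * norm u"
  shows "bounded_clinear T"
  unfolding bounded_clinear_def using assms
  by (auto intro!: bounded_linear_intro[of T C] simp: scaleC_of_real[symmetric] mult.commute)

lemma bounded_clinear_continuous: "bounded_clinear T \<Longrightarrow> continuous_on S T"
  by (intro linear_continuous_on bounded_clinearD(1))

lemma bounded_clinear_tendsto: "bounded_clinear T \<Longrightarrow> (f \<longlongrightarrow> u) F \<Longrightarrow> ((\<lambda>x. T (f x)) \<longlongrightarrow> T u) F"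
  by (rule bounded_linear.tendsto[OF bounded_clinearD(1)])

lemma bounded_clinear_ident: "bounded_clinear (\<lambda>u. u)"
  by (rule bounded_clinearI[of _ 1]) auto

lemma bounded_clinear_comp: "bounded_clinear S \<Longrightarrow> bounded_clinear T \<Longrightarrow> bounded_clinear (\<lambda>u. S (T u))"
  unfolding bounded_clinear_def using bounded_linear_compose by auto

lemma bounded_clinear_add: "bounded_clinear S \<Longrightarrow> bounded_clinear T \<Longrightarrow> bounded_clinear (\<lambda>u. S u + T u)"
  unfolding bounded_clinear_def by (auto intro: bounded_linear_add simp: scaleC_add)

lemma bounded_clinear_diff: "bounded_clinear S \<Longrightarrow> bounded_clinear T \<Longrightarrow> bounded_clinear (\<lambda>u. S u - T u)"
  unfolding bounded_clinear_def by (auto intro: bounded_linear_sub simp: scaleC_diff)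

lemma bounded_clinear_scaleC: "bounded_clinear T \<Longrightarrow> bounded_clinear (\<lambda>u. c *\<^sub>C T u)"
  unfolding bounded_clinear_def
  by (auto intro: bounded_linear_compose[OF bounded_linear_scaleC] simp: mult.commute)

lemma bounded_clinear_scaleR: "bounded_clinear T \<Longrightarrow> bounded_clinear (\<lambda>u. r *\<^sub>R T u)"
  using bounded_clinear_scaleC[of T "of_real r"] by (simp add: scaleC_of_real)

lemma bounded_clinear_sum: "(\<And>i. i \<in> I \<Longrightarrow> bounded_clinear (T i)) \<Longrightarrow> bounded_clinear (\<lambda>u. \<Sum>i\<in>I. T i u)"
proof (induction I rule: infinite_finite_induct)
  case (insert i I)
  then show ?case by (simp add: bounded_clinear_add)
qed (auto intro: bounded_clinearI[of _ 0])

section \<open>Spectral measures of a bounded symmetric operator\<close>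

locale pvm =
  fixes P :: "real set \<Rightarrow> 'i ell2 \<Rightarrow> 'i ell2"
  assumes pvm: "projection_valued_measure P"
begin

lemma proj: "B \<in> sets borel \<Longrightarrow> orthogonal_projection (P B)"
  using pvm by (simp add: projection_valued_measure_def)

lemma clinear: "B \<in> sets borel \<Longrightarrow> bounded_clinear (P B)"
  using proj by (simp add: orthogonal_projection_def)

lemma idem: "B \<in> sets borel \<Longrightarrow> P B (P B u) = P B u"
  using proj by (simp add: orthogonal_projection_def)

lemma symmetric: "B \<in> sets borel \<Longrightarrow> cinner u (P B v) = cinner (P B u) v"
  using proj by (simp add: orthogonal_projection_def)

lemma P_UNIV: "P UNIV u = u"
  using pvm by (simp add: projection_valued_measure_def)

lemma P_sums:
  fixes F :: "nat \<Rightarrow> real set"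
  assumes "range F \<subseteq> sets borel" "disjoint_family F"
  shows "(\<lambda>k. P (F k) u) sums P (\<Union>k. F k) u"
  using assms pvm by (simp add: projection_valued_measure_def)

lemma P_empty: "P {} u = 0"
proof -
  have "(\<lambda>k :: nat. P {} u) sums P (\<Union>k :: nat. {}) u"
    by (rule P_sums) (auto simp: disjoint_family_on_def)
  then have "summable (\<lambda>k :: nat. P {} u)" by (rule sums_summable)
  then show ?thesis by (simp add: summable_const_iff)
qed

lemma P_union:
  assumes "B \<in> sets borel" "C \<in> sets borel" "B \<inter> C = {}"
  shows "P (B \<union> C) u = P B u + P C u"
proof -
  define F where "F k = (if k = 0 then B else if k = 1 then C else {})" for k :: nat
  have "(\<lambda>k. P (F k) u) sums P (\<Union>k. F k) u"
    by (rule P_sums) (use assms in \<open>auto simp: disjoint_family_on_def F_def split: if_splits\<close>)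
  moreover have "(\<Union>k. F k) = B \<union> C" by (auto simp: F_def split: if_splits)
  moreover have "(\<lambda>k. P (F k) u) sums (\<Sum>k\<in>{0, 1}. P (F k) u)"
    by (rule sums_finite) (auto simp: F_def P_empty)
  ultimately show ?thesis
    using sums_unique2 by (fastforce simp: F_def)
qed

lemma P_compl: "B \<in> sets borel \<Longrightarrow> P (- B) u = u - P B u"
  using P_union[of B "- B" u] by (simp add: P_UNIV eq_diff_eq add.commute)

text \<open>If two projections \<open>Q\<close>, \<open>R\<close> have a projection as their sum, then \<open>QR + RQ = 0\<close>. Multiplying by \<open>Q\<close>
  on either side gives \<open>QR = RQ\<close>, so both products vanish.\<close>

lemma P_disjoint:
  assumes B: "B \<in> sets borel" and C: "C \<in> sets borel" and d: "B \<inter> C = {}"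
  shows "P B (P C u) = 0"
proof -
  have BC: "B \<union> C \<in> sets borel" using B C by auto
  have *: "P B (P C v) + P C (P B v) = 0" for v
    using idem[OF BC, of v]
    by (simp add: P_union[OF B C d] bounded_clinearD(3)[OF clinear[OF B]]
        bounded_clinearD(3)[OF clinear[OF C]] idem B C algebra_simps)
  have 1: "P B (P C u) + P B (P C (P B u)) = 0"
    using arg_cong[OF *[of u], of "P B"]
    by (simp add: bounded_clinearD(3,6)[OF clinear[OF B]] idem[OF B])
  have 2: "P B (P C (P B u)) + P C (P B u) = 0"
    using *[of "P B u"] by (simp add: idem[OF B])
  have "P B (P C u) = P C (P B u)" using 1 2 by (metis add.commute add_left_cancel)
  then have "2 *\<^sub>R P B (P C u) = 0" using *[of u] by (simp add: scaleR_2)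
  then show ?thesis by simp
qed

lemma P_inter:
  assumes B: "B \<in> sets borel" and C: "C \<in> sets borel"
  shows "P B (P C u) = P (B \<inter> C) u"
proof -
  have "B = (B \<inter> C) \<union> (B - C)" "C = (B \<inter> C) \<union> (C - B)" by auto
  then have eqs: "P B v = P (B \<inter> C) v + P (B - C) v" "P C v = P (B \<inter> C) v + P (C - B) v" for v
    using P_union[of "B \<inter> C" "B - C" v] P_union[of "B \<inter> C" "C - B" v] B C by auto
  have BC: "B \<inter> C \<in> sets borel" "B - C \<in> sets borel" "C - B \<in> sets borel" using B C by auto
  have "P B (P C u) = P B (P (B \<inter> C) u) + P B (P (C - B) u)"
    by (simp add: eqs(2)[of u] bounded_clinearD(3)[OF clinear[OF B]])
  also have "P B (P (C - B) u) = 0" using B BC by (intro P_disjoint) auto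
  also have "P B (P (B \<inter> C) u) = P (B \<inter> C) (P (B \<inter> C) u) + P (B - C) (P (B \<inter> C) u)"
    by (rule eqs(1))
  also have "P (B - C) (P (B \<inter> C) u) = 0" using BC by (intro P_disjoint) auto
  finally show ?thesis using BC by (simp add: idem)
qed

lemma cinner_P: "B \<in> sets borel \<Longrightarrow> cinner u (P B u) = of_real ((norm (P B u))\<^sup>2)"
  using symmetric[of B u "P B u"] idem[of B u] cinner_self[of "P B u"] by simp

lemma norm_P_le: "B \<in> sets borel \<Longrightarrow> norm (P B u) \<le> norm u"
proof -
  assume B: "B \<in> sets borel"
  have "(norm (P B u))\<^sup>2 = cmod (cinner u (P B u))" by (simp add: cinner_P[OF B] norm_power)
  also have "\<dots> \<le> norm u * norm (P B u)" by (rule Cauchy_Schwarz_cinner)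
  finally show ?thesis by (cases "P B u = 0") (auto simp: power2_eq_square)
qed

lemma sets_diagonal [measurable_cong]: "sets (diagonal_measure P u) = sets borel"
  using sets.sigma_sets_eq[of "borel :: real measure"] by (simp add: diagonal_measure_def)

lemma space_diagonal [simp]: "space (diagonal_measure P u) = UNIV"
  using sets_eq_imp_space_eq[OF sets_diagonal] by simp

lemma emeasure_diagonal:
  assumes B: "B \<in> sets borel"
  shows "emeasure (diagonal_measure P u) B = ennreal ((norm (P B u))\<^sup>2)"
proof -
  have "emeasure (diagonal_measure P u) B = ennreal (Re (cinner u (P B u)))"
    unfolding diagonal_measure_def
  proof (rule emeasure_measure_of_sigma)
    show "sigma_algebra UNIV (sets (borel :: real measure))"
      using sets.sigma_algebra_axioms[of "borel :: real measure"] by simp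
    show "positive (sets borel) (\<lambda>B. ennreal (Re (cinner u (P B u))))"
      by (simp add: positive_def P_empty)
    show "countably_additive (sets borel) (\<lambda>B. ennreal (Re (cinner u (P B u))))"
    proof (rule countably_additiveI)
      fix F :: "nat \<Rightarrow> real set"
      assume F: "range F \<subseteq> sets borel" "disjoint_family F"
      have "(\<lambda>k. cinner u (P (F k) u)) sums cinner u (P (\<Union>k. F k) u)"
        using bounded_linear.sums[OF bounded_linear_cinner_right P_sums[OF F]] .
      then have "(\<lambda>k. Re (cinner u (P (F k) u))) sums Re (cinner u (P (\<Union>k. F k) u))"
        by (rule bounded_linear.sums[OF bounded_linear_Re])
      moreover have "0 \<le> Re (cinner u (P (F k) u))" for k
        using F by (subst cinner_P) auto
      ultimately show "(\<Sum>k. ennreal (Re (cinner u (P (F k) u)))) = ennreal (Re (cinner u (P (\<Union>k. F k) u)))"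
        by (intro suminf_ennreal_eq) auto
    qed
    show "B \<in> sets borel" by fact
  qed
  then show ?thesis using B by (simp add: cinner_P)
qed

lemma finite_measure_diagonal: "finite_measure (diagonal_measure P u)"
  by (rule finite_measureI) (simp add: emeasure_diagonal)

lemma measure_diagonal: "B \<in> sets borel \<Longrightarrow> measure (diagonal_measure P u) B = (norm (P B u))\<^sup>2"
  by (simp add: measure_def emeasure_diagonal)

text \<open>Projecting the vector restricts its measure to \<^term>\<open>B\<close>; integrals over the projected vector are
  thereby integrals over \<^term>\<open>B\<close>.\<close>

lemma diagonal_measure_P:
  assumes B: "B \<in> sets borel"
  shows "diagonal_measure P (P B u) = density (diagonal_measure P u) (indicator B)"
proof (rule measure_eqI)
  fix C assume "C \<in> sets (diagonal_measure P (P B u))"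
  then have C: "C \<in> sets borel" by (simp add: sets_diagonal)
  have "emeasure (density (diagonal_measure P u) (indicator B)) C
      = (\<integral>\<^sup>+x. indicator B x * indicator C x \<partial>diagonal_measure P u)"
    using B C by (subst emeasure_density) (auto simp: sets_diagonal)
  also have "\<dots> = (\<integral>\<^sup>+x. indicator (C \<inter> B) x \<partial>diagonal_measure P u)"
    by (rule nn_integral_cong) (auto simp: indicator_def)
  also have "\<dots> = emeasure (diagonal_measure P u) (C \<inter> B)"
    using B C by (subst nn_integral_indicator) (auto simp: sets_diagonal)
  finally show "emeasure (diagonal_measure P (P B u)) C = emeasure (density (diagonal_measure P u) (indicator B)) C"
    using B C by (simp add: emeasure_diagonal P_inter)
qed (simp add: sets_diagonal)

end

locale spectral_resolution =
  fixes T :: "'i ell2 \<Rightarrow> 'i ell2" and P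
  assumes T: "bounded_clinear T"
    and T_symmetric: "\<And>u v. cinner u (T v) = cinner (T u) v"
    and spectral: "is_spectral_measure T P"
begin

sublocale pvm P
  using spectral by unfold_locales (simp add: is_spectral_measure_def)

lemma integrable_diagonal: "integrable (diagonal_measure P u) (\<lambda>x. x)"
  and cinner_T: "cinner u (T u) = of_real (\<integral>x. x \<partial>diagonal_measure P u)"
  using spectral by (auto simp: is_spectral_measure_def)

lemma cinner_T_P:
  assumes B: "B \<in> sets borel"
  shows "cinner (P B u) (T (P B u)) = of_real (\<integral>x. indicator B x * x \<partial>diagonal_measure P u)"
    "integrable (diagonal_measure P u) (\<lambda>x. indicator B x * x)"
proof -
  have ind: "(\<lambda>x. ennreal (indicat_real B x)) = indicator B" by (simp add: fun_eq_iff indicator_def)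
  have d: "diagonal_measure P (P B u) = density (diagonal_measure P u) (\<lambda>x. ennreal (indicat_real B x))"
    unfolding ind by (rule diagonal_measure_P[OF B])
  have [measurable]: "indicat_real B \<in> borel_measurable (diagonal_measure P u)"
    "(\<lambda>x. x) \<in> borel_measurable (diagonal_measure P u)"
    using B by (auto simp: sets_diagonal intro!: borel_measurable_indicator measurable_ident_sets)
  show "cinner (P B u) (T (P B u)) = of_real (\<integral>x. indicator B x * x \<partial>diagonal_measure P u)"
    unfolding cinner_T d by (subst integral_density) auto
  show "integrable (diagonal_measure P u) (\<lambda>x. indicator B x * x)"
    using integrable_diagonal[of "P B u"] unfolding d by (subst (asm) integrable_density) auto
qed

text \<open>The quadratic form of \<^term>\<open>T\<close> splits along a spectral projection, because the diagonal measures do;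
  polarizing with the phases \<open>1\<close> and \<open>\<i>\<close> removes the off-diagonal part of \<^term>\<open>T\<close>.\<close>

lemma off_diagonal:
  assumes B: "B \<in> sets borel"
  shows "cinner (P B u) (T (P (- B) v)) = 0"
proof -
  have nB: "- B \<in> sets borel" using B by simp
  have split: "cinner a (T b) + cinner b (T a) = 0" if a: "P B a = a" and b: "P (- B) b = b" for a b
  proof -
    have "P B b = 0" "P (- B) a = 0"
      using P_disjoint[OF B nB, of b] P_disjoint[OF nB B, of a] a b by auto
    then have ab: "P B (a + b) = a" "P (- B) (a + b) = b"
      using a b by (simp_all add: bounded_clinearD(3)[OF clinear[OF B]] bounded_clinearD(3)[OF clinear[OF nB]])
    have "cinner (a + b) (T (a + b)) = of_real (\<integral>x. indicator B x * x + indicator (- B) x * x \<partial>diagonal_measure P (a + b))"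
      unfolding cinner_T by (intro arg_cong[where f = of_real] Bochner_Integration.integral_cong) (auto simp: indicator_def)
    also have "\<dots> = cinner a (T a) + cinner b (T b)"
      using cinner_T_P[OF B, of "a + b"] cinner_T_P[OF nB, of "a + b"] by (simp add: ab)
    finally show ?thesis
      by (simp add: cinner_add bounded_clinearD(3)[OF T] add.commute)
  qed
  define a b where "a = P B u" and "b = P (- B) v"
  have ab: "P B a = a" "P (- B) b = b" using B nB by (auto simp: a_def b_def idem)
  have ib: "P (- B) (\<i> *\<^sub>C b) = \<i> *\<^sub>C b"
    using ab by (simp add: bounded_clinearD(2)[OF clinear[OF nB]])
  have "cinner a (T b) + cinner b (T a) = 0" by (rule split[OF ab])
  moreover have "\<i> * cinner a (T b) - \<i> * cinner b (T a) = 0"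
    using split[OF ab(1) ib] by (simp add: bounded_clinearD(2)[OF T])
  then have "cinner a (T b) = cinner b (T a)" by simp
  ultimately show ?thesis unfolding a_def b_def by simp
qed

lemma P_commute:
  assumes B: "B \<in> sets borel"
  shows "T (P B u) = P B (T u)"
proof -
  have nB: "- B \<in> sets borel" using B by simp
  have *: "P C (T (P (- C) v)) = 0" if "C \<in> sets borel" for C v
  proof -
    have "cinner (P C (T (P (- C) v))) (P C (T (P (- C) v))) = 0"
      using off_diagonal[OF that, of "T (P (- C) v)" v] by (simp add: symmetric that idem)
    then show ?thesis by (simp add: cinner_self)
  qed
  have "P B (T u) = P B (T (P B u)) + P B (T (P (- B) u))"
    by (simp add: P_compl[OF B] bounded_clinearD[OF T] bounded_clinearD[OF clinear[OF B]])
  also have "\<dots> = P B (T (P B u))" using *[OF B] by simp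
  also have "\<dots> = T (P B u) - P (- B) (T (P B u))" by (simp add: P_compl[OF B])
  also have "P (- B) (T (P B u)) = 0" using *[OF nB] by simp
  finally show ?thesis by simp
qed

lemma form_bounds:
  assumes B: "B \<in> sets borel" and w: "P B w = w"
  shows "(\<And>x. x \<in> B \<Longrightarrow> x \<le> c) \<Longrightarrow> w \<bullet> T w \<le> c * (norm w)\<^sup>2"
    and "(\<And>x. x \<in> B \<Longrightarrow> c \<le> x) \<Longrightarrow> c * (norm w)\<^sup>2 \<le> w \<bullet> T w"
proof -
  let ?M = "diagonal_measure P w"
  interpret M: finite_measure ?M by (rule finite_measure_diagonal)
  have "emeasure ?M (- B) = 0"
    using B w by (simp add: emeasure_diagonal P_compl)
  then have AE: "AE x in ?M. x \<in> B"
    using B by (intro AE_I[of _ _ "- B"]) (auto simp: sets_diagonal)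
  have f: "w \<bullet> T w = (\<integral>x. x \<partial>?M)" by (simp add: inner_eq_Re_cinner cinner_T)
  have m: "measure ?M UNIV = (norm w)\<^sup>2" by (simp add: measure_diagonal P_UNIV)
  show "w \<bullet> T w \<le> c * (norm w)\<^sup>2" if "\<And>x. x \<in> B \<Longrightarrow> x \<le> c"
  proof -
    have "(\<integral>x. x \<partial>?M) \<le> (\<integral>x. c \<partial>?M)"
      using integrable_diagonal AE that by (intro integral_mono_AE) (auto elim: eventually_mono)
    then show ?thesis by (simp add: f m mult.commute)
  qed
  show "c * (norm w)\<^sup>2 \<le> w \<bullet> T w" if "\<And>x. x \<in> B \<Longrightarrow> c \<le> x"
  proof -
    have "(\<integral>x. c \<partial>?M) \<le> (\<integral>x. x \<partial>?M)"
      using integrable_diagonal AE that by (intro integral_mono_AE) (auto elim: eventually_mono)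
    then show ?thesis by (simp add: f m mult.commute)
  qed
qed

text \<open>On the range of \<open>1\<^sub>I(T)\<close> the operator \<open>T - c\<close> is at most the half-length of \<open>I\<close>: there its
  quadratic form is, and a symmetric operator is bounded by its quadratic form.\<close>

lemma norm_T_minus_le:
  assumes w: "P {c - r<..<c + r} w = w" and r: "0 < r"
  shows "norm (T w - c *\<^sub>R w) \<le> r * norm w"
proof -
  let ?I = "{c - r<..<c + r}"
  let ?S = "\<lambda>u. T u - c *\<^sub>R u"
  have I: "?I \<in> sets borel" by simp
  have S_sym: "u \<bullet> ?S v = ?S u \<bullet> v" for u v
    using arg_cong[OF T_symmetric[of u v], of Re]
    by (simp add: inner_diff inner_eq_Re_cinner[symmetric])
  have S_lin: "?S (u + v) = ?S u + ?S v" "?S (u - v) = ?S u - ?S v" "?S (t *\<^sub>R u) = t *\<^sub>R ?S u" for u v t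
    by (simp_all add: bounded_clinearD[OF T] algebra_simps)
  have form: "\<bar>v \<bullet> ?S v\<bar> \<le> r * (norm v)\<^sup>2" if "P ?I v = v" for v
    using form_bounds(1)[OF I that, of "c + r"] form_bounds(2)[OF I that, of "c - r"]
    by (simp add: inner_diff power2_norm_eq_inner algebra_simps abs_le_iff)
  have inv: "P ?I (?S w) = ?S w"
    using P_commute[OF I, of w] w by (simp add: bounded_clinearD[OF clinear[OF I]])
  \<comment> \<open>Scaling both vectors to the same norm makes the polarization estimate sharp.\<close>
  define x y where "x = norm (?S w) *\<^sub>R w" and "y = norm w *\<^sub>R ?S w"
  have xy: "P ?I x = x" "P ?I y = y"
    using w inv by (simp_all only: x_def y_def bounded_clinearD[OF clinear[OF I]])
  have "4 * (y \<bullet> ?S x) = (x + y) \<bullet> ?S (x + y) - (x - y) \<bullet> ?S (x - y)"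
    using S_sym[of x y] by (simp only: S_lin) (simp add: inner_add inner_diff inner_commute algebra_simps)
  also have "\<dots> \<le> r * (norm (x + y))\<^sup>2 + r * (norm (x - y))\<^sup>2"
    using form[of "x + y"] form[of "x - y"] xy
    by (simp add: bounded_clinearD[OF clinear[OF I]])
  also have "\<dots> = 2 * r * ((norm x)\<^sup>2 + (norm y)\<^sup>2)"
    by (simp add: power2_norm_eq_inner inner_add inner_diff inner_commute algebra_simps)
  also have "\<dots> = 4 * (r * (norm (?S w) * norm w)\<^sup>2)"
    by (simp add: x_def y_def power_mult_distrib)
  also have "y \<bullet> ?S x = norm w * norm (?S w) * (norm (?S w))\<^sup>2"
    unfolding x_def y_def by (simp only: S_lin(3)) (simp add: power2_norm_eq_inner)
  finally have "((norm (?S w))\<^sup>2 * norm w) * norm (?S w) \<le> ((norm (?S w))\<^sup>2 * norm w) * (r * norm w)"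
    by (simp add: power2_eq_square mult_ac)
  then show ?thesis
    using r by (cases "?S w = 0 \<or> w = 0") (auto simp: bounded_clinearD[OF T] mult_le_cancel_left)
qed

text \<open>Approximate eigenvectors are almost contained in the spectral subspace: off \<open>I\<close> the operator
  \<open>T - E\<close> is bounded below.\<close>

lemma norm_minus_P_le:
  assumes E: "a < E" "E < b" and \<delta>: "0 < \<delta>" "\<delta> \<le> E - a" "\<delta> \<le> b - E"
  shows "\<delta> * norm (u - P {a<..<b} u) \<le> norm (T u - E *\<^sub>R u)"
proof -
  have sets: "{..a} \<in> sets borel" "{b..} \<in> sets borel" "{a<..<b} \<in> sets borel" by auto
  define x y where "x = P {..a} u" and "y = P {b..} u"
  have "- {a<..<b} = {..a} \<union> {b..}" and disj: "{..a} \<inter> {b..} = {}" using E by auto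
  then have w: "u - P {a<..<b} u = x + y"
    using P_compl[OF sets(3), of u] P_union[OF sets(1,2), of u] by (simp add: x_def y_def)
  have px: "P {..a} x = x" and py: "P {b..} y = y" by (simp_all add: x_def y_def idem)
  let ?S = "\<lambda>u. T u - E *\<^sub>R u"
  have inv: "P B (?S v) = ?S (P B v)" if "B \<in> sets borel" for B v
    using that by (simp add: P_commute bounded_clinearD[OF clinear[OF that]])
  have orth: "P {..a} v \<bullet> P {b..} v' = 0" for v v'
    using symmetric[OF sets(1), of v "P {b..} v'"] P_disjoint[OF sets(1,2) disj, of v']
    by (simp add: inner_eq_Re_cinner)
  have low: "\<delta> * norm v \<le> norm (?S v)" if "\<delta> * (norm v)\<^sup>2 \<le> \<bar>v \<bullet> ?S v\<bar>" for v
  proof -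
    have "norm v * (\<delta> * norm v) \<le> norm v * norm (?S v)"
      using that Cauchy_Schwarz_ineq2[of v "?S v"] by (simp add: power2_eq_square mult_ac)
    then show ?thesis using \<delta> by (cases "v = 0") auto
  qed
  have "x \<bullet> T x \<le> a * (norm x)\<^sup>2" by (rule form_bounds(1)[OF sets(1) px]) auto
  moreover have "\<delta> * (norm x)\<^sup>2 \<le> (E - a) * (norm x)\<^sup>2" using \<delta> by (intro mult_right_mono) auto
  ultimately have lx: "\<delta> * norm x \<le> norm (?S x)"
    by (intro low) (simp add: inner_diff power2_norm_eq_inner algebra_simps)
  have "b * (norm y)\<^sup>2 \<le> y \<bullet> T y" by (rule form_bounds(2)[OF sets(2) py]) auto
  moreover have "\<delta> * (norm y)\<^sup>2 \<le> (b - E) * (norm y)\<^sup>2" using \<delta> by (intro mult_right_mono) auto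
  ultimately have ly: "\<delta> * norm y \<le> norm (?S y)"
    by (intro low) (simp add: inner_diff power2_norm_eq_inner algebra_simps)
  have pyth: "(norm (v + v'))\<^sup>2 = (norm v)\<^sup>2 + (norm v')\<^sup>2" if "v \<bullet> v' = 0" for v v' :: "'i ell2"
    using that by (simp add: power2_norm_eq_inner inner_add inner_commute)
  have "(\<delta> * norm (x + y))\<^sup>2 = (\<delta> * norm x)\<^sup>2 + (\<delta> * norm y)\<^sup>2"
    using pyth[of x y] orth by (simp add: x_def y_def power_mult_distrib algebra_simps)
  also have "\<dots> \<le> (norm (?S x))\<^sup>2 + (norm (?S y))\<^sup>2"
    using lx ly \<delta> by (intro add_mono power_mono) auto
  also have "\<dots> = (norm (?S x + ?S y))\<^sup>2"
    using pyth[of "?S x" "?S y"] orth[of "?S u" "?S u"] inv[OF sets(1)] inv[OF sets(2)]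
    by (simp add: x_def y_def)
  also have "?S x + ?S y = ?S u - P {a<..<b} (?S u)"
  proof -
    have "?S x + ?S y = ?S (x + y)" by (simp add: bounded_clinearD[OF T] algebra_simps)
    also have "\<dots> = ?S u - ?S (P {a<..<b} u)"
      unfolding w[symmetric] by (simp add: bounded_clinearD[OF T] algebra_simps)
    finally show ?thesis by (simp add: inv)
  qed
  also have "\<dots> = P (- {a<..<b}) (?S u)" by (simp add: P_compl)
  also have "(norm \<dots>)\<^sup>2 \<le> (norm (?S u))\<^sup>2" by (intro power_mono norm_P_le) auto
  finally have "\<delta> * norm (x + y) \<le> norm (?S u)" by (rule power2_le_imp_le) simp
  then show ?thesis by (simp add: w)
qed

end

section \<open>Fourier analysis of finitely supported sequences\<close>

text \<open>Angles are measured in full turns, so that the torus has total mass \<open>1\<close> and the characters are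
  orthonormal.\<close>

definition torus :: "('d::finite \<Rightarrow> real) measure"
  where "torus = Pi\<^sub>M UNIV (\<lambda>_. restrict_space lborel {0..1})"

definition char :: "int ^ 'd \<Rightarrow> ('d::finite \<Rightarrow> real) \<Rightarrow> complex"
  where "char n \<theta> = (\<Prod>i\<in>UNIV. cis (2 * pi * of_int (n $ i) * \<theta> i))"

lemma emeasure_unit_interval [simp]: "emeasure (restrict_space lborel {0..1::real}) {0..1} = 1"
  by (simp add: emeasure_restrict_space)

lemma product_sigma_finite_unit_interval: "product_sigma_finite (\<lambda>_ :: 'd. restrict_space lborel {0..1::real})"
proof (rule product_sigma_finite.intro)
  have "finite_measure (restrict_space lborel {0..1::real})"
    by (rule finite_measureI) simp
  then show "sigma_finite_measure (restrict_space lborel {0..1::real})"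
    by (rule finite_measure.axioms)
qed

lemma emeasure_torus: "emeasure torus (space (torus :: ('d::finite \<Rightarrow> real) measure)) = 1"
proof -
  interpret product_sigma_finite "\<lambda>_ :: 'd. restrict_space lborel {0..1::real}"
    by (rule product_sigma_finite_unit_interval)
  show ?thesis
    using emeasure_PiM[of "UNIV :: 'd set" "\<lambda>_. space (restrict_space lborel {0..1::real})"]
    sets.top[of "restrict_space lborel {0..1::real}"]
    by (simp add: torus_def space_PiM)
qed

lemma finite_measure_torus: "finite_measure torus"
  by (rule finite_measureI) (simp add: emeasure_torus)

lemma coordinate_measurable [measurable]: "(\<lambda>\<theta>. \<theta> i) \<in> borel_measurable torus"
proof -
  have "(\<lambda>\<theta>. \<theta> i) \<in> torus \<rightarrow>\<^sub>M restrict_space lborel {0..1}"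
    unfolding torus_def by (rule measurable_component_singleton) simp
  then have "(\<lambda>\<theta>. (\<lambda>x. x) (\<theta> i)) \<in> borel_measurable torus"
    by (rule measurable_compose) (auto intro: measurable_restrict_space1)
  then show ?thesis .
qed

lemma cis_measurable [measurable]: "cis \<in> borel_measurable borel"
  by (intro borel_measurable_continuous_onI continuous_intros)

lemma cnj_measurable [measurable]: "cnj \<in> borel_measurable borel"
  by (intro borel_measurable_continuous_onI continuous_intros)

lemma char_measurable [measurable]: "char n \<in> borel_measurable torus"
  unfolding char_def by measurable

lemma char_zero [simp]: "char 0 \<theta> = 1"
  by (simp add: char_def)

lemma char_add: "char (m + n) \<theta> = char m \<theta> * char n \<theta>"
  by (simp add: char_def prod.distrib[symmetric] cis_mult algebra_simps)

lemma norm_char [simp]: "cmod (char n \<theta>) = 1"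
  by (simp add: char_def flip: prod_norm)

lemma cnj_char: "cnj (char n \<theta>) = char (- n) \<theta>"
  by (simp add: char_def cnj_prod cis_cnj)

lemma char_axis: "char (axis i k) \<theta> = cis (2 * pi * of_int k * \<theta> i)"
proof -
  have "char (axis i k) \<theta> = (\<Prod>j\<in>UNIV. if j = i then cis (2 * pi * of_int k * \<theta> i) else 1)"
    unfolding char_def by (rule prod.cong) (auto simp: axis_def)
  then show ?thesis by simp
qed

lemma integral_cis:
  "(\<integral>x. cis (2 * pi * of_int k * x) \<partial>restrict_space lborel {0..1}) = (if k = 0 then 1 else 0)"
proof -
  have *: "(\<integral>x. cis (2 * pi * of_int k * x) \<partial>restrict_space lborel {0..1})
      = (\<integral>x. indicator {0..1} x *\<^sub>R cis (2 * pi * of_int k * x) \<partial>lborel)"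
    by (rule integral_restrict_space) simp
  show ?thesis
  proof (cases "k = 0")
    case True
    then show ?thesis unfolding * by simp
  next
    case False
    define a where "a = 2 * pi * of_int k * \<i>"
    have a: "a \<noteq> 0" using False by (simp add: a_def)
    have cis: "cis (2 * pi * of_int k * x) = exp (a * of_real x)" for x
      by (simp add: cis_conv_exp a_def mult_ac)
    have "(\<integral>x. indicator {0..1} x *\<^sub>R exp (a * of_real x) \<partial>lborel)
        = exp (a * of_real 1) / a - exp (a * of_real 0) / a"
    proof (rule integral_FTC_atLeastAtMost)
      show "((\<lambda>x. exp (a * of_real x) / a) has_vector_derivative exp (a * of_real x)) (at x within {0..1})" for x
        by (rule has_vector_derivative_real_field) (use a in \<open>auto intro!: derivative_eq_intros\<close>)
      show "continuous_on {0..1} (\<lambda>x. exp (a * complex_of_real x))" by (intro continuous_intros)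
    qed simp
    also have "\<dots> = 0"
      using cis[of 1] cis_multiple_2pi[of "of_int k"] by (simp add: mult_ac)
    finally show ?thesis unfolding * unfolding cis using False by simp
  qed
qed

lemma integral_char:
  fixes n :: "int ^ 'd::finite"
  shows "(\<integral>\<theta>. char n \<theta> \<partial>torus) = (if n = 0 then 1 else 0)"
proof -
  interpret product_sigma_finite "\<lambda>_ :: 'd. restrict_space lborel {0..1::real}"
    by (rule product_sigma_finite_unit_interval)
  interpret U: finite_measure "restrict_space lborel {0..1::real}"
    by (rule finite_measureI) simp
  have "(\<integral>\<theta>. char n \<theta> \<partial>torus) = (\<Prod>i\<in>UNIV. \<integral>x. cis (2 * pi * of_int (n $ i) * x) \<partial>restrict_space lborel {0..1})"
    unfolding torus_def char_def
  proof (rule product_integral_prod)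
    show "integrable (restrict_space lborel {0..1}) (\<lambda>x. cis (2 * pi * of_int (n $ i) * x))" for i
      by (rule U.integrable_const_bound[of _ 1]) (auto intro!: measurable_restrict_space1)
  qed simp
  also have "\<dots> = (\<Prod>i\<in>UNIV. if n $ i = 0 then 1 else 0)" by (simp add: integral_cis)
  also have "\<dots> = (if n = 0 then 1 else 0)"
    by (auto simp: vec_eq_iff prod_zero_iff)
  finally show ?thesis .
qed

lemma integrable_torus:
  fixes f :: "('d::finite \<Rightarrow> real) \<Rightarrow> 'b::{banach, second_countable_topology}"
  assumes "f \<in> borel_measurable torus" "\<And>\<theta>. norm (f \<theta>) \<le> C"
  shows "integrable torus f"
  by (rule finite_measure.integrable_const_bound[OF finite_measure_torus _ assms(1), of C]) (simp add: assms(2))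

text \<open>The Fourier transform of a finitely supported sequence. The sum has the default value \<open>0\<close> when the
  support is infinite.\<close>

definition hat :: "(int ^ 'd::finite) ell2 \<Rightarrow> ('d \<Rightarrow> real) \<Rightarrow> complex"
  where "hat u \<theta> = (\<Sum>n | seq u n \<noteq> 0. seq u n * char n \<theta>)"

lemma hat_superset:
  assumes "finite F" "\<And>n. n \<notin> F \<Longrightarrow> seq u n = 0"
  shows "hat u \<theta> = (\<Sum>n\<in>F. seq u n * char n \<theta>)"
  unfolding hat_def by (rule sum.mono_neutral_left) (use assms in auto)

lemma hat_measurable [measurable]: "hat u \<in> borel_measurable torus"
  unfolding hat_def[abs_def] by measurable

lemma norm_hat_le: "cmod (hat u \<theta>) \<le> (\<Sum>n | seq u n \<noteq> 0. cmod (seq u n))"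
  unfolding hat_def by (rule order_trans[OF norm_sum]) (simp add: norm_mult)

lemma hat_add:
  assumes "u \<in> compactly_supported" "v \<in> compactly_supported"
  shows "hat (u + v) \<theta> = hat u \<theta> + hat v \<theta>"
proof -
  define F where "F = {n. seq u n \<noteq> 0} \<union> {n. seq v n \<noteq> 0}"
  have F: "finite F" using assms by (simp add: F_def compactly_supported_def)
  show ?thesis
    by (subst (1 2 3) hat_superset[OF F]) (auto simp: F_def sum.distrib[symmetric] algebra_simps)
qed

lemma hat_scaleC: "hat (c *\<^sub>C u) \<theta> = c * hat u \<theta>"
proof (cases "c = 0")
  case False
  then show ?thesis by (simp add: hat_def sum_distrib_left mult.assoc)
qed (simp add: hat_def)

lemma hat_scaleR: "hat (r *\<^sub>R u) \<theta> = of_real r * hat u \<theta>"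
  by (simp add: scaleC_of_real[symmetric] hat_scaleC)

lemma hat_zero [simp]: "hat 0 \<theta> = 0"
  by (simp add: hat_def)

lemma hat_diff:
  assumes "u \<in> compactly_supported" "v \<in> compactly_supported"
  shows "hat (u - v) \<theta> = hat u \<theta> - hat v \<theta>"
proof -
  have "u - v = u + (-1) *\<^sub>R v" by simp
  then show ?thesis using hat_add[of u "(-1) *\<^sub>R v" \<theta>] assms
    by (simp only: hat_scaleR compactly_supported_closed) simp
qed

lemma hat_sum:
  assumes "\<And>i. i \<in> I \<Longrightarrow> u i \<in> compactly_supported"
  shows "hat (\<Sum>i\<in>I. u i) \<theta> = (\<Sum>i\<in>I. hat (u i) \<theta>)"
  using assms
proof (induction I rule: infinite_finite_induct)
  case (insert i I)
  then show ?case by (simp add: hat_add compactly_supported_sum)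
qed auto

lemma shift_compactly_supported: "u \<in> compactly_supported \<Longrightarrow> shift_ell2 i k u \<in> compactly_supported"
proof -
  assume "u \<in> compactly_supported"
  then have "finite ((\<lambda>n. n + axis i k) ` {n. seq u n \<noteq> 0})" by (simp add: compactly_supported_def)
  moreover have "{n. seq (shift_ell2 i k u) n \<noteq> 0} \<subseteq> (\<lambda>n. n + axis i k) ` {n. seq u n \<noteq> 0}"
  proof
    fix n assume "n \<in> {n. seq (shift_ell2 i k u) n \<noteq> 0}"
    then show "n \<in> (\<lambda>n. n + axis i k) ` {n. seq u n \<noteq> 0}"
      by (intro image_eqI[of _ _ "n - axis i k"]) (auto simp: shift_ell2.rep_eq shift_def)
  qed
  ultimately show ?thesis unfolding compactly_supported_def by (auto intro: finite_subset)
qed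

lemma seq_shift [simp]: "seq (shift_ell2 i k u) n = seq u (n - axis i k)"
  by (simp add: shift_ell2.rep_eq shift_def)

lemma hat_shift: "hat (shift_ell2 i k u) \<theta> = char (axis i k) \<theta> * hat u \<theta>"
proof -
  have "hat (shift_ell2 i k u) \<theta> = (\<Sum>n | seq u n \<noteq> 0. seq u n * char (n + axis i k) \<theta>)"
    unfolding hat_def
    by (rule sum.reindex_bij_witness[of _ "\<lambda>n. n + axis i k" "\<lambda>n. n - axis i k"]) auto
  then show ?thesis by (simp add: char_add hat_def sum_distrib_left mult_ac)
qed

definition energy_symbol :: "('d::finite \<Rightarrow> real) \<Rightarrow> real"
  where "energy_symbol \<theta> = (\<Sum>i\<in>UNIV. cos (2 * pi * \<theta> i))"

lemma energy_symbol_measurable [measurable]: "energy_symbol \<in> borel_measurable torus"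
  unfolding energy_symbol_def by measurable

lemma abs_energy_symbol_le: "\<bar>energy_symbol (\<theta> :: 'd::finite \<Rightarrow> real)\<bar> \<le> real CARD('d)"
  unfolding energy_symbol_def by (rule order_trans[OF sum_abs], rule sum_bounded_above[of _ _ 1, simplified]) simp

lemma laplacian_compactly_supported: "u \<in> compactly_supported \<Longrightarrow> laplacian u \<in> compactly_supported"
  unfolding laplacian_def by (intro compactly_supported_sum compactly_supported_closed shift_compactly_supported)

lemma cis_add_cis_minus: "cis t + cis (- t) = of_real (2 * cos t)"
  by (simp add: complex_eq_iff)

lemma hat_laplacian:
  assumes "u \<in> compactly_supported"
  shows "hat (laplacian u) \<theta> = energy_symbol \<theta> * hat u \<theta>"
proof -
  have "hat (laplacian u) \<theta> = (\<Sum>i\<in>UNIV. hat ((1/2) *\<^sub>R (shift_ell2 i 1 u + shift_ell2 i (-1) u)) \<theta>)"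
    unfolding laplacian_def
    by (intro hat_sum compactly_supported_closed shift_compactly_supported assms)
  also have "\<dots> = (\<Sum>i\<in>UNIV. of_real (1/2) * (char (axis i 1) \<theta> + char (axis i (-1)) \<theta>) * hat u \<theta>)"
    by (intro sum.cong refl) (simp only: hat_scaleR hat_add hat_shift shift_compactly_supported assms distrib_right mult.assoc)
  also have "\<dots> = (\<Sum>i\<in>UNIV. of_real (cos (2 * pi * \<theta> i)) * hat u \<theta>)"
  proof (rule sum.cong[OF refl])
    fix i
    show "of_real (1/2) * (char (axis i 1) \<theta> + char (axis i (-1)) \<theta>) * hat u \<theta> = of_real (cos (2 * pi * \<theta> i)) * hat u \<theta>"
      using cis_add_cis_minus[of "2 * pi * \<theta> i"] by (simp add: char_axis)
  qed
  finally show ?thesis by (simp add: energy_symbol_def sum_distrib_right)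
qed

lemma integral_trig_polynomial:
  assumes "finite F" "finite G"
  shows "(\<integral>\<theta>. cnj (\<Sum>m\<in>F. a m * char m \<theta>) * (\<Sum>n\<in>G. b n * char n \<theta>) \<partial>torus)
    = (\<Sum>n\<in>F \<inter> G. cnj (a n) * b n)"
proof -
  have "(\<integral>\<theta>. cnj (\<Sum>m\<in>F. a m * char m \<theta>) * (\<Sum>n\<in>G. b n * char n \<theta>) \<partial>torus)
      = (\<integral>\<theta>. (\<Sum>m\<in>F. \<Sum>n\<in>G. (cnj (a m) * b n) * char (n - m) \<theta>) \<partial>torus)"
  proof (intro Bochner_Integration.integral_cong refl)
    fix \<theta> :: "'a \<Rightarrow> real"
    have "cnj (a m * char m \<theta>) * (b n * char n \<theta>) = (cnj (a m) * b n) * char (n - m) \<theta>" for m n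
      using char_add[of n "- m" \<theta>] by (simp add: cnj_char)
    then show "cnj (\<Sum>m\<in>F. a m * char m \<theta>) * (\<Sum>n\<in>G. b n * char n \<theta>)
        = (\<Sum>m\<in>F. \<Sum>n\<in>G. (cnj (a m) * b n) * char (n - m) \<theta>)"
      by (simp only: cnj_sum sum_product)
  qed
  also have "\<dots> = (\<Sum>m\<in>F. \<Sum>n\<in>G. (cnj (a m) * b n) * (\<integral>\<theta>. char (n - m) \<theta> \<partial>torus))"
    by (subst Bochner_Integration.integral_sum | intro sum.cong refl Bochner_Integration.integrable_sum
        integrable_mult_right integrable_torus[of _ 1] char_measurable | simp)+
  also have "\<dots> = (\<Sum>m\<in>F. \<Sum>n\<in>G. if n = m then cnj (a m) * b n else 0)"
    by (intro sum.cong refl) (auto simp: integral_char)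
  also have "\<dots> = (\<Sum>m\<in>F. if m \<in> G then cnj (a m) * b m else 0)"
    using assms by (intro sum.cong refl) (simp add: sum.delta)
  also have "\<dots> = (\<Sum>n\<in>F \<inter> G. cnj (a n) * b n)"
    using assms by (simp add: sum.inter_restrict)
  finally show ?thesis .
qed

lemma Parseval:
  assumes u: "u \<in> compactly_supported" and v: "v \<in> compactly_supported"
  shows "cinner u v = (\<integral>\<theta>. cnj (hat u \<theta>) * hat v \<theta> \<partial>torus)"
proof -
  have f: "finite {n. seq u n \<noteq> 0}" "finite {n. seq v n \<noteq> 0}" using u v by (simp_all add: compactly_supported_def)
  have "cinner u v = (\<Sum>n | seq u n \<noteq> 0. cnj (seq u n) * seq v n)"
    by (rule cinner_finite_left) (use f in auto)
  also have "\<dots> = (\<Sum>n\<in>{n. seq u n \<noteq> 0} \<inter> {n. seq v n \<noteq> 0}. cnj (seq u n) * seq v n)"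
    by (rule sum.mono_neutral_right) (use f in auto)
  finally show ?thesis unfolding hat_def by (subst integral_trig_polynomial[OF f])
qed

text \<open>The squared distance of \<^term>\<open>\<phi>\<close> to its Fourier partial sum is the difference of the two sides.\<close>

lemma Bessel:
  assumes [measurable]: "\<phi> \<in> borel_measurable torus" and bd: "\<And>\<theta>. cmod (\<phi> \<theta>) \<le> C" and F: "finite F"
  shows "(\<Sum>m\<in>F. (cmod (\<integral>\<theta>. cnj (char m \<theta>) * \<phi> \<theta> \<partial>torus))\<^sup>2) \<le> (\<integral>\<theta>. (cmod (\<phi> \<theta>))\<^sup>2 \<partial>torus)"
proof -
  define c where "c m = (\<integral>\<theta>. cnj (char m \<theta>) * \<phi> \<theta> \<partial>torus)" for m
  define \<psi> where "\<psi> \<theta> = (\<Sum>m\<in>F. c m * char m \<theta>)" for \<theta>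
  define D where "D = (\<Sum>m\<in>F. cmod (c m))"
  have [measurable]: "\<psi> \<in> borel_measurable torus" unfolding \<psi>_def by measurable
  have D: "cmod (\<psi> \<theta>) \<le> D" for \<theta>
    unfolding \<psi>_def D_def by (rule order_trans[OF norm_sum]) (simp add: norm_mult)
  have C0: "0 \<le> C" using bd[of undefined] norm_ge_zero order_trans by blast
  have D0: "0 \<le> D" by (simp add: D_def sum_nonneg)
  have i1: "integrable torus (\<lambda>\<theta>. (cmod (\<phi> \<theta>))\<^sup>2)"
    by (rule integrable_torus[of _ "C\<^sup>2"]) (auto intro: power_mono bd)
  have i2: "integrable torus (\<lambda>\<theta>. cnj (\<psi> \<theta>) * \<phi> \<theta>)"
    by (rule integrable_torus[of _ "D * C"]) (auto simp: norm_mult intro!: mult_mono bd D D0)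
  have i3: "integrable torus (\<lambda>\<theta>. cnj (\<psi> \<theta>) * \<psi> \<theta>)"
    by (rule integrable_torus[of _ "D * D"]) (auto simp: norm_mult intro!: mult_mono D D0)
  have i4: "integrable torus (\<lambda>\<theta>. cnj (char m \<theta>) * \<phi> \<theta>)" for m
    by (rule integrable_torus[of _ C]) (auto simp: norm_mult bd)
  have 2: "(\<integral>\<theta>. cnj (\<psi> \<theta>) * \<phi> \<theta> \<partial>torus) = of_real (\<Sum>m\<in>F. (cmod (c m))\<^sup>2)"
  proof -
    have "(\<integral>\<theta>. cnj (\<psi> \<theta>) * \<phi> \<theta> \<partial>torus) = (\<integral>\<theta>. (\<Sum>m\<in>F. cnj (c m) * (cnj (char m \<theta>) * \<phi> \<theta>)) \<partial>torus)"
      by (intro Bochner_Integration.integral_cong refl) (simp add: \<psi>_def sum_distrib_left mult_ac)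
    also have "\<dots> = (\<Sum>m\<in>F. cnj (c m) * c m)"
      using i4 by (subst Bochner_Integration.integral_sum) (auto simp: c_def)
    finally show ?thesis
      by (simp only: complex_norm_square of_real_sum mult.commute)
  qed
  have 3: "(\<integral>\<theta>. cnj (\<psi> \<theta>) * \<psi> \<theta> \<partial>torus) = of_real (\<Sum>m\<in>F. (cmod (c m))\<^sup>2)"
    unfolding \<psi>_def integral_trig_polynomial[OF F F]
    by (simp only: complex_norm_square of_real_sum mult.commute Int_absorb)
  have pt: "(cmod (\<phi> \<theta> - \<psi> \<theta>))\<^sup>2 = (cmod (\<phi> \<theta>))\<^sup>2 + Re (cnj (\<psi> \<theta>) * \<psi> \<theta>) - 2 * Re (cnj (\<psi> \<theta>) * \<phi> \<theta>)" for \<theta>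
    unfolding cmod_power2 by (simp only: minus_complex.sel times_complex.sel cnj.sel) (simp only: power2_eq_square, algebra)
  have "0 \<le> (\<integral>\<theta>. (cmod (\<phi> \<theta> - \<psi> \<theta>))\<^sup>2 \<partial>torus)" by simp
  also have "\<dots> = (\<integral>\<theta>. (cmod (\<phi> \<theta>))\<^sup>2 \<partial>torus) + Re (\<integral>\<theta>. cnj (\<psi> \<theta>) * \<psi> \<theta> \<partial>torus)
      - 2 * Re (\<integral>\<theta>. cnj (\<psi> \<theta>) * \<phi> \<theta> \<partial>torus)"
    unfolding pt integral_Re[OF i2, symmetric] integral_Re[OF i3, symmetric]
    using i1 integrable_Re[OF i2] integrable_Re[OF i3] by (simp del: times_complex.sel)
  finally show ?thesis unfolding 2 3 by (simp add: c_def)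
qed

section \<open>Operators with a bounded symbol, and the spectral measure of the Laplacian\<close>

text \<open>A uniform bound on finite blocks makes every row square-summable. So the operator can be defined
  entrywise by inner products with the rows, and the bound extends to all vectors by density.\<close>

lemma ell2_matrix_operator:
  fixes K :: "'i \<Rightarrow> 'i \<Rightarrow> complex"
  assumes bound: "\<And>F G v. finite F \<Longrightarrow> finite G \<Longrightarrow>
      (\<Sum>m\<in>F. (cmod (\<Sum>n\<in>G. K m n * v n))\<^sup>2) \<le> C\<^sup>2 * (\<Sum>n\<in>G. (cmod (v n))\<^sup>2)"
    and C: "0 \<le> C"
  obtains T where "bounded_clinear T" "\<And>u. norm (T u) \<le> C * norm u"
    "\<And>m n. seq (T (unit_seq n)) m = K m n"
proof -
  have "\<exists>r. seq r = (\<lambda>n. cnj (K m n))" for m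
  proof -
    have "(\<Sum>n\<in>G. (cmod (cnj (K m n)))\<^sup>2) \<le> C\<^sup>2" if G: "finite G" for G
    proof -
      define s where "s = (\<Sum>n\<in>G. (cmod (K m n))\<^sup>2)"
      have "(\<Sum>n\<in>G. K m n * cnj (K m n)) = of_real s"
        by (simp only: s_def of_real_sum complex_norm_square)
      then have "(cmod (of_real s))\<^sup>2 \<le> C\<^sup>2 * s"
        using bound[of "{m}" G "\<lambda>n. cnj (K m n)"] G by (simp add: s_def[symmetric])
      then have "s\<^sup>2 \<le> C\<^sup>2 * s" by simp
      moreover have "0 \<le> s" by (simp add: s_def sum_nonneg)
      ultimately show ?thesis
        by (cases "s = 0") (auto simp: power2_eq_square s_def)
    qed
    from ell2_of_bounded_sums[OF this C] show ?thesis by blast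
  qed
  then obtain r where r: "\<And>m. seq (r m) = (\<lambda>n. cnj (K m n))" by metis
  have le: "(\<Sum>m\<in>F. (cmod (cinner (r m) v))\<^sup>2) \<le> C\<^sup>2 * (norm v)\<^sup>2" if F: "finite F" for F v
  proof (rule ell2_le_on_dense[where u = v])
    show "continuous_on UNIV (\<lambda>v. \<Sum>m\<in>F. (cmod (cinner (r m) v))\<^sup>2)"
      "continuous_on UNIV (\<lambda>v :: 'i ell2. C\<^sup>2 * (norm v)\<^sup>2)"
      by (intro continuous_intros)+
    fix v :: "'i ell2" assume "v \<in> compactly_supported"
    then have G: "finite {n. seq v n \<noteq> 0}" by (simp add: compactly_supported_def)
    have "cinner (r m) v = (\<Sum>n | seq v n \<noteq> 0. K m n * seq v n)" for m
      by (subst cinner_commute, subst cinner_finite_left[OF G]) (auto simp: r mult.commute)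
    then show "(\<Sum>m\<in>F. (cmod (cinner (r m) v))\<^sup>2) \<le> C\<^sup>2 * (norm v)\<^sup>2"
      using bound[OF F G, of "seq v"] norm_square_finite[OF G, of v] by simp
  qed
  have "\<exists>w. seq w = (\<lambda>m. cinner (r m) v) \<and> norm w \<le> C * norm v" for v
    using ell2_of_bounded_sums[of "\<lambda>m. cinner (r m) v" "C * norm v"] le[of _ v] C
    by (auto simp: power_mult_distrib)
  then obtain T where T: "\<And>v. seq (T v) = (\<lambda>m. cinner (r m) v)" "\<And>v. norm (T v) \<le> C * norm v"
    by metis
  show ?thesis
  proof
    show "bounded_clinear T"
      by (rule bounded_clinearI[of _ C]) (auto intro!: ell2_eqI T(2) simp: T(1) cinner_add)
    show "norm (T u) \<le> C * norm u" for u by (rule T(2))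
    show "seq (T (unit_seq n)) m = K m n" for m n by (simp add: T(1) r)
  qed
qed

definition bounded_symbol :: "(('d::finite \<Rightarrow> real) \<Rightarrow> real) \<Rightarrow> bool"
  where "bounded_symbol f \<longleftrightarrow> f \<in> borel_measurable torus \<and> (\<exists>C. \<forall>\<theta>. \<bar>f \<theta>\<bar> \<le> C)"

lemma bounded_symbolI: "f \<in> borel_measurable torus \<Longrightarrow> (\<And>\<theta>. \<bar>f \<theta>\<bar> \<le> C) \<Longrightarrow> bounded_symbol f"
  by (auto simp: bounded_symbol_def)

lemma bounded_symbol_const [simp]: "bounded_symbol (\<lambda>_. c)"
  by (rule bounded_symbolI[of _ "\<bar>c\<bar>"]) auto

lemma bounded_symbol_energy [simp]: "bounded_symbol energy_symbol"
  by (rule bounded_symbolI[OF energy_symbol_measurable abs_energy_symbol_le])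

lemma bounded_symbol_add:
  assumes "bounded_symbol f" "bounded_symbol g"
  shows "bounded_symbol (\<lambda>\<theta>. f \<theta> + g \<theta>)"
proof -
  obtain C D where "\<And>\<theta>. \<bar>f \<theta>\<bar> \<le> C" "\<And>\<theta>. \<bar>g \<theta>\<bar> \<le> D" using assms by (auto simp: bounded_symbol_def)
  then show ?thesis using assms
    by (intro bounded_symbolI[of _ "C + D"])
      (auto simp: bounded_symbol_def intro: order_trans[OF abs_triangle_ineq] add_mono)
qed

lemma bounded_symbol_mult:
  assumes "bounded_symbol f" "bounded_symbol g"
  shows "bounded_symbol (\<lambda>\<theta>. f \<theta> * g \<theta>)"
proof -
  obtain C D where *: "\<And>\<theta>. \<bar>f \<theta>\<bar> \<le> C" "\<And>\<theta>. \<bar>g \<theta>\<bar> \<le> D" using assms by (auto simp: bounded_symbol_def)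
  have "0 \<le> C" using *(1)[of undefined] abs_ge_zero order_trans by blast
  then show ?thesis using assms *
    by (intro bounded_symbolI[of _ "C * D"])
      (auto simp: bounded_symbol_def abs_mult intro!: mult_mono)
qed

text \<open>The sesquilinear form of multiplication by \<^term>\<open>f\<close> in Fourier space.\<close>

definition symbol_form where "symbol_form f u v = (\<integral>\<theta>. of_real (f \<theta>) * (cnj (hat u \<theta>) * hat v \<theta>) \<partial>torus)"

lemma symbol_form_integrable:
  assumes "bounded_symbol f"
  shows "integrable torus (\<lambda>\<theta>. complex_of_real (f \<theta>) * (cnj (hat u \<theta>) * hat v \<theta>))"
proof -
  obtain C where C: "\<And>\<theta>. \<bar>f \<theta>\<bar> \<le> C" and [measurable]: "f \<in> borel_measurable torus"
    using assms by (auto simp: bounded_symbol_def)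
  have C0: "0 \<le> C" using C[of undefined] abs_ge_zero order_trans by blast
  show ?thesis
    by (rule integrable_torus[of _ "C * ((\<Sum>n | seq u n \<noteq> 0. cmod (seq u n)) * (\<Sum>n | seq v n \<noteq> 0. cmod (seq v n)))"])
      (auto simp: norm_mult intro!: mult_mono C C0 norm_hat_le sum_nonneg mult_nonneg_nonneg)
qed

text \<open>The matrix of the form has entries \<open>\<integral> f cnj(char m) char n\<close>. Bessel, applied to \<^term>\<open>f\<close> times a
  trigonometric polynomial, bounds its finite blocks by the supremum of \<open>\<bar>f\<bar>\<close>.\<close>

lemma symbol_operator_ex:
  assumes f: "bounded_symbol f" and C: "\<And>\<theta>. \<bar>f \<theta>\<bar> \<le> C"
  obtains T where "bounded_clinear T" "\<And>u. norm (T u) \<le> C * norm u"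
    "\<And>u v. u \<in> compactly_supported \<Longrightarrow> v \<in> compactly_supported \<Longrightarrow> cinner u (T v) = symbol_form f u v"
proof -
  have [measurable]: "f \<in> borel_measurable torus" using f by (simp add: bounded_symbol_def)
  have C0: "0 \<le> C" using C[of undefined] abs_ge_zero order_trans by blast
  define K where "K m n = symbol_form f (unit_seq m) (unit_seq n)" for m n
  have hat_unit: "hat (unit_seq n) \<theta> = char n \<theta>" for n :: "int ^ 'a" and \<theta>
    by (subst hat_superset[of "{n}"]) auto
  have ik: "integrable torus (\<lambda>\<theta>. of_real (f \<theta>) * (cnj (char m \<theta>) * char n \<theta>))" for m n
    using symbol_form_integrable[OF f, of "unit_seq m" "unit_seq n"] by (simp add: hat_unit)
  obtain T where T: "bounded_clinear T" "\<And>u. norm (T u) \<le> C * norm u"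
    "\<And>m n. seq (T (unit_seq n)) m = K m n"
  proof (rule ell2_matrix_operator[of K C])
    fix F G :: "(int ^ 'a) set" and v :: "int ^ 'a \<Rightarrow> complex"
    assume F: "finite F" and G: "finite G"
    define p where "p \<theta> = (\<Sum>n\<in>G. v n * char n \<theta>)" for \<theta>
    have [measurable]: "p \<in> borel_measurable torus" unfolding p_def by measurable
    define D where "D = (\<Sum>n\<in>G. cmod (v n))"
    have D: "cmod (p \<theta>) \<le> D" for \<theta>
      unfolding p_def D_def by (rule order_trans[OF norm_sum]) (simp add: norm_mult)
    have D0: "0 \<le> D" by (simp add: D_def sum_nonneg)
    have bd: "cmod (of_real (f \<theta>) * p \<theta>) \<le> C * D" for \<theta>
      by (simp add: norm_mult) (intro mult_mono C D C0 norm_ge_zero)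
    have entry: "(\<Sum>n\<in>G. K m n * v n) = (\<integral>\<theta>. cnj (char m \<theta>) * (of_real (f \<theta>) * p \<theta>) \<partial>torus)" for m
    proof -
      have "(\<integral>\<theta>. cnj (char m \<theta>) * (of_real (f \<theta>) * p \<theta>) \<partial>torus)
          = (\<integral>\<theta>. (\<Sum>n\<in>G. v n * (of_real (f \<theta>) * (cnj (char m \<theta>) * char n \<theta>))) \<partial>torus)"
        by (intro Bochner_Integration.integral_cong refl) (simp add: p_def sum_distrib_left mult_ac)
      also have "\<dots> = (\<Sum>n\<in>G. v n * K m n)"
        using ik by (subst Bochner_Integration.integral_sum) (auto simp: K_def symbol_form_def hat_unit)
      finally show ?thesis by (simp add: mult.commute)
    qed
    have "(\<Sum>m\<in>F. (cmod (\<Sum>n\<in>G. K m n * v n))\<^sup>2) \<le> (\<integral>\<theta>. (cmod (of_real (f \<theta>) * p \<theta>))\<^sup>2 \<partial>torus)"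
      unfolding entry by (rule Bessel[OF _ bd F]) measurable
    also have "\<dots> \<le> (\<integral>\<theta>. C\<^sup>2 * (cmod (p \<theta>))\<^sup>2 \<partial>torus)"
    proof (rule integral_mono)
      show "integrable torus (\<lambda>\<theta>. (cmod (of_real (f \<theta>) * p \<theta>))\<^sup>2)"
        by (rule integrable_torus[of _ "(C * D)\<^sup>2"]) (auto intro: power_mono bd simp del: norm_mult)
      show "integrable torus (\<lambda>\<theta>. C\<^sup>2 * (cmod (p \<theta>))\<^sup>2)"
        by (intro integrable_mult_right integrable_torus[of _ "D\<^sup>2"]) (auto intro: power_mono D)
      show "(cmod (of_real (f \<theta>) * p \<theta>))\<^sup>2 \<le> C\<^sup>2 * (cmod (p \<theta>))\<^sup>2" for \<theta>
        unfolding norm_mult power_mult_distrib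
        by (intro mult_right_mono) (use C[of \<theta>] in \<open>auto intro: abs_le_square_iff[THEN iffD1] simp: C0\<close>)
    qed
    also have "\<dots> = C\<^sup>2 * Re (\<integral>\<theta>. cnj (p \<theta>) * p \<theta> \<partial>torus)"
    proof -
      have "integrable torus (\<lambda>\<theta>. cnj (p \<theta>) * p \<theta>)"
        by (rule integrable_torus[of _ "D * D"]) (auto simp: norm_mult intro!: mult_mono D D0)
      then have "Re (\<integral>\<theta>. cnj (p \<theta>) * p \<theta> \<partial>torus) = (\<integral>\<theta>. Re (cnj (p \<theta>) * p \<theta>) \<partial>torus)"
        by (rule integral_Re[symmetric])
      moreover have "Re (cnj z * z) = (cmod z)\<^sup>2" for z
        by (metis Re_complex_of_real complex_norm_square mult.commute)
      ultimately show ?thesis by simp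
    qed
    also have "(\<integral>\<theta>. cnj (p \<theta>) * p \<theta> \<partial>torus) = of_real (\<Sum>n\<in>G. (cmod (v n))\<^sup>2)"
      unfolding p_def integral_trig_polynomial[OF G G]
      by (simp only: complex_norm_square of_real_sum mult.commute Int_absorb)
    finally show "(\<Sum>m\<in>F. (cmod (\<Sum>n\<in>G. K m n * v n))\<^sup>2) \<le> C\<^sup>2 * (\<Sum>n\<in>G. (cmod (v n))\<^sup>2)" by simp
  qed (use C0 that in auto)
  have "cinner u (T v) = symbol_form f u v" if u: "u \<in> compactly_supported" and v: "v \<in> compactly_supported" for u v
  proof -
    define F G where "F = {n. seq u n \<noteq> 0}" and "G = {n. seq v n \<noteq> 0}"
    have F: "finite F" and G: "finite G" using u v by (simp_all add: F_def G_def compactly_supported_def)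
    have Tv: "T v = (\<Sum>n\<in>G. seq v n *\<^sub>C T (unit_seq n))"
    proof -
      have "T (\<Sum>n\<in>G. seq v n *\<^sub>C unit_seq n) = (\<Sum>n\<in>G. T (seq v n *\<^sub>C unit_seq n))"
        by (rule linear_sum[OF bounded_linear.linear[OF bounded_clinearD(1)[OF T(1)]]])
      then show ?thesis
        using compactly_supported_expansion[OF v] by (simp add: G_def bounded_clinearD(2)[OF T(1)])
    qed
    have "symbol_form f u v = (\<integral>\<theta>. (\<Sum>m\<in>F. \<Sum>n\<in>G. (cnj (seq u m) * seq v n) * (of_real (f \<theta>) * (cnj (char m \<theta>) * char n \<theta>))) \<partial>torus)"
      unfolding symbol_form_def
    proof (intro Bochner_Integration.integral_cong refl)
      fix \<theta> :: "'a \<Rightarrow> real"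
      have "cnj (hat u \<theta>) * hat v \<theta> = (\<Sum>m\<in>F. \<Sum>n\<in>G. (cnj (seq u m) * seq v n) * (cnj (char m \<theta>) * char n \<theta>))"
        unfolding hat_def F_def[symmetric] G_def[symmetric] cnj_sum sum_product
        by (intro sum.cong refl) (simp add: mult_ac)
      then show "of_real (f \<theta>) * (cnj (hat u \<theta>) * hat v \<theta>)
          = (\<Sum>m\<in>F. \<Sum>n\<in>G. (cnj (seq u m) * seq v n) * (of_real (f \<theta>) * (cnj (char m \<theta>) * char n \<theta>)))"
        by (simp only: sum_distrib_left) (simp only: mult_ac)
    qed
    also have "\<dots> = (\<Sum>m\<in>F. \<Sum>n\<in>G. (cnj (seq u m) * seq v n) * K m n)"
    proof (subst Bochner_Integration.integral_sum)
      show "integrable torus (\<lambda>\<theta>. \<Sum>n\<in>G. (cnj (seq u m) * seq v n) * (of_real (f \<theta>) * (cnj (char m \<theta>) * char n \<theta>)))" for m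
        by (intro Bochner_Integration.integrable_sum integrable_mult_right ik)
      show "(\<Sum>m\<in>F. \<integral>\<theta>. (\<Sum>n\<in>G. (cnj (seq u m) * seq v n) * (of_real (f \<theta>) * (cnj (char m \<theta>) * char n \<theta>))) \<partial>torus)
          = (\<Sum>m\<in>F. \<Sum>n\<in>G. (cnj (seq u m) * seq v n) * K m n)"
        unfolding K_def symbol_form_def hat_unit
        by (intro sum.cong refl, subst Bochner_Integration.integral_sum)
          (intro integrable_mult_right ik, intro sum.cong refl integral_mult_right_zero)
    qed
    also have "\<dots> = cinner u (T v)"
      unfolding Tv
      by (subst cinner_finite_left[OF F]) (auto simp: F_def T(3) sum_distrib_left mult_ac)
    finally show ?thesis by simp
  qed
  with T(1,2) that show ?thesis by blast
qed

definition symbol_op :: "(('d::finite \<Rightarrow> real) \<Rightarrow> real) \<Rightarrow> (int ^ 'd) ell2 \<Rightarrow> (int ^ 'd) ell2"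
  where "symbol_op f = (SOME T. bounded_clinear T \<and>
    (\<forall>u\<in>compactly_supported. \<forall>v\<in>compactly_supported. cinner u (T v) = symbol_form f u v))"

lemma operator_eqI:
  assumes S: "bounded_clinear S" and T: "bounded_clinear T"
    and eq: "\<And>u v. u \<in> compactly_supported \<Longrightarrow> v \<in> compactly_supported \<Longrightarrow> cinner u (S v) = cinner u (T v)"
  shows "S = T"
proof
  fix w
  have "S v = T v" if v: "v \<in> compactly_supported" for v
    using eq[OF unit_seq_compactly_supported v] by (intro ell2_eqI) simp
  then show "S w = T w"
    by (rule ell2_eq_on_dense[OF bounded_clinear_continuous[OF S] bounded_clinear_continuous[OF T]])
qed

lemma symbol_op:
  assumes f: "bounded_symbol f"
  shows "bounded_clinear (symbol_op f)"
    and "u \<in> compactly_supported \<Longrightarrow> v \<in> compactly_supported \<Longrightarrow> cinner u (symbol_op f v) = symbol_form f u v"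
proof -
  obtain C where C: "\<And>\<theta>. \<bar>f \<theta>\<bar> \<le> C" using f by (auto simp: bounded_symbol_def)
  have "\<exists>T. bounded_clinear T \<and>
    (\<forall>u\<in>compactly_supported. \<forall>v\<in>compactly_supported. cinner u (T v) = symbol_form f u v)"
    using symbol_operator_ex[OF f C] by metis
  from someI_ex[OF this] show "bounded_clinear (symbol_op f)"
    and "u \<in> compactly_supported \<Longrightarrow> v \<in> compactly_supported \<Longrightarrow> cinner u (symbol_op f v) = symbol_form f u v"
    by (auto simp: symbol_op_def)
qed

lemma symbol_op_eqI:
  assumes f: "bounded_symbol f" and T: "bounded_clinear T"
    and "\<And>u v. u \<in> compactly_supported \<Longrightarrow> v \<in> compactly_supported \<Longrightarrow> cinner u (T v) = symbol_form f u v"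
  shows "symbol_op f = T"
  by (rule operator_eqI[OF symbol_op(1)[OF f] T]) (simp add: symbol_op(2)[OF f] assms(3))

lemma norm_symbol_op_le:
  assumes f: "bounded_symbol f" and C: "\<And>\<theta>. \<bar>f \<theta>\<bar> \<le> C"
  shows "norm (symbol_op f u) \<le> C * norm u"
proof -
  obtain T where "bounded_clinear T" "norm (T u) \<le> C * norm u"
    "\<And>u v. u \<in> compactly_supported \<Longrightarrow> v \<in> compactly_supported \<Longrightarrow> cinner u (T v) = symbol_form f u v"
    using symbol_operator_ex[OF f C] by metis
  then show ?thesis using symbol_op_eqI[OF f] by metis
qed

lemma symbol_op_const: "symbol_op (\<lambda>_. c) = (\<lambda>u. c *\<^sub>R u)"
  by (rule symbol_op_eqI) (auto simp: symbol_form_def Parseval intro: bounded_clinear_scaleR bounded_clinear_ident)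

lemma symbol_op_add:
  assumes f: "bounded_symbol f" and g: "bounded_symbol g"
  shows "symbol_op (\<lambda>\<theta>. f \<theta> + g \<theta>) = (\<lambda>u. symbol_op f u + symbol_op g u)"
  by (rule symbol_op_eqI[OF bounded_symbol_add[OF f g] bounded_clinear_add[OF symbol_op(1)[OF f] symbol_op(1)[OF g]]])
    (simp add: cinner_add symbol_op(2) f g symbol_form_def distrib_right symbol_form_integrable)

lemma symbol_op_scale:
  assumes f: "bounded_symbol f"
  shows "symbol_op (\<lambda>\<theta>. c * f \<theta>) = (\<lambda>u. c *\<^sub>R symbol_op f u)"
  by (rule symbol_op_eqI[OF bounded_symbol_mult[OF bounded_symbol_const f] bounded_clinear_scaleR[OF symbol_op(1)[OF f]]])
    (simp add: symbol_op(2) f symbol_form_def mult.assoc)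

lemma symbol_op_symmetric:
  assumes f: "bounded_symbol f"
  shows "cinner u (symbol_op f v) = cinner (symbol_op f u) v"
proof -
  have fin: "cinner u (symbol_op f v) = cinner (symbol_op f u) v"
    if u: "u \<in> compactly_supported" and v: "v \<in> compactly_supported" for u v
  proof -
    have "cinner (symbol_op f u) v = cnj (symbol_form f v u)"
      by (subst cinner_commute) (simp add: symbol_op(2)[OF f v u])
    also have "\<dots> = (\<integral>\<theta>. cnj (of_real (f \<theta>) * (cnj (hat v \<theta>) * hat u \<theta>)) \<partial>torus)"
      by (simp add: symbol_form_def integral_cnj del: complex_cnj_mult)
    also have "\<dots> = symbol_form f u v"
      unfolding symbol_form_def by (intro Bochner_Integration.integral_cong refl) (simp add: mult_ac)
    finally show ?thesis by (simp add: symbol_op(2)[OF f u v])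
  qed
  note N = bounded_clinear_continuous[OF symbol_op(1)[OF f], of UNIV]
  note cont = continuous_on_cinner[OF continuous_on_const N]
    continuous_on_cinner[OF continuous_on_const continuous_on_id]
    continuous_on_cinner[OF N continuous_on_const]
    continuous_on_cinner[OF continuous_on_id continuous_on_const]
  have "cinner u (symbol_op f v) = cinner (symbol_op f u) v" if u: "u \<in> compactly_supported" for u v
    by (rule ell2_eq_on_dense[OF cont(1,2)]) (rule fin[OF u])
  then show ?thesis
    by (rule ell2_eq_on_dense[OF cont(4,3)])
qed

lemma norm_shift: "norm (shift_ell2 i k u) = norm u"
proof -
  have "bij_betw (\<lambda>n. n - axis i k) UNIV UNIV"
    by (rule bij_betw_byWitness[where f' = "\<lambda>n. n + axis i k"]) auto
  from has_sum_reindex_bij_betw[OF this, of "\<lambda>n. (cmod (seq u n))\<^sup>2" "(norm u)\<^sup>2"]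
  have "((\<lambda>n. (cmod (seq (shift_ell2 i k u) n))\<^sup>2) has_sum (norm u)\<^sup>2) UNIV"
    using norm_square_seq[of u] by simp
  then have "(norm (shift_ell2 i k u))\<^sup>2 = (norm u)\<^sup>2"
    using norm_square_seq has_sum_unique by blast
  then show ?thesis by simp
qed

lemma bounded_clinear_shift: "bounded_clinear (shift_ell2 i k)"
  by (rule bounded_clinearI[of _ 1]) (auto intro: ell2_eqI simp: norm_shift)

lemma bounded_clinear_laplacian: "bounded_clinear laplacian"
  unfolding laplacian_def[abs_def]
  by (intro bounded_clinear_sum bounded_clinear_scaleR bounded_clinear_add bounded_clinear_shift)

lemma laplacian_eq_symbol_op: "laplacian = symbol_op energy_symbol"
  by (rule symbol_op_eqI[symmetric, OF bounded_symbol_energy bounded_clinear_laplacian])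
    (auto simp: Parseval laplacian_compactly_supported hat_laplacian symbol_form_def mult_ac)

text \<open>Equi-Lipschitz functions converge everywhere once they converge on a dense set.\<close>

lemma tendsto_on_dense:
  fixes a :: "nat \<Rightarrow> 'i ell2 \<Rightarrow> complex"
  assumes a: "\<And>k w w'. cmod (a k w - a k w') \<le> L * norm (w - w')"
    and b: "\<And>w w'. cmod (b w - b w') \<le> L * norm (w - w')"
    and fin: "\<And>w. w \<in> compactly_supported \<Longrightarrow> (\<lambda>k. a k w) \<longlonglongrightarrow> b w"
  shows "(\<lambda>k. a k w) \<longlonglongrightarrow> b w"
proof (rule LIMSEQ_I)
  fix r :: real assume r: "0 < r"
  obtain X where X: "\<And>k :: nat. X k \<in> compactly_supported" "X \<longlonglongrightarrow> w"
    using compactly_supported_approx by blast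
  have "(\<lambda>j. L * norm (w - X j)) \<longlonglongrightarrow> L * norm (w - w)"
    by (intro tendsto_intros X)
  then have "\<forall>\<^sub>F j in sequentially. L * norm (w - X j) < r / 3"
    using r by (intro order_tendstoD(2)[of _ 0]) auto
  then obtain j where j: "L * norm (w - X j) < r / 3"
    by (auto simp: eventually_sequentially)
  obtain k0 where k0: "\<And>k. k0 \<le> k \<Longrightarrow> cmod (a k (X j) - b (X j)) < r / 3"
    using LIMSEQ_D[OF fin[OF X(1)[of j]], of "r / 3"] r by auto
  show "\<exists>k0. \<forall>k\<ge>k0. cmod (a k w - b w) < r"
  proof (intro exI[of _ k0] allI impI)
    fix k assume "k0 \<le> k"
    have eq: "a k w - b w = (a k w - a k (X j)) + (a k (X j) - b (X j)) - (b w - b (X j))" by simp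
    have "cmod (a k w - b w) \<le> cmod (a k w - a k (X j)) + cmod (a k (X j) - b (X j)) + cmod (b w - b (X j))"
      unfolding eq
      using norm_triangle_ineq4[of "(a k w - a k (X j)) + (a k (X j) - b (X j))" "b w - b (X j)"]
        norm_triangle_ineq[of "a k w - a k (X j)" "a k (X j) - b (X j)"] by linarith
    then show "cmod (a k w - b w) < r"
      using k0[OF \<open>k0 \<le> k\<close>] a[of k w "X j"] b[of w "X j"] j by linarith
  qed
qed

text \<open>On finitely supported vectors this is dominated convergence. Density extends it first in the right
  argument and then, since real symbols give symmetric operators, in the left one.\<close>

lemma symbol_op_weak_limit:
  assumes f: "\<And>k :: nat. bounded_symbol (f k)" "\<And>k \<theta>. \<bar>f k \<theta>\<bar> \<le> C"
    and lim: "\<And>\<theta>. (\<lambda>k. f k \<theta>) \<longlonglongrightarrow> g \<theta>" and g: "bounded_symbol g"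
  shows "(\<lambda>k. cinner u (symbol_op (f k) w)) \<longlonglongrightarrow> cinner u (symbol_op g w)"
proof -
  have gC: "\<bar>g \<theta>\<bar> \<le> C" for \<theta>
    by (rule LIMSEQ_le_const2[OF tendsto_rabs[OF lim]]) (use f(2) in auto)
  have C0: "0 \<le> C" using gC[of undefined] abs_ge_zero order_trans by blast
  have [measurable]: "f k \<in> borel_measurable torus" "g \<in> borel_measurable torus" for k
    using f(1) g by (auto simp: bounded_symbol_def)
  have lip: "cmod (cinner u (symbol_op h w) - cinner u (symbol_op h w')) \<le> (norm u * C) * norm (w - w')"
    if h: "bounded_symbol h" "\<And>\<theta>. \<bar>h \<theta>\<bar> \<le> C" for h u and w w' :: "(int ^ 'a) ell2"
  proof -
    have "cmod (cinner u (symbol_op h (w - w'))) \<le> norm u * norm (symbol_op h (w - w'))"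
      by (rule Cauchy_Schwarz_cinner)
    also have "\<dots> \<le> norm u * (C * norm (w - w'))"
      by (intro mult_left_mono norm_symbol_op_le h) auto
    finally show ?thesis by (simp add: bounded_clinearD(4)[OF symbol_op(1)[OF h(1)]] cinner_diff mult.assoc)
  qed
  have fin: "(\<lambda>k. cinner u (symbol_op (f k) w)) \<longlonglongrightarrow> cinner u (symbol_op g w)"
    if u: "u \<in> compactly_supported" and w: "w \<in> compactly_supported" for u w
  proof -
    have "(\<lambda>k. symbol_form (f k) u w) \<longlonglongrightarrow> symbol_form g u w"
      unfolding symbol_form_def
    proof (rule integral_dominated_convergence)
      show "integrable torus (\<lambda>\<theta>. C * cmod (cnj (hat u \<theta>) * hat w \<theta>))"
        using integrable_norm[OF symbol_form_integrable[OF bounded_symbol_const[of 1], of u w]] by simp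
      show "AE \<theta> in torus. (\<lambda>k. complex_of_real (f k \<theta>) * (cnj (hat u \<theta>) * hat w \<theta>))
          \<longlonglongrightarrow> complex_of_real (g \<theta>) * (cnj (hat u \<theta>) * hat w \<theta>)"
        by (intro AE_I2 tendsto_intros lim)
      show "AE \<theta> in torus. cmod (complex_of_real (f k \<theta>) * (cnj (hat u \<theta>) * hat w \<theta>)) \<le> C * cmod (cnj (hat u \<theta>) * hat w \<theta>)" for k
        by (intro AE_I2) (simp only: norm_mult norm_of_real mult_right_mono f(2) norm_ge_zero mult_nonneg_nonneg)
    qed measurable
    then show ?thesis by (simp add: symbol_op(2) f g u w)
  qed
  have fin2: "(\<lambda>k. cinner u (symbol_op (f k) w)) \<longlonglongrightarrow> cinner u (symbol_op g w)"
    if u: "u \<in> compactly_supported" for u w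
    by (rule tendsto_on_dense[where L = "norm u * C" and a = "\<lambda>k v. cinner u (symbol_op (f k) v)"
      and b = "\<lambda>v. cinner u (symbol_op g v)"]) (use lip f g gC fin[OF u] in auto)
  show ?thesis
  proof (rule tendsto_on_dense[where L = "norm u * C" and a = "\<lambda>k v. cinner u (symbol_op (f k) v)"
      and b = "\<lambda>v. cinner u (symbol_op g v)"])
    fix v :: "(int ^ 'a) ell2" assume v: "v \<in> compactly_supported"
    have "(\<lambda>k. cnj (cinner v (symbol_op (f k) u))) \<longlonglongrightarrow> cnj (cinner v (symbol_op g u))"
      by (intro tendsto_intros fin2 v)
    then show "(\<lambda>k. cinner u (symbol_op (f k) v)) \<longlonglongrightarrow> cinner u (symbol_op g v)"
      by (simp add: symbol_op_symmetric f g cinner_commute[symmetric])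
  qed (use lip f g gC in auto)
qed

subsection \<open>Multiplicativity\<close>

text \<open>The symbols \<^term>\<open>f\<close> for which composition with \<^term>\<open>symbol_op f\<close> is multiplication of symbols form a class
  that is closed under sums, products and bounded pointwise limits. It contains the energy, hence
  its polynomials, by Weierstrass its continuous functions, and finally the indicators of its Borel
  sets.\<close>

definition multiplicative :: "(('d::finite \<Rightarrow> real) \<Rightarrow> real) \<Rightarrow> bool"
  where "multiplicative f \<longleftrightarrow> bounded_symbol f \<and>
    (\<forall>g. bounded_symbol g \<longrightarrow> (\<forall>u. symbol_op f (symbol_op g u) = symbol_op (\<lambda>\<theta>. f \<theta> * g \<theta>) u))"

lemma multiplicative_bounded: "multiplicative f \<Longrightarrow> bounded_symbol f"
  by (simp add: multiplicative_def)

lemma multiplicativeD: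
  "multiplicative f \<Longrightarrow> bounded_symbol g \<Longrightarrow> symbol_op f (symbol_op g u) = symbol_op (\<lambda>\<theta>. f \<theta> * g \<theta>) u"
  by (simp add: multiplicative_def)

lemma multiplicative_const: "multiplicative (\<lambda>_. c)"
  by (simp add: multiplicative_def symbol_op_const symbol_op_scale)

lemma multiplicative_add:
  assumes "multiplicative f" "multiplicative g"
  shows "multiplicative (\<lambda>\<theta>. f \<theta> + g \<theta>)"
  using assms unfolding multiplicative_def
  by (auto simp: bounded_symbol_add bounded_symbol_mult symbol_op_add distrib_right)

lemma multiplicative_mult:
  assumes "multiplicative f" "multiplicative g"
  shows "multiplicative (\<lambda>\<theta>. f \<theta> * g \<theta>)"
  unfolding multiplicative_def
proof (intro conjI allI impI)
  have f: "bounded_symbol f" and g: "bounded_symbol g"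
    using assms by (auto simp: multiplicative_def)
  show "bounded_symbol (\<lambda>\<theta>. f \<theta> * g \<theta>)" using f g by (rule bounded_symbol_mult)
  fix h u assume h: "bounded_symbol (h :: ('a \<Rightarrow> real) \<Rightarrow> real)"
  have "symbol_op (\<lambda>\<theta>. f \<theta> * g \<theta>) (symbol_op h u) = symbol_op f (symbol_op g (symbol_op h u))"
    using assms(1) g by (simp add: multiplicativeD)
  also have "\<dots> = symbol_op (\<lambda>\<theta>. f \<theta> * (g \<theta> * h \<theta>)) u"
    using assms g h by (simp add: multiplicativeD bounded_symbol_mult)
  finally show "symbol_op (\<lambda>\<theta>. f \<theta> * g \<theta>) (symbol_op h u) = symbol_op (\<lambda>\<theta>. f \<theta> * g \<theta> * h \<theta>) u"
    by (simp add: mult.assoc)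
qed

text \<open>The Laplacian preserves finite supports, so it can be moved to the other side of the form, where it
  becomes a factor of the integrand.\<close>

lemma multiplicative_energy: "multiplicative energy_symbol"
  unfolding multiplicative_def
proof (intro conjI allI impI)
  fix g u assume g: "bounded_symbol (g :: ('a \<Rightarrow> real) \<Rightarrow> real)"
  have "symbol_op (\<lambda>\<theta>. energy_symbol \<theta> * g \<theta>) = (\<lambda>v. symbol_op energy_symbol (symbol_op g v))"
  proof (rule symbol_op_eqI)
    fix u v :: "(int ^ 'a) ell2"
    assume u: "u \<in> compactly_supported" and v: "v \<in> compactly_supported"
    have "cinner u (symbol_op energy_symbol (symbol_op g v)) = cinner (laplacian u) (symbol_op g v)"
      by (simp add: symbol_op_symmetric laplacian_eq_symbol_op)
    also have "\<dots> = symbol_form g (laplacian u) v"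
      by (intro symbol_op(2) g laplacian_compactly_supported u v)
    also have "\<dots> = symbol_form (\<lambda>\<theta>. energy_symbol \<theta> * g \<theta>) u v"
      unfolding symbol_form_def hat_laplacian[OF u] by (simp add: mult_ac)
    finally show "cinner u (symbol_op energy_symbol (symbol_op g v)) = symbol_form (\<lambda>\<theta>. energy_symbol \<theta> * g \<theta>) u v" .
  qed (rule bounded_symbol_mult[OF bounded_symbol_energy g]
      bounded_clinear_comp[OF symbol_op(1)[OF bounded_symbol_energy] symbol_op(1)[OF g]])+
  then show "symbol_op energy_symbol (symbol_op g u) = symbol_op (\<lambda>\<theta>. energy_symbol \<theta> * g \<theta>) u" by simp
qed simp

lemma multiplicative_limit:
  assumes f: "\<And>k :: nat. multiplicative (f k)" and C: "\<And>k \<theta>. \<bar>f k \<theta>\<bar> \<le> C"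
    and lim: "\<And>\<theta>. (\<lambda>k. f k \<theta>) \<longlonglongrightarrow> g \<theta>"
  shows "multiplicative g"
proof -
  have fb: "bounded_symbol (f k)" for k using f by (rule multiplicative_bounded)
  have gC: "\<bar>g \<theta>\<bar> \<le> C" for \<theta>
    by (rule LIMSEQ_le_const2[OF tendsto_rabs[OF lim]]) (use C in auto)
  have "g \<in> borel_measurable torus"
    by (rule borel_measurable_LIMSEQ_real[OF lim]) (use fb in \<open>auto simp: bounded_symbol_def\<close>)
  then have g: "bounded_symbol g" using gC by (rule bounded_symbolI)
  show ?thesis unfolding multiplicative_def
  proof (intro conjI allI impI g)
    fix h u assume h: "bounded_symbol (h :: ('a \<Rightarrow> real) \<Rightarrow> real)"
    obtain D where D: "\<And>\<theta>. \<bar>h \<theta>\<bar> \<le> D" using h by (auto simp: bounded_symbol_def)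
    have C0: "0 \<le> C" using gC[of undefined] abs_ge_zero order_trans by blast
    show "symbol_op g (symbol_op h u) = symbol_op (\<lambda>\<theta>. g \<theta> * h \<theta>) u"
    proof (rule ell2_eqI)
      fix n
      have "(\<lambda>k. cinner (unit_seq n) (symbol_op (f k) (symbol_op h u)))
          \<longlonglongrightarrow> cinner (unit_seq n) (symbol_op g (symbol_op h u))"
        by (rule symbol_op_weak_limit[OF fb C lim g])
      moreover have "(\<lambda>k. cinner (unit_seq n) (symbol_op (\<lambda>\<theta>. f k \<theta> * h \<theta>) u))
          \<longlonglongrightarrow> cinner (unit_seq n) (symbol_op (\<lambda>\<theta>. g \<theta> * h \<theta>) u)"
        by (rule symbol_op_weak_limit[of _ "C * D"])
          (auto intro!: bounded_symbol_mult fb h g mult_mono C D C0 tendsto_intros lim simp: abs_mult)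
      ultimately show "seq (symbol_op g (symbol_op h u)) n = seq (symbol_op (\<lambda>\<theta>. g \<theta> * h \<theta>) u) n"
        using LIMSEQ_unique by (fastforce simp: multiplicativeD[OF f h])
    qed
  qed
qed

lemma multiplicative_polynomial:
  "real_polynomial_function p \<Longrightarrow> multiplicative (\<lambda>\<theta> :: 'd::finite \<Rightarrow> real. p (energy_symbol \<theta>))"
proof (induction p rule: real_polynomial_function.induct)
  case (linear p)
  have "p x = p 1 * x" for x
    using linear_cmul[OF bounded_linear.linear[OF linear], of x 1] by simp
  then have "(\<lambda>\<theta>. p (energy_symbol \<theta>)) = (\<lambda>\<theta> :: 'd \<Rightarrow> real. p 1 * energy_symbol \<theta>)"
    by (rule ext)
  then show ?case
    using multiplicative_mult[OF multiplicative_const[of "p 1"] multiplicative_energy] by (simp only:)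
next
  case (const c)
  show ?case by (rule multiplicative_const)
next
  case (add f g)
  then show ?case by (intro multiplicative_add)
next
  case (mult f g)
  then show ?case by (intro multiplicative_mult)
qed

lemma multiplicative_continuous:
  assumes \<phi>: "continuous_on UNIV \<phi>"
  shows "multiplicative (\<lambda>\<theta> :: 'd::finite \<Rightarrow> real. \<phi> (energy_symbol \<theta>))"
proof -
  let ?D = "real CARD('d)"
  have \<phi>D: "continuous_on {- ?D..?D} \<phi>" using \<phi> by (rule continuous_on_subset) simp
  have in_D: "energy_symbol \<theta> \<in> {- ?D..?D}" for \<theta> :: "'d \<Rightarrow> real"
    using abs_energy_symbol_le[of \<theta>] by (simp add: abs_le_iff)
  have "bounded (\<phi> ` {- ?D..?D})"
    by (intro compact_imp_bounded compact_continuous_image \<phi>D) simp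
  then obtain C where C: "\<And>x. x \<in> {- ?D..?D} \<Longrightarrow> \<bar>\<phi> x\<bar> \<le> C" unfolding bounded_iff by (metis imageI real_norm_def)
  have "\<exists>p. real_polynomial_function p \<and> (\<forall>x\<in>{- ?D..?D}. \<bar>\<phi> x - p x\<bar> < inverse (real (Suc k)))" for k
    by (rule Stone_Weierstrass_real_polynomial_function[OF compact_Icc \<phi>D, of "inverse (real (Suc k))"]) auto
  then obtain p where p: "\<And>k. real_polynomial_function (p k)"
    "\<And>k x. x \<in> {- ?D..?D} \<Longrightarrow> \<bar>\<phi> x - p k x\<bar> < inverse (real (Suc k))" by metis
  show ?thesis
  proof (rule multiplicative_limit)
    show "multiplicative (\<lambda>\<theta> :: 'd \<Rightarrow> real. p k (energy_symbol \<theta>))" for k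
      by (rule multiplicative_polynomial[OF p(1)])
    show "\<bar>p k (energy_symbol \<theta>)\<bar> \<le> C + 1" for k and \<theta> :: "'d \<Rightarrow> real"
    proof -
      have "inverse (real (Suc k)) \<le> 1" by (simp add: inverse_eq_divide)
      then show ?thesis using C[OF in_D[of \<theta>]] p(2)[OF in_D[of \<theta>], of k] by linarith
    qed
    show "(\<lambda>k. p k (energy_symbol \<theta>)) \<longlonglongrightarrow> \<phi> (energy_symbol \<theta>)" for \<theta> :: "'d \<Rightarrow> real"
      by (rule LIM_zero_cancel, rule Lim_null_comparison[OF _ LIMSEQ_inverse_real_of_nat])
        (use p(2)[OF in_D[of \<theta>]] in \<open>auto intro!: always_eventually less_imp_le simp: abs_minus_commute\<close>)
  qed
qed

text \<open>Indicators of half-lines are limits of continuous ramps; half-lines generate the Borel sets and are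
  closed under intersection.\<close>

lemma multiplicative_indicator:
  assumes "B \<in> sets borel"
  shows "multiplicative (\<lambda>\<theta> :: 'd::finite \<Rightarrow> real. indicator B (energy_symbol \<theta>))"
proof -
  have halfline: "multiplicative (\<lambda>\<theta> :: 'd \<Rightarrow> real. indicator {..a} (energy_symbol \<theta>))" for a
  proof (rule multiplicative_limit)
    show "multiplicative (\<lambda>\<theta> :: 'd \<Rightarrow> real. max 0 (min 1 (1 - real k * (energy_symbol \<theta> - a))))" for k
      by (rule multiplicative_continuous) (intro continuous_intros)
    show "\<bar>max 0 (min 1 (1 - real k * (energy_symbol \<theta> - a)))\<bar> \<le> 1" for k and \<theta> :: "'d \<Rightarrow> real"
      by simp
    show "(\<lambda>k. max 0 (min 1 (1 - real k * (energy_symbol \<theta> - a)))) \<longlonglongrightarrow> indicator {..a} (energy_symbol \<theta>)" for \<theta> :: "'d \<Rightarrow> real"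
    proof (cases "energy_symbol \<theta> \<le> a")
      case True
      then have "0 \<le> real k * (a - energy_symbol \<theta>)" for k by simp
      then have "max 0 (min 1 (1 - real k * (energy_symbol \<theta> - a))) = 1" for k
        using mult_nonneg_nonpos[of "real k" "energy_symbol \<theta> - a"] True by simp
      then show ?thesis using True by simp
    next
      case False
      then obtain N where N: "inverse (energy_symbol \<theta> - a) < real N" using reals_Archimedean2 by blast
      have "max 0 (min 1 (1 - real k * (energy_symbol \<theta> - a))) = 0" if "N \<le> k" for k
      proof -
        have "1 = inverse (energy_symbol \<theta> - a) * (energy_symbol \<theta> - a)" using False by simp
        also have "\<dots> \<le> real k * (energy_symbol \<theta> - a)"
          by (rule mult_right_mono) (use N that False in auto)
        finally show ?thesis by simp
      qed
      then have "\<forall>\<^sub>F k in sequentially. max 0 (min 1 (1 - real k * (energy_symbol \<theta> - a))) = 0"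
        unfolding eventually_sequentially by blast
      then show ?thesis using False by (simp add: tendsto_eventually)
    qed
  qed
  have Int_stable_atMost: "Int_stable (range (atMost :: real \<Rightarrow> _))"
  proof (rule Int_stableI)
    fix A B assume "A \<in> range (atMost :: real \<Rightarrow> _)" "B \<in> range (atMost :: real \<Rightarrow> _)"
    then obtain a b where "A = {..a}" "B = {..b}" by auto
    then have "A \<inter> B = {..min a b}" by auto
    then show "A \<inter> B \<in> range atMost" by blast
  qed
  have subset_Pow_atMost: "range (atMost :: real \<Rightarrow> _) \<subseteq> Pow UNIV" by simp
  have "B \<in> sigma_sets UNIV (range atMost)"
    using assms by (subst (asm) borel_eq_atMost) simp
  show ?thesis
    using Int_stable_atMost subset_Pow_atMost \<open>B \<in> sigma_sets UNIV (range atMost)\<close>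
  proof (induction rule: sigma_sets_induct_disjoint)
    case (basic A)
    then show ?case using halfline by auto
  next
    case empty
    show ?case using multiplicative_const[of 0] by simp
  next
    case (compl A)
    have "indicat_real (UNIV - A) x = 1 + (- 1) * indicator A x" for x by (simp add: indicator_def)
    then show ?case
      using multiplicative_add[OF multiplicative_const[of 1] multiplicative_mult[OF multiplicative_const[of "-1"] compl(2)]]
      by simp
  next
    case (union F)
    show ?case
    proof (rule multiplicative_limit)
      show "multiplicative (\<lambda>\<theta> :: 'd \<Rightarrow> real. \<Sum>i<k. indicator (F i) (energy_symbol \<theta>))" for k
        by (induction k) (auto intro: multiplicative_const multiplicative_add union)
      have eq: "(\<Sum>i<k. indicat_real (F i) x) = indicator (\<Union>i<k. F i) x" for k x
        by (rule indicator_UN_disjoint[symmetric]) (use union in \<open>auto simp: disjoint_family_on_def\<close>)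
      show "\<bar>\<Sum>i<k. indicat_real (F i) (energy_symbol \<theta>)\<bar> \<le> 1" for k and \<theta> :: "'d \<Rightarrow> real"
      proof -
        have "\<bar>indicat_real A x\<bar> \<le> 1" for A x by (simp add: indicator_def)
        then show ?thesis unfolding eq .
      qed
      show "(\<lambda>k. \<Sum>i<k. indicat_real (F i) (energy_symbol \<theta>)) \<longlonglongrightarrow> indicator (\<Union>i. F i) (energy_symbol \<theta>)" for \<theta> :: "'d \<Rightarrow> real"
        unfolding eq by (rule LIMSEQ_indicator_UN)
    qed
  qed
qed

subsection \<open>The spectral measure\<close>

definition energy_projection :: "real set \<Rightarrow> (int ^ 'd::finite) ell2 \<Rightarrow> (int ^ 'd) ell2"
  where "energy_projection B = symbol_op (\<lambda>\<theta>. indicator B (energy_symbol \<theta>))"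

lemma bounded_symbol_indicator [simp]:
  "B \<in> sets borel \<Longrightarrow> bounded_symbol (\<lambda>\<theta>. indicator B (energy_symbol \<theta>))"
  by (rule multiplicative_bounded[OF multiplicative_indicator])

lemma orthogonal_energy_projection:
  assumes "B \<in> sets borel"
  shows "orthogonal_projection (energy_projection B)"
proof -
  have "(\<lambda>\<theta> :: 'a \<Rightarrow> real. indicat_real B (energy_symbol \<theta>) * indicator B (energy_symbol \<theta>))
      = (\<lambda>\<theta>. indicator B (energy_symbol \<theta>))" by (auto simp: indicator_def)
  then show ?thesis using assms
    by (simp add: orthogonal_projection_def energy_projection_def symbol_op symbol_op_symmetric
      multiplicativeD[OF multiplicative_indicator])
qed

text \<open>Each remainder of the series is itself a projection, so the square of its norm is a quadratic form,
  and weak convergence of the symbols to \<open>0\<close> gives norm convergence.\<close>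

lemma pvm_energy_projection: "projection_valued_measure energy_projection"
  unfolding projection_valued_measure_def
proof (intro conjI ballI allI impI)
  show "orthogonal_projection (energy_projection B)" if "B \<in> sets borel" for B
    using that by (rule orthogonal_energy_projection)
  show "energy_projection UNIV = (\<lambda>u. u)"
    by (simp add: energy_projection_def symbol_op_const)
  fix F :: "nat \<Rightarrow> real set" and u :: "(int ^ 'a) ell2"
  assume F: "range F \<subseteq> sets borel" "disjoint_family F"
  then have [measurable]: "F k \<in> sets borel" for k by auto
  define G where "G k = (\<Union>i. F i) - (\<Union>i<k. F i)" for k
  have G [measurable]: "G k \<in> sets borel" for k unfolding G_def by measurable
  have partial: "(\<Sum>i<k. energy_projection (F i) u) = energy_projection (\<Union>i. F i) u - energy_projection (G k) u" for k
  proof -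
    have 1: "energy_projection (\<Union>i<k. F i) u = (\<Sum>i<k. energy_projection (F i) u)" for k
    proof (induction k)
      case 0
      show ?case by (simp add: energy_projection_def symbol_op_const)
    next
      case (Suc k)
      have "indicat_real (\<Union>i<Suc k. F i) x = indicator (\<Union>i<k. F i) x + indicator (F k) x" for x
      proof -
        have "F i \<inter> F k = {}" if "i < k" for i
          using that by (intro disjoint_family_onD[OF F(2)]) auto
        then have "(\<Union>i<k. F i) \<inter> F k = {}" by blast
        then show ?thesis by (auto simp: indicator_def less_Suc_eq)
      qed
      then show ?case using Suc
        by (simp add: energy_projection_def symbol_op_add)
    qed
    have "indicat_real (\<Union>i. F i) x = indicator (\<Union>i<k. F i) x + indicator (G k) x" for x
      by (auto simp: indicator_def G_def)
    then have "energy_projection (\<Union>i. F i) u = energy_projection (\<Union>i<k. F i) u + energy_projection (G k) u"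
      by (simp add: energy_projection_def symbol_op_add)
    then show ?thesis by (simp add: 1)
  qed
  have "(\<lambda>k. cinner u (energy_projection (G k) u)) \<longlonglongrightarrow> cinner u (symbol_op (\<lambda>_. 0) u)"
    unfolding energy_projection_def
  proof (rule symbol_op_weak_limit[where C = 1])
    fix \<theta> :: "'a \<Rightarrow> real"
    have "(\<lambda>k. indicat_real (\<Union>i. F i) (energy_symbol \<theta>) - indicator (\<Union>i<k. F i) (energy_symbol \<theta>))
        \<longlonglongrightarrow> indicator (\<Union>i. F i) (energy_symbol \<theta>) - indicator (\<Union>i. F i) (energy_symbol \<theta>)"
      by (intro tendsto_intros LIMSEQ_indicator_UN)
    moreover have "indicat_real (\<Union>i. F i) x - indicator (\<Union>i<k. F i) x = indicator (G k) x" for k x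
      by (auto simp: indicator_def G_def)
    ultimately show "(\<lambda>k. indicator (G k) (energy_symbol \<theta>)) \<longlonglongrightarrow> (0 :: real)" by simp
  qed (simp, simp add: indicator_def, simp)
  moreover have "cinner u (energy_projection (G k) u) = of_real ((norm (energy_projection (G k) u))\<^sup>2)" for k
  proof -
    have P: "energy_projection (G k) (energy_projection (G k) u) = energy_projection (G k) u"
      "cinner u (energy_projection (G k) v) = cinner (energy_projection (G k) u) v" for v
      using orthogonal_energy_projection[OF G[of k]] unfolding orthogonal_projection_def by blast+
    from P(2)[of "energy_projection (G k) u"] show ?thesis
      by (simp add: P(1) cinner_self)
  qed
  ultimately have "(\<lambda>k. complex_of_real ((norm (energy_projection (G k) u))\<^sup>2)) \<longlonglongrightarrow> complex_of_real 0"
    by (simp add: symbol_op_const)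
  then have "(\<lambda>k. (norm (energy_projection (G k) u))\<^sup>2) \<longlonglongrightarrow> 0"
    by (simp only: tendsto_of_real_iff)
  then have "(\<lambda>k. norm (energy_projection (G k) u)) \<longlonglongrightarrow> 0"
    using tendsto_real_sqrt by fastforce
  then have "(\<lambda>k. energy_projection (\<Union>i. F i) u - energy_projection (G k) u) \<longlonglongrightarrow> energy_projection (\<Union>i. F i) u - 0"
    by (intro tendsto_intros) (simp add: tendsto_norm_zero_iff)
  then show "(\<lambda>k. energy_projection (F k) u) sums energy_projection (\<Union>k. F k) u"
    by (simp add: sums_def partial)
qed

lemma integral_diagonal_energy_projection:
  fixes u :: "(int ^ 'd::finite) ell2"
  fixes g :: "real \<Rightarrow> real"
  assumes g: "g \<in> borel_measurable borel" "\<And>x. 0 \<le> g x" "\<And>x. g x \<le> C"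
  shows "cinner u (symbol_op (\<lambda>\<theta>. g (energy_symbol \<theta>)) u) = of_real (\<integral>x. g x \<partial>diagonal_measure energy_projection u)"
proof -
  interpret pvm "energy_projection :: real set \<Rightarrow> (int ^ 'd) ell2 \<Rightarrow> (int ^ 'd) ell2"
    by unfold_locales (rule pvm_energy_projection)
  let ?M = "diagonal_measure energy_projection u"
  interpret M: finite_measure ?M by (rule finite_measure_diagonal)
  have bs: "bounded_symbol (\<lambda>\<theta> :: 'd \<Rightarrow> real. g (energy_symbol \<theta>))"
    if [measurable]: "g \<in> borel_measurable borel" and "\<And>x. 0 \<le> g x" "\<And>x. g x \<le> C" for g :: "real \<Rightarrow> real" and C
    by (rule bounded_symbolI[of _ C]) (use that in auto)
  have int: "integrable ?M g" if "g \<in> borel_measurable borel" and "\<And>x. 0 \<le> g x" "\<And>x. g x \<le> C" for g :: "real \<Rightarrow> real" and C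
    by (rule M.integrable_const_bound[of _ C]) (use that in \<open>auto simp: measurable_cong_sets[OF sets_diagonal refl]\<close>)
  show ?thesis
    using g
  proof (induction g arbitrary: C rule: borel_measurable_induct_real)
    case (set A)
    then have A: "A \<in> sets borel" by simp
    then have "(\<integral>x. indicator A x \<partial>?M) = measure ?M A"
      by (simp add: sets_diagonal)
    then show ?case using A
      by (simp add: measure_diagonal) (simp add: cinner_P[OF A, unfolded energy_projection_def] energy_projection_def)
  next
    case (mult f c)
    show ?case
    proof (cases "c = 0")
      case True
      then show ?thesis by (simp add: symbol_op_const)
    next
      case False
      then have le: "f x \<le> C / c" for x using mult(1) mult(5)[of x] by (simp add: field_simps)
      have "bounded_symbol (\<lambda>\<theta> :: 'd \<Rightarrow> real. f (energy_symbol \<theta>))" using mult(2,3) le by (rule bs)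
      then show ?thesis using mult.IH[OF le] by (simp add: symbol_op_scale)
    qed
  next
    case (add f h)
    have le: "f x \<le> C" "h x \<le> C" for x using add.prems[of x] add.hyps(2,4)[of x] by linarith+
    then show ?case using add.IH(1)[OF le(1)] add.IH(2)[OF le(2)] add.hyps
      by (simp add: symbol_op_add bs[of _ C] int[of _ C] cinner_add)
  next
    case (seq U)
    have UC: "U i x \<le> C" for i x
    proof -
      have "U i x \<le> g x"
        using incseq_le[OF _ seq(4)] seq(3) by (auto simp: incseq_def le_fun_def)
      then show ?thesis using seq.prems[of x] by linarith
    qed
    note U = seq(1,2) UC
    have "(\<lambda>i. cinner u (symbol_op (\<lambda>\<theta>. U i (energy_symbol \<theta>)) u)) \<longlonglongrightarrow> cinner u (symbol_op (\<lambda>\<theta>. g (energy_symbol \<theta>)) u)"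
      by (rule symbol_op_weak_limit[of _ C]) (use U g seq in \<open>auto intro!: bs[of _ C]\<close>)
    moreover have "(\<lambda>i. \<integral>x. U i x \<partial>?M) \<longlonglongrightarrow> (\<integral>x. g x \<partial>?M)"
      by (rule integral_dominated_convergence[where w = "\<lambda>_. C"])
        (use U g seq in \<open>auto simp: measurable_cong_sets[OF sets_diagonal refl]\<close>)
    ultimately show ?case
      using seq.IH[OF UC] LIMSEQ_unique[OF _ tendsto_of_real] by fastforce
  qed
qed

lemma spectral_measure_laplacian: "is_spectral_measure laplacian energy_projection"
  unfolding is_spectral_measure_def
proof (intro conjI allI pvm_energy_projection)
  interpret pvm "energy_projection :: real set \<Rightarrow> (int ^ 'd::finite) ell2 \<Rightarrow> (int ^ 'd) ell2"
    by unfold_locales (rule pvm_energy_projection)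
  fix u :: "(int ^ 'd) ell2"
  let ?M = "diagonal_measure energy_projection u"
  interpret M: finite_measure ?M by (rule finite_measure_diagonal)
  let ?D = "real CARD('d)"
  \<comment> \<open>A bounded nonnegative function that agrees with x + D on the range of the energy.\<close>
  let ?g = "\<lambda>x. max 0 (min (x + ?D) (2 * ?D))"
  have in_D: "- ?D \<le> energy_symbol \<theta>" "energy_symbol \<theta> \<le> ?D" for \<theta> :: "'d \<Rightarrow> real"
    using abs_energy_symbol_le[of \<theta>] by auto
  have "energy_projection (- {- ?D..?D}) u = 0"
  proof -
    have "indicat_real (- {- ?D..?D}) (energy_symbol \<theta>) = 0" for \<theta> :: "'d \<Rightarrow> real"
      using in_D[of \<theta>] by (simp add: indicator_def)
    then show ?thesis by (simp add: energy_projection_def symbol_op_const)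
  qed
  then have "emeasure ?M (- {- ?D..?D}) = 0" by (simp add: emeasure_diagonal)
  then have AE: "AE x in ?M. x \<in> {- ?D..?D}"
    by (intro AE_I[of _ _ "- {- ?D..?D}"]) (auto simp: sets_diagonal)
  have AE2: "AE x in ?M. x = ?g x - ?D"
    using AE by eventually_elim auto
  have int: "integrable ?M ?g"
    by (rule M.integrable_const_bound[of _ "2 * ?D"]) (auto simp: measurable_cong_sets[OF sets_diagonal refl])
  show ix: "integrable ?M (\<lambda>x. x)"
    by (rule M.integrable_const_bound[of _ ?D])
      (use AE in \<open>auto elim!: eventually_mono simp: measurable_cong_sets[OF sets_diagonal refl] abs_le_iff simp del: AE_conj_iff\<close>)
  have "(\<integral>x. x \<partial>?M) = (\<integral>x. ?g x - ?D \<partial>?M)"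
    using AE2 by (intro integral_cong_AE) (auto simp: measurable_cong_sets[OF sets_diagonal refl])
  also have "\<dots> = (\<integral>x. ?g x \<partial>?M) - ?D * (norm u)\<^sup>2"
    using int by (simp add: measure_diagonal P_UNIV)
  finally have "complex_of_real (\<integral>x. x \<partial>?M) = of_real (\<integral>x. ?g x \<partial>?M) - of_real (?D * (norm u)\<^sup>2)"
    by (simp only: of_real_diff)
  also have "of_real (\<integral>x. ?g x \<partial>?M) = cinner u (symbol_op (\<lambda>\<theta>. ?g (energy_symbol \<theta>)) u)"
    by (rule integral_diagonal_energy_projection[symmetric, of _ "2 * ?D"]) auto
  also have "(\<lambda>\<theta> :: 'd \<Rightarrow> real. ?g (energy_symbol \<theta>)) = (\<lambda>\<theta>. energy_symbol \<theta> + ?D)"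
  proof
    fix \<theta> :: "'d \<Rightarrow> real"
    show "?g (energy_symbol \<theta>) = energy_symbol \<theta> + ?D" using in_D[of \<theta>] by linarith
  qed
  also have "cinner u (symbol_op \<dots> u) = cinner u (laplacian u) + of_real (?D * (norm u)\<^sup>2)"
    by (simp add: symbol_op_add symbol_op_const laplacian_eq_symbol_op cinner_add cinner_self)
  finally show "cinner u (laplacian u) = complex_of_real (\<integral>x. x \<partial>?M)" by simp
qed

lemma laplacian_symmetric: "cinner u (laplacian v) = cinner (laplacian u) v"
  by (simp add: laplacian_eq_symbol_op symbol_op_symmetric)

text \<open>The choice in \<^const>\<open>spectral_projection\<close> yields some spectral measure, since one exists; all later
  arguments hold for any.\<close>

lemma spectral_resolution_laplacian:
  "spectral_resolution laplacian (spectral_projection (laplacian :: (int ^ 'd::finite) ell2 \<Rightarrow> _))"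
proof
  have "spectral_projection laplacian = (SOME P. is_spectral_measure (laplacian :: (int ^ 'd) ell2 \<Rightarrow> _) P)"
    by (simp add: spectral_projection_def fun_eq_iff)
  then show "is_spectral_measure laplacian (spectral_projection (laplacian :: (int ^ 'd) ell2 \<Rightarrow> _))"
    using someI[of "is_spectral_measure laplacian", OF spectral_measure_laplacian] by simp
qed (auto intro: bounded_clinear_laplacian laplacian_symmetric)

section \<open>The conjugate operators\<close>

subsection \<open>Their action on sequences\<close>

lemma A_formal_eq:
  "A_formal i k f n = 1 / (4 * \<i>) * ((2 * of_int (n $ i) - of_nat k) * f (n - axis i (int k))
    - (2 * of_int (n $ i) + of_nat k) * f (n + axis i (int k)))"
proof -
  have 1: "n - axis i (- int k) = n + axis i (int k)" by (simp add: vec_eq_iff axis_def)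
  have 2: "(n - axis i (int k)) $ i = n $ i - int k" "(n + axis i (int k)) $ i = n $ i + int k" by simp_all
  show ?thesis
    unfolding A_formal_def shift_def position_def 1 2 by (simp add: algebra_simps)
qed

definition A_total :: "nat \<Rightarrow> (int ^ 'd::finite \<Rightarrow> complex) \<Rightarrow> int ^ 'd \<Rightarrow> complex"
  where "A_total k f n = (\<Sum>i\<in>UNIV. A_formal i k f n)"

text \<open>The maximal operator: its domain consists of all vectors that the formal expression maps into \<open>\<ell>\<^sup>2\<close>.
  In contrast, \<open>A_fin\<close> is the restriction to finitely supported sequences.\<close>

definition A_max :: "nat \<Rightarrow> ((int ^ 'd::finite) ell2 \<times> (int ^ 'd) ell2) set"
  where "A_max k = {(u, v). seq v = A_total k (seq u)}"

definition A_fin :: "nat \<Rightarrow> ((int ^ 'd::finite) ell2 \<times> (int ^ 'd) ell2) set"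
  where "A_fin k = {(u, v). u \<in> compactly_supported \<and> seq v = A_total k (seq u)}"

lemma continuous_on_coord [continuous_intros]:
  "continuous_on S f \<Longrightarrow> continuous_on S (\<lambda>x. seq (f x) n)"
  by (rule bounded_linear.continuous_on[OF bounded_linear_coord])

text \<open>Coordinates are continuous, so an operator that is given by finitely many coordinates at each site
  keeps its formula when its graph is closed.\<close>

lemma closed_graph_formal:
  fixes F :: "(int ^ 'd::finite \<Rightarrow> complex) \<Rightarrow> int ^ 'd \<Rightarrow> complex"
  assumes "\<And>n. continuous_on UNIV (\<lambda>u. F (seq u) n)"
  shows "closed {(u, v). seq v = F (seq u)}"
proof -
  have "{(u, v). seq v = F (seq u)} = (\<Inter>n. {p. seq (snd p) n = F (seq (fst p)) n})"
    by (auto simp: fun_eq_iff)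
  moreover have "closed {p. seq (snd p) n = F (seq (fst p)) n}" for n
    by (intro closed_Collect_eq continuous_intros continuous_on_compose2[OF assms]) auto
  ultimately show ?thesis by auto
qed

lemma continuous_A_formal: "continuous_on UNIV (\<lambda>u. A_formal i k (seq u) n)"
  unfolding A_formal_eq by (intro continuous_intros)

lemma closed_A_max: "closed (A_max k)"
  unfolding A_max_def by (rule closed_graph_formal) (auto simp: A_total_def intro!: continuous_intros continuous_A_formal)

lemma finite_support_A_formal:
  assumes "u \<in> compactly_supported"
  shows "finite {n. A_formal i k (seq u) n \<noteq> 0}"
proof (rule finite_subset)
  let ?U = "{n. seq u n \<noteq> 0}"
  show "{n. A_formal i k (seq u) n \<noteq> 0} \<subseteq> (\<lambda>n. n + axis i (int k)) ` ?U \<union> (\<lambda>n. n - axis i (int k)) ` ?U"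
  proof
    fix n assume "n \<in> {n. A_formal i k (seq u) n \<noteq> 0}"
    then have "seq u (n - axis i (int k)) \<noteq> 0 \<or> seq u (n + axis i (int k)) \<noteq> 0"
      by (auto simp: A_formal_eq)
    then show "n \<in> (\<lambda>n. n + axis i (int k)) ` ?U \<union> (\<lambda>n. n - axis i (int k)) ` ?U"
      using image_eqI[of n "\<lambda>n. n + axis i (int k)" "n - axis i (int k)" ?U]
        image_eqI[of n "\<lambda>n. n - axis i (int k)" "n + axis i (int k)" ?U] by auto
  qed
  show "finite ((\<lambda>n. n + axis i (int k)) ` ?U \<union> (\<lambda>n. n - axis i (int k)) ` ?U)"
    using assms by (simp add: compactly_supported_def)
qed

lemma A_formal_vector:
  assumes "u \<in> compactly_supported"
  obtains v where "seq v = A_formal i k (seq u)"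
  using seq_Abs_ell2_finite[OF finite_support_A_formal[OF assms]] by metis

lemma A_total_vector:
  assumes "u \<in> compactly_supported"
  obtains v where "seq v = A_total k (seq u)"
proof -
  have "\<exists>v. seq v = A_formal i k (seq u)" for i
    using A_formal_vector[OF assms] by blast
  then have "\<exists>v. \<forall>i. seq (v i) = A_formal i k (seq u)"
    by (intro choice allI)
  then obtain v where "\<And>i. seq (v i) = A_formal i k (seq u)" by blast
  then have "seq (\<Sum>i\<in>UNIV. v i) = A_total k (seq u)"
    by (simp add: fun_eq_iff A_total_def)
  then show ?thesis by (rule that)
qed

subsection \<open>Self-adjointness\<close>

lemma ell2_dominated:
  assumes "\<And>n. cmod (f n) \<le> C * cmod (seq w n)" "0 \<le> C"
  obtains u where "seq u = f" "norm u \<le> C * norm w"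
proof (rule ell2_of_bounded_sums)
  show "(\<Sum>n\<in>F. (cmod (f n))\<^sup>2) \<le> (C * norm w)\<^sup>2" if F: "finite F" for F
  proof -
    have "(\<Sum>n\<in>F. (cmod (f n))\<^sup>2) \<le> (\<Sum>n\<in>F. C\<^sup>2 * (cmod (seq w n))\<^sup>2)"
      by (intro sum_mono) (use assms(1) in \<open>auto simp: power_mult_distrib[symmetric] intro: power_mono\<close>)
    also have "\<dots> \<le> C\<^sup>2 * (norm w)\<^sup>2"
      unfolding sum_distrib_left[symmetric] by (intro mult_left_mono finite_sum_le_norm_square F) auto
    finally show ?thesis by (simp add: power_mult_distrib)
  qed
qed (use assms that in auto)

definition size1 :: "int ^ 'd::finite \<Rightarrow> real"
  where "size1 n = (\<Sum>i\<in>UNIV. \<bar>of_int (n $ i)\<bar>)"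

lemma size1_axis: "size1 (axis i k) = \<bar>of_int k\<bar>"
proof -
  have "size1 (axis i k) = (\<Sum>j\<in>UNIV. if j = i then \<bar>of_int k\<bar> else 0)"
    unfolding size1_def by (rule sum.cong) (auto simp: axis_def)
  then show ?thesis by simp
qed

lemma size1_add_le: "size1 (m + n) \<le> size1 m + size1 n"
  unfolding size1_def sum.distrib[symmetric] by (rule sum_mono) (simp add: abs_triangle_ineq)

lemma size1_minus [simp]: "size1 (- n) = size1 n"
  by (simp add: size1_def)

lemma size1_shift: "\<bar>size1 (n + axis i k) - size1 n\<bar> \<le> \<bar>of_int k\<bar>"
proof -
  have "size1 (n + axis i k) \<le> size1 n + \<bar>of_int k\<bar>"
    using size1_add_le[of n "axis i k"] by (simp add: size1_axis)
  moreover have "size1 n \<le> size1 (n + axis i k) + \<bar>of_int k\<bar>"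
    using size1_add_le[of "n + axis i k" "- axis i k"] by (simp only: size1_minus size1_axis) simp
  ultimately show ?thesis by linarith
qed

lemma coord_le_size1: "\<bar>of_int (n $ i)\<bar> \<le> size1 n"
  unfolding size1_def by (rule member_le_sum) auto

lemma finite_size1_le: "finite {n :: int ^ 'd::finite. size1 n \<le> r}"
proof (rule finite_subset)
  let ?N = "{- \<lceil>r\<rceil>..\<lceil>r\<rceil>}"
  show "{n :: int ^ 'd. size1 n \<le> r} \<subseteq> (\<lambda>f. \<chi> i. f i) ` (UNIV \<rightarrow>\<^sub>E ?N)"
  proof
    fix n :: "int ^ 'd" assume "n \<in> {n. size1 n \<le> r}"
    then have "\<bar>of_int (n $ i)\<bar> \<le> r" for i using coord_le_size1[of n i] by simp
    then have "n $ i \<in> ?N" for i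
      by (metis abs_le_iff atLeastAtMost_iff ceiling_mono ceiling_of_int le_of_int_ceiling minus_le_iff of_int_abs of_int_le_iff order_trans)
    then show "n \<in> (\<lambda>f. \<chi> i. f i) ` (UNIV \<rightarrow>\<^sub>E ?N)"
      by (intro image_eqI[of _ _ "\<lambda>i. n $ i"]) auto
  qed
  show "finite ((\<lambda>f. \<chi> i. f i :: int ^ 'd) ` (UNIV \<rightarrow>\<^sub>E ?N))"
    by (intro finite_imageI finite_PiE) auto
qed

lemma truncate_size1_tendsto:
  fixes u :: "(int ^ 'd::finite) ell2"
  shows "(\<lambda>R :: nat. truncate {n. size1 n \<le> real R - c} u) \<longlonglongrightarrow> u"
proof (rule filterlim_compose[OF truncate_tendsto])
  show "filterlim (\<lambda>R :: nat. {n :: int ^ 'd. size1 n \<le> real R - c}) (finite_subsets_at_top UNIV) sequentially"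
    unfolding filterlim_finite_subsets_at_top
  proof (intro allI impI)
    fix X :: "(int ^ 'd) set" assume "finite X \<and> X \<subseteq> UNIV"
    then have X: "finite X" by simp
    obtain N where N: "Max (insert 0 (size1 ` X)) + c \<le> real N" using real_arch_simple by blast
    have "X \<subseteq> {n. size1 n \<le> real R - c}" if "N \<le> R" for R
    proof
      fix n assume "n \<in> X"
      then have "size1 n \<le> Max (insert 0 (size1 ` X))" using X by (intro Max_ge) auto
      then show "n \<in> {n. size1 n \<le> real R - c}" using N that by simp
    qed
    then show "\<forall>\<^sub>F R in sequentially. finite {n :: int ^ 'd. size1 n \<le> real R - c} \<and>
        X \<subseteq> {n. size1 n \<le> real R - c} \<and> {n. size1 n \<le> real R - c} \<subseteq> UNIV"
      unfolding eventually_sequentially using finite_size1_le by blast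
  qed
qed

text \<open>Equal to \<open>1\<close> up to radius \<open>R\<close>, equal to \<open>0\<close> beyond \<open>2R\<close>, and linear in between.\<close>

definition cutoff :: "nat \<Rightarrow> int ^ 'd::finite \<Rightarrow> real"
  where "cutoff R n = max 0 (min 1 (2 - size1 n / real R))"

lemma cutoff_bounds: "0 \<le> cutoff R n" "cutoff R n \<le> 1"
  by (auto simp: cutoff_def)

lemma cutoff_inside: "size1 n \<le> real R \<Longrightarrow> 0 < R \<Longrightarrow> cutoff R n = 1"
  by (simp add: cutoff_def field_simps)

lemma cutoff_outside: "2 * real R \<le> size1 n \<Longrightarrow> 0 < R \<Longrightarrow> cutoff R n = 0"
  by (simp add: cutoff_def field_simps)

lemma cutoff_shift:
  assumes "0 < R"
  shows "\<bar>cutoff R (n + axis i k) - cutoff R n\<bar> \<le> \<bar>of_int k\<bar> / real R"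
proof -
  have lip: "\<bar>max 0 (min 1 s) - max 0 (min 1 t)\<bar> \<le> \<bar>s - t\<bar>" for s t :: real by linarith
  have "\<bar>cutoff R (n + axis i k) - cutoff R n\<bar> \<le> \<bar>(2 - size1 (n + axis i k) / real R) - (2 - size1 n / real R)\<bar>"
    unfolding cutoff_def by (rule lip)
  also have "\<dots> = \<bar>size1 (n + axis i k) - size1 n\<bar> / real R"
    using assms by (simp add: field_simps abs_minus_commute flip: diff_divide_distrib)
  also have "\<dots> \<le> \<bar>of_int k\<bar> / real R"
    by (intro divide_right_mono size1_shift) simp
  finally show ?thesis .
qed

text \<open>The linear growth of the coefficients of the conjugate operator is exactly compensated by the
  slope \<open>1/R\<close> of the cutoff, and only the far region, where the sequence is small, contributes.\<close>

lemma cutoff_commutator_coefficient: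
  fixes n :: "int ^ 'd::finite" and i k s
  assumes R: "0 < R" and k: "k \<noteq> 0" and s: "s = 1 \<or> s = - 1"
  defines "m \<equiv> n + axis i (s * int k)"
  defines "a \<equiv> (2 * of_int (n $ i) + of_int s * real k) * (cutoff R m - cutoff R n)"
  shows "\<bar>a\<bar> \<le> 7 * (real k)\<^sup>2" and "size1 m \<le> real R - real k \<Longrightarrow> a = 0"
proof -
  have sk: "\<bar>of_int (s * int k)\<bar> = real k" using s by auto
  have near: "\<bar>size1 m - size1 n\<bar> \<le> real k"
    using size1_shift[of n i "s * int k"] sk by (simp add: m_def)
  show "a = 0" if "size1 m \<le> real R - real k"
    using near that R by (simp add: a_def cutoff_inside)
  show "\<bar>a\<bar> \<le> 7 * (real k)\<^sup>2"
  proof (cases "size1 n \<ge> 2 * real R \<and> size1 m \<ge> 2 * real R")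
    case True
    then show ?thesis using R by (simp add: a_def cutoff_outside)
  next
    case False
    have k1: "1 \<le> real k" and R1: "1 \<le> real R" using k R by auto
    have "\<bar>2 * of_int (n $ i) + of_int s * real k\<bar> \<le> 2 * \<bar>of_int (n $ i)\<bar> + real k"
      using s by auto
    also have "\<dots> \<le> 4 * real R + 3 * real k"
      using False near coord_le_size1[of n i] by auto
    finally have 1: "\<bar>2 * of_int (n $ i) + of_int s * real k\<bar> \<le> 4 * real R + 3 * real k" .
    have "\<bar>a\<bar> \<le> (4 * real R + 3 * real k) * (real k / real R)"
      unfolding a_def abs_mult m_def using cutoff_shift[OF R, of n i "s * int k"] sk
      by (intro mult_mono 1) auto
    also have "\<dots> = 4 * real k + 3 * (real k)\<^sup>2 / real R"
      using R by (simp add: field_simps power2_eq_square)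
    also have "\<dots> \<le> 4 * (real k)\<^sup>2 + 3 * (real k)\<^sup>2"
    proof (rule add_mono)
      show "4 * real k \<le> 4 * (real k)\<^sup>2" using k1 by (simp add: power2_eq_square)
      have "3 * (real k)\<^sup>2 / real R \<le> 3 * (real k)\<^sup>2 / 1" by (rule divide_left_mono) (use R1 in auto)
      then show "3 * (real k)\<^sup>2 / real R \<le> 3 * (real k)\<^sup>2" by simp
    qed
    finally show ?thesis by simp
  qed
qed

text \<open>Essential self-adjointness. For \<open>(u, v)\<close> in the maximal operator, the cut-off vectors \<open>\<chi>\<^sub>R u\<close> are finitely
  supported and \<open>A \<chi>\<^sub>R u = \<chi>\<^sub>R v + [A, \<chi>\<^sub>R] u\<close>, where the commutator is bounded uniformly in \<open>R\<close> and only
  sees the part of \<open>u\<close> at distance at least \<open>R - k\<close> from the origin.\<close>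

lemma A_max_subset_closure:
  assumes k: "k \<noteq> 0"
  shows "A_max k \<subseteq> closure (A_fin k :: ((int ^ 'd::finite) ell2 \<times> (int ^ 'd) ell2) set)"
proof
  fix p :: "(int ^ 'd) ell2 \<times> (int ^ 'd) ell2" assume "p \<in> A_max k"
  then obtain u v where p: "p = (u, v)" and v: "seq v = A_total k (seq u)" by (auto simp: A_max_def)
  define cut :: "nat \<Rightarrow> (int ^ 'd) ell2 \<Rightarrow> (int ^ 'd) ell2"
    where "cut R w = Abs_ell2 (\<lambda>n. cutoff R n * seq w n)" for R w
  have seq_cut: "seq (cut R w) = (\<lambda>n. cutoff R n * seq w n)" for R w
  proof -
    have "cmod (cutoff R n * seq w n) \<le> 1 * cmod (seq w n)" for n
      using cutoff_bounds[of R n] by (simp add: norm_mult mult_left_le_one_le)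
    then obtain w' where "seq w' = (\<lambda>n. cutoff R n * seq w n)"
      using ell2_dominated[of "\<lambda>n. cutoff R n * seq w n" 1 w] by auto
    then show ?thesis unfolding cut_def by (metis seq_inverse)
  qed
  have cut_fin: "cut R w \<in> compactly_supported" if "0 < R" for R w
  proof -
    have "{n. seq (cut R w) n \<noteq> 0} \<subseteq> {n. size1 n \<le> 2 * real R}"
    proof
      fix n assume "n \<in> {n. seq (cut R w) n \<noteq> 0}"
      then show "n \<in> {n. size1 n \<le> 2 * real R}"
        using cutoff_outside[OF _ that, of n] by (cases "size1 n \<le> 2 * real R") (auto simp: seq_cut)
    qed
    then show ?thesis
      unfolding compactly_supported_def by (auto intro: finite_subset finite_size1_le)
  qed
  have cut_tendsto: "(\<lambda>R. cut R w) \<longlonglongrightarrow> w" for w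
  proof (rule LIM_zero_cancel, rule Lim_null_comparison)
    show "\<forall>\<^sub>F R in sequentially. norm (cut R w - w) \<le> norm (w - truncate {n. size1 n \<le> real R - 0} w)"
    proof (rule eventually_sequentiallyI[of 1])
      fix R :: nat assume R: "1 \<le> R"
      have "cmod (seq (cut R w - w) n) \<le> 1 * cmod (seq (w - truncate {n. size1 n \<le> real R - 0} w) n)" for n
      proof (cases "size1 n \<le> real R")
        case True
        then show ?thesis using R by (simp add: seq_cut cutoff_inside)
      next
        case False
        have "cutoff R n * seq w n - seq w n = of_real (cutoff R n - 1) * seq w n" by (simp add: algebra_simps)
        then show ?thesis using False cutoff_bounds[of R n]
          by (simp add: seq_cut norm_mult mult_left_le_one_le del: of_real_diff)
      qed
      from ell2_dominated[OF this]
      show "norm (cut R w - w) \<le> norm (w - truncate {n. size1 n \<le> real R - 0} w)"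
        by (metis mult_1 seq_inject zero_le_one)
    qed
    have "(\<lambda>R. norm (w - truncate {n. size1 n \<le> real R - 0} w)) \<longlonglongrightarrow> norm (w - w)"
      by (intro tendsto_intros truncate_size1_tendsto)
    then show "(\<lambda>R. norm (w - truncate {n. size1 n \<le> real R - 0} w)) \<longlonglongrightarrow> 0" by simp
  qed
  have "\<exists>z. seq z = A_total k (seq (cut (Suc R) u))" for R
    using A_total_vector[OF cut_fin] by (metis zero_less_Suc)
  then obtain z where z: "\<And>R. seq (z R) = A_total k (seq (cut (Suc R) u))" by metis
  have zlim: "z \<longlonglongrightarrow> v"
  proof (rule LIM_zero_cancel, rule Lim_null_comparison)
    define C where "C = 7 * (real k)\<^sup>2"
    define far where "far R = u - truncate {n. size1 n \<le> real (Suc R) - real k} u" for R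
    have seq_far: "seq (far R) n = (if size1 n \<le> real (Suc R) - real k then 0 else seq u n)" for R n
      by (simp add: far_def)
    show "\<forall>\<^sub>F R in sequentially. norm (z R - v) \<le> norm (cut (Suc R) v - v) + (\<Sum>i\<in>(UNIV :: 'd set). 2 * C * norm (far R))"
    proof (rule always_eventually, rule allI)
      fix R
      define a where "a s i n = (2 * of_int (n $ i) + of_int s * real k) *
        (cutoff (Suc R) (n + axis i (s * int k)) - cutoff (Suc R) n)" for s i and n :: "int ^ 'd"
      have ex_t: "\<exists>t. seq t = (\<lambda>n. of_real (a s i n) * seq u (n + axis i (s * int k))) \<and> norm t \<le> C * norm (far R)"
        if s: "s = 1 \<or> s = - 1" for s i
      proof -
        have "cmod (of_real (a s i n) * seq u (n + axis i (s * int k)))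
            \<le> C * cmod (seq (shift_ell2 i (- (s * int k)) (far R)) n)" for n
        proof -
          have ax: "n - axis i (- (s * int k)) = n + axis i (s * int k)" by (simp add: vec_eq_iff axis_def)
          note co = cutoff_commutator_coefficient[OF zero_less_Suc k s, of n i R]
          show ?thesis
          proof (cases "size1 (n + axis i (s * int k)) \<le> real (Suc R) - real k")
            case True
            then have "a s i n = 0" using co(2) by (simp add: a_def)
            then show ?thesis by (simp add: C_def)
          next
            case False
            moreover have "\<bar>a s i n\<bar> \<le> C" using co(1) by (simp add: a_def C_def)
            ultimately show ?thesis
              by (simp add: ax seq_far norm_mult mult_right_mono del: of_nat_Suc)
          qed
        qed
        moreover have "0 \<le> C" by (simp add: C_def)
        ultimately show ?thesis
          by (rule ell2_dominated) (auto simp: norm_shift)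
      qed
      define t where "t s i = (SOME t. seq t = (\<lambda>n. of_real (a s i n) * seq u (n + axis i (s * int k)))
          \<and> norm t \<le> C * norm (far R))" for s i
      have t: "seq (t s i) = (\<lambda>n. of_real (a s i n) * seq u (n + axis i (s * int k))) \<and> norm (t s i) \<le> C * norm (far R)"
        if "s = 1 \<or> s = - 1" for s i
        unfolding t_def by (rule someI_ex[OF ex_t[OF that]])
      have "z R - cut (Suc R) v = (\<Sum>i\<in>UNIV. (1 / (4 * \<i>)) *\<^sub>C (t (- 1) i - t 1 i))"
      proof (rule ell2_eqI)
        fix n :: "int ^ 'd"
        have ax: "n - axis i (int k) = n + axis i (- int k)" for i by (simp add: vec_eq_iff axis_def)
        have "A_formal i k (seq (cut (Suc R) u)) n - cutoff (Suc R) n * A_formal i k (seq u) n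
          = 1 / (4 * \<i>) * (seq (t (- 1) i) n - seq (t 1 i) n)" for i
          using t[of 1 i] t[of "-1" i] by (simp add: A_formal_eq seq_cut a_def ax algebra_simps)
        then show "seq (z R - cut (Suc R) v) n = seq (\<Sum>i\<in>UNIV. (1 / (4 * \<i>)) *\<^sub>C (t (- 1) i - t 1 i)) n"
          by (simp add: z seq_cut v A_total_def sum_distrib_left sum_subtractf[symmetric])
      qed
      also have "norm \<dots> \<le> (\<Sum>i\<in>(UNIV :: 'd set). 2 * C * norm (far R))"
      proof (rule sum_norm_le)
        fix i
        have "norm ((1 / (4 * \<i>)) *\<^sub>C (t (- 1) i - t 1 i)) \<le> norm (t (- 1) i - t 1 i)"
          by (simp add: norm_divide norm_mult)
        also have "\<dots> \<le> norm (t (- 1) i) + norm (t 1 i)" by (rule norm_triangle_ineq4)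
        also have "\<dots> \<le> 2 * C * norm (far R)" using t[of 1 i] t[of "-1" i] by simp
        finally show "norm ((1 / (4 * \<i>)) *\<^sub>C (t (- 1) i - t 1 i)) \<le> 2 * C * norm (far R)" .
      qed
      finally show "norm (z R - v) \<le> norm (cut (Suc R) v - v) + (\<Sum>i\<in>(UNIV :: 'd set). 2 * C * norm (far R))"
        using norm_triangle_ineq[of "z R - cut (Suc R) v" "cut (Suc R) v - v"] by simp
    qed
    have "(\<lambda>R. norm (u - truncate {n. size1 n \<le> real R - real k} u)) \<longlonglongrightarrow> norm (u - u)"
      by (intro tendsto_intros truncate_size1_tendsto)
    then have far: "(\<lambda>R. norm (far R)) \<longlonglongrightarrow> 0"
      using LIMSEQ_Suc by (fastforce simp: far_def)
    have cutv: "(\<lambda>R. norm (cut (Suc R) v - v)) \<longlonglongrightarrow> 0"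
      using LIMSEQ_Suc[OF cut_tendsto[of v]] by (simp add: LIM_zero_iff tendsto_norm_zero_iff)
    have "(\<lambda>R. norm (cut (Suc R) v - v) + (\<Sum>i\<in>(UNIV :: 'd set). 2 * C * norm (far R)))
        \<longlonglongrightarrow> 0 + (\<Sum>i\<in>(UNIV :: 'd set). 2 * C * 0)"
      by (intro tendsto_intros far cutv)
    then show "(\<lambda>R. norm (cut (Suc R) v - v) + (\<Sum>i\<in>(UNIV :: 'd set). 2 * C * norm (far R))) \<longlonglongrightarrow> 0" by simp
  qed
  have "(\<lambda>R. (cut (Suc R) u, z R)) \<longlonglongrightarrow> (u, v)"
    by (intro tendsto_Pair zlim LIMSEQ_Suc[OF cut_tendsto])
  moreover have "(cut (Suc R) u, z R) \<in> A_fin k" for R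
    by (simp add: A_fin_def z cut_fin)
  ultimately show "p \<in> closure (A_fin k)"
    unfolding p closure_sequential by (intro exI[of _ "\<lambda>R. (cut (Suc R) u, z R)"]) auto
qed

text \<open>The closure over finitely supported sequences is contained in the sum, the sum acts by the formal
  expression, and the maximal operator is contained in that closure. So all three agree.\<close>

lemma A_sum_eq_A_max:
  assumes k: "j * \<kappa> \<noteq> 0"
  shows "A_sum j \<kappa> = (A_max (j * \<kappa>) :: ((int ^ 'd::finite) ell2 \<times> (int ^ 'd) ell2) set)" (is "?L = ?R")
proof
  have coord: "seq v = A_formal i (j * \<kappa>) (seq u)" if "(u, v) \<in> A_coord i j \<kappa>" for u v and i :: 'd
  proof -
    have "A_coord i j \<kappa> \<subseteq> {(u, v). seq v = A_formal i (j * \<kappa>) (seq u)}"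
      unfolding A_coord_def by (intro closure_minimal closed_graph_formal continuous_A_formal) auto
    then show ?thesis using that by auto
  qed
  show "?L \<subseteq> ?R"
    unfolding A_sum_def
  proof (rule closure_minimal[OF _ closed_A_max])
    show "{(u, \<Sum>i\<in>UNIV. v i) |u v. \<forall>i. (u, v i) \<in> A_coord i j \<kappa>}
        \<subseteq> (A_max (j * \<kappa>) :: ((int ^ 'd) ell2 \<times> (int ^ 'd) ell2) set)"
    proof
      fix p :: "(int ^ 'd) ell2 \<times> (int ^ 'd) ell2"
      assume "p \<in> {(u, \<Sum>i\<in>UNIV. v i) |u v. \<forall>i. (u, v i) \<in> A_coord i j \<kappa>}"
      then obtain u v where p: "p = (u, \<Sum>i\<in>UNIV. v i)" and "\<forall>i. (u, v i) \<in> A_coord i j \<kappa>" by blast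
      then have "seq (v i) = A_formal i (j * \<kappa>) (seq u)" for i by (intro coord) blast
      then show "p \<in> A_max (j * \<kappa>)"
        by (simp add: p A_max_def A_total_def fun_eq_iff)
    qed
  qed
  have "(A_fin (j * \<kappa>) :: ((int ^ 'd) ell2 \<times> (int ^ 'd) ell2) set) \<subseteq> {(u, \<Sum>i\<in>UNIV. v i) |u v. \<forall>i. (u, v i) \<in> A_coord i j \<kappa>}"
  proof
    fix p :: "(int ^ 'd) ell2 \<times> (int ^ 'd) ell2" assume "p \<in> A_fin (j * \<kappa>)"
    then obtain u w where p: "p = (u, w)" "u \<in> compactly_supported" "seq w = A_total (j * \<kappa>) (seq u)"
      by (auto simp: A_fin_def)
    have "\<exists>v. seq v = A_formal i (j * \<kappa>) (seq u)" for i
      using A_formal_vector[OF p(2)] by blast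
    then have "\<exists>v. \<forall>i. seq (v i) = A_formal i (j * \<kappa>) (seq u)"
      by (intro choice allI)
    then obtain v where v: "\<And>i. seq (v i) = A_formal i (j * \<kappa>) (seq u)" by blast
    have "(u, v i) \<in> A_coord i j \<kappa>" for i
      unfolding A_coord_def by (rule subsetD[OF closure_subset]) (simp add: p(2) v)
    moreover have "w = (\<Sum>i\<in>UNIV. v i)"
      by (rule ell2_eqI) (simp add: p(3) v A_total_def)
    ultimately show "p \<in> {(u, \<Sum>i\<in>UNIV. v i) |u v. \<forall>i. (u, v i) \<in> A_coord i j \<kappa>}"
      using p(1) by blast
  qed
  then have "closure (A_fin (j * \<kappa>)) \<subseteq> ?L"
    unfolding A_sum_def by (rule closure_mono)
  then show "?R \<subseteq> ?L" using A_max_subset_closure[OF k] by blast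
qed

lemma A_total_linear:
  "A_total k (\<lambda>n. \<Sum>m\<in>M. c m * f m n) n = (\<Sum>m\<in>M. c m * A_total k (f m) n)"
  unfolding A_total_def A_formal_eq
  by (simp add: sum_distrib_left sum_subtractf[symmetric] sum.swap[of _ M] algebra_simps)

lemma cinner_A_total_unit:
  assumes "seq z = A_total k (seq (unit_seq m))"
  shows "cinner z w = A_total k (seq w) m"
proof -
  have z: "z = (\<Sum>i\<in>UNIV. (1 / (4 * \<i>)) *\<^sub>C ((2 * of_int (m $ i) + of_nat k) *\<^sub>C unit_seq (m + axis i (int k))
      - (2 * of_int (m $ i) - of_nat k) *\<^sub>C unit_seq (m - axis i (int k))))"
  proof (rule ell2_eqI)
    fix n
    have "A_formal i k (seq (unit_seq m)) n = seq ((1 / (4 * \<i>)) *\<^sub>C ((2 * of_int (m $ i) + of_nat k) *\<^sub>C unit_seq (m + axis i (int k))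
      - (2 * of_int (m $ i) - of_nat k) *\<^sub>C unit_seq (m - axis i (int k)))) n" for i
    proof -
      have eqs: "n - axis i (int k) = m \<longleftrightarrow> n = m + axis i (int k)" "n + axis i (int k) = m \<longleftrightarrow> n = m - axis i (int k)"
        by (auto simp: algebra_simps)
      have "(2 * of_int (n $ i) - of_nat k) * (if n = m + axis i (int k) then 1 else 0)
          = (2 * of_int (m $ i) + of_nat k) * (if n = m + axis i (int k) then 1 else 0 :: complex)"
        "(2 * of_int (n $ i) + of_nat k) * (if n = m - axis i (int k) then 1 else 0)
          = (2 * of_int (m $ i) - of_nat k) * (if n = m - axis i (int k) then 1 else 0 :: complex)"
        by auto
      then show ?thesis
        by (simp only: A_formal_eq seq_unit_seq eqs scaleC.rep_eq minus_ell2.rep_eq)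
    qed
    then show "seq z n = seq (\<Sum>i\<in>UNIV. (1 / (4 * \<i>)) *\<^sub>C ((2 * of_int (m $ i) + of_nat k) *\<^sub>C unit_seq (m + axis i (int k))
      - (2 * of_int (m $ i) - of_nat k) *\<^sub>C unit_seq (m - axis i (int k)))) n"
      by (simp only: assms A_total_def seq_sum)
  qed
  show ?thesis
    unfolding z A_total_def cinner_sum
  proof (rule sum.cong[OF refl])
    fix i
    have "cnj (1 / (4 * \<i>)) = - (1 / (4 * \<i>))" by (simp add: complex_eq_iff)
    moreover have "cnj (2 * of_int (m $ i) + of_nat k) = 2 * of_int (m $ i) + of_nat k"
      "cnj (2 * of_int (m $ i) - of_nat k) = 2 * of_int (m $ i) - of_nat k" by simp_all
    ultimately show "cinner ((1 / (4 * \<i>)) *\<^sub>C ((2 * of_int (m $ i) + of_nat k) *\<^sub>C unit_seq (m + axis i (int k))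
        - (2 * of_int (m $ i) - of_nat k) *\<^sub>C unit_seq (m - axis i (int k)))) w = A_formal i k (seq w) m"
      unfolding cinner_scaleC cinner_diff cinner_unit_seq A_formal_eq
      by (simp only: minus_mult_commute minus_diff_eq)
  qed
qed

text \<open>Testing with unit sequences shows that the adjoint acts by the formal expression, which is symmetric.
  Conversely the maximal operator is symmetric, because it is so on the core of finitely supported
  sequences.\<close>

lemma self_adjoint_A_max:
  assumes k: "k \<noteq> 0"
  shows "self_adjoint (A_max k :: ((int ^ 'd::finite) ell2 \<times> (int ^ 'd) ell2) set)"
  unfolding self_adjoint_def
proof (intro conjI)
  have "compactly_supported \<subseteq> Domain (A_max k :: ((int ^ 'd) ell2 \<times> (int ^ 'd) ell2) set)"
  proof
    fix u :: "(int ^ 'd) ell2" assume "u \<in> compactly_supported"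
    then obtain v where "seq v = A_total k (seq u)" by (rule A_total_vector)
    then have "(u, v) \<in> A_max k" by (simp add: A_max_def)
    then show "u \<in> Domain (A_max k)" by blast
  qed
  then show "closure (Domain (A_max k :: ((int ^ 'd) ell2 \<times> (int ^ 'd) ell2) set)) = UNIV"
    using closure_mono compactly_supported_dense by blast
  show "adjoint_graph (A_max k) = (A_max k :: ((int ^ 'd) ell2 \<times> (int ^ 'd) ell2) set)"
  proof (intro equalityI subsetI)
    fix p :: "(int ^ 'd) ell2 \<times> (int ^ 'd) ell2" assume "p \<in> adjoint_graph (A_max k)"
    moreover obtain v w where p: "p = (v, w)" by (cases p)
    ultimately have vw: "\<And>u z. (u, z) \<in> A_max k \<Longrightarrow> cinner v z = cinner w u"
      by (auto simp: adjoint_graph_def)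
    have "seq w m = A_total k (seq v) m" for m
    proof -
      obtain z :: "(int ^ 'd) ell2" where z: "seq z = A_total k (seq (unit_seq m))"
        using A_total_vector[OF unit_seq_compactly_supported] .
      then have "cinner v z = cinner w (unit_seq m)" by (intro vw) (simp add: A_max_def)
      then have "cinner z v = cinner (unit_seq m) w"
        using cinner_commute[of z v] by simp
      then show ?thesis using cinner_A_total_unit[OF z, of v] by simp
    qed
    then show "p \<in> A_max k" by (simp add: p A_max_def fun_eq_iff)
  next
    fix p :: "(int ^ 'd) ell2 \<times> (int ^ 'd) ell2" assume "p \<in> A_max k"
    then obtain v w where p: "p = (v, w)" and w: "seq w = A_total k (seq v)" by (auto simp: A_max_def)
    have "closed {q :: (int ^ 'd) ell2 \<times> (int ^ 'd) ell2. cinner v (snd q) = cinner w (fst q)}"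
      by (intro closed_Collect_eq continuous_intros)
    moreover have "A_fin k \<subseteq> {q. cinner v (snd q) = cinner w (fst q)}"
    proof (clarsimp simp: A_fin_def)
      fix u z :: "(int ^ 'd) ell2"
      assume u: "u \<in> compactly_supported" and z: "seq z = A_total k (seq u)"
      let ?M = "{n. seq u n \<noteq> 0}"
      have "\<exists>e. seq e = A_total k (seq (unit_seq m))" for m :: "int ^ 'd"
        using A_total_vector[OF unit_seq_compactly_supported] by blast
      then have "\<exists>e. \<forall>m :: int ^ 'd. seq (e m) = A_total k (seq (unit_seq m))"
        by (intro choice allI)
      then obtain e where e: "\<And>m :: int ^ 'd. seq (e m) = A_total k (seq (unit_seq m))" by blast
      have u_eq: "seq u = (\<lambda>n. \<Sum>m\<in>?M. seq u m * seq (unit_seq m) n)"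
        using compactly_supported_expansion[OF u] by (metis (no_types, lifting) scaleC.rep_eq seq_sum sum.cong)
      have "z = (\<Sum>m\<in>?M. seq u m *\<^sub>C e m)"
      proof (rule ell2_eqI)
        fix n
        have "seq z n = A_total k (\<lambda>n. \<Sum>m\<in>?M. seq u m * seq (unit_seq m) n) n"
          using z u_eq by simp
        then show "seq z n = seq (\<Sum>m\<in>?M. seq u m *\<^sub>C e m) n"
          by (simp only: A_total_linear seq_sum scaleC.rep_eq e)
      qed
      then have "cinner v z = (\<Sum>m\<in>?M. seq u m * cinner v (e m))"
        by (simp add: cinner_sum)
      moreover have "cinner v (e m) = cnj (seq w m)" for m
        using cinner_A_total_unit[OF e, of m v] w by (subst cinner_commute) simp
      ultimately have 1: "cinner v z = (\<Sum>m\<in>?M. seq u m * cnj (seq w m))" by simp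
      have "cinner w u = cnj (\<Sum>m\<in>?M. cnj (seq u m) * seq w m)"
        using u by (subst cinner_commute, subst cinner_finite_left[of ?M]) (auto simp: compactly_supported_def)
      then show "cinner v z = cinner w u" by (simp add: 1)
    qed
    ultimately have "closure (A_fin k) \<subseteq> {q. cinner v (snd q) = cinner w (fst q)}" by (intro closure_minimal)
    then show "p \<in> adjoint_graph (A_max k)"
      using A_max_subset_closure[OF k] by (auto simp: adjoint_graph_def p)
  qed
qed

subsection \<open>The commutator\<close>

lemma lin_comb_single:
  assumes "\<kappa> \<noteq> 0"
  shows "lin_comb \<kappa> (\<lambda>m. if m = \<kappa> then 1 else 0) = (A_max \<kappa> :: ((int ^ 'd::finite) ell2 \<times> (int ^ 'd) ell2) set)"
proof -
  have A: "A_sum 1 \<kappa> = (A_max \<kappa> :: ((int ^ 'd) ell2 \<times> (int ^ 'd) ell2) set)"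
    using A_sum_eq_A_max[of 1 \<kappa>] assms by simp
  have sum: "(\<lambda>k. (if Suc k * \<kappa> = \<kappa> then 1 else 0) *\<^sub>R v (Suc k)) sums v 1" for v :: "nat \<Rightarrow> (int ^ 'd) ell2"
  proof -
    have eq: "(\<lambda>k. (if Suc k * \<kappa> = \<kappa> then 1 else 0) *\<^sub>R v (Suc k)) = (\<lambda>k. if k = 0 then v (Suc k) else 0)"
      using assms by (auto simp: fun_eq_iff)
    show ?thesis unfolding eq using sums_single[of 0 "\<lambda>k. v (Suc k)"] by simp
  qed
  show ?thesis
  proof (intro equalityI subsetI)
    fix p :: "(int ^ 'd) ell2 \<times> (int ^ 'd) ell2"
    assume "p \<in> lin_comb \<kappa> (\<lambda>m. if m = \<kappa> then 1 else 0)"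
    then obtain u w v where p: "p = (u, w)" and v: "\<forall>j\<ge>1. (if j * \<kappa> = \<kappa> then 1 else 0 :: real) \<noteq> 0 \<longrightarrow> (u, v j) \<in> A_sum j \<kappa>"
      and s: "(\<lambda>k. (if Suc k * \<kappa> = \<kappa> then 1 else 0) *\<^sub>R v (Suc k)) sums w"
      by (auto simp: lin_comb_def)
    have "w = v 1" by (rule sums_unique2[OF s sum])
    moreover have "(u, v 1) \<in> A_sum 1 \<kappa>" using v by auto
    ultimately show "p \<in> A_max \<kappa>" using p A by simp
  next
    fix p :: "(int ^ 'd) ell2 \<times> (int ^ 'd) ell2"
    assume p: "p \<in> A_max \<kappa>"
    obtain u w where uw: "p = (u, w)" by (cases p)
    show "p \<in> lin_comb \<kappa> (\<lambda>m. if m = \<kappa> then 1 else 0)"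
      unfolding lin_comb_def uw using p uw A sum[of "\<lambda>_. w"] assms
      by (auto intro!: exI[of _ "\<lambda>_. w"])
  qed
qed

text \<open>The commutator of the Laplacian with \<open>\<i> A\<^sub>k\<close>: the function
  \<open>\<Sum>\<^sub>i (cos ((k - 1) \<theta>\<^sub>i) - cos ((k + 1) \<theta>\<^sub>i)) / 2\<close> written with shifts.\<close>

definition comm_op :: "nat \<Rightarrow> (int ^ 'd::finite) ell2 \<Rightarrow> (int ^ 'd) ell2"
  where "comm_op k u = (\<Sum>i\<in>UNIV. (1/4) *\<^sub>R (shift_ell2 i (int k - 1) u + shift_ell2 i (1 - int k) u
    - shift_ell2 i (int k + 1) u - shift_ell2 i (- 1 - int k) u))"

lemma bounded_clinear_comm_op: "bounded_clinear (comm_op k)"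
  unfolding comm_op_def[abs_def]
  by (intro bounded_clinear_sum bounded_clinear_scaleR bounded_clinear_add bounded_clinear_diff bounded_clinear_shift)

text \<open>The coefficients grow linearly with slope \<open>2\<close>, so the commutator with a translation has constant
  coefficients.\<close>

lemma A_formal_shift:
  "\<i> * (A_formal i k f (n - axis j l) - A_formal i k (\<lambda>n. f (n - axis j l)) n) =
    (if i = j then - (of_int l / 2) * (f (n - axis i (int k + l)) - f (n - axis i (l - int k))) else 0)"
proof (cases "i = j")
  case True
  have 1: "(n - axis j l) $ j = n $ j - l" by simp
  have 2: "n - axis j l - axis j (int k) = n - axis j (int k + l)"
    "n - axis j l + axis j (int k) = n - axis j (l - int k)"
    "n - axis j (int k) - axis j l = n - axis j (int k + l)"
    "n + axis j (int k) - axis j l = n - axis j (l - int k)"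
    by (simp_all add: vec_eq_iff axis_def)
  show ?thesis unfolding True A_formal_eq 1 2 by (simp add: field_simps)
next
  case False
  then have 1: "(n - axis j l) $ i = n $ i" by (simp add: axis_def)
  have 2: "n - axis j l - axis i (int k) = n - axis i (int k) - axis j l"
    "n - axis j l + axis i (int k) = n + axis i (int k) - axis j l"
    by simp_all
  show ?thesis using False unfolding A_formal_eq 1 2 by simp
qed

lemma seq_laplacian:
  "seq (laplacian u) n = (\<Sum>j\<in>UNIV. 1/2 * (seq u (n - axis j 1) + seq u (n - axis j (-1))))"
  unfolding laplacian_def by (simp add: scaleR_conv_of_real)

lemma A_formal_linear:
  "A_formal i k (\<lambda>n. \<Sum>j\<in>J. c * (f j n + g j n)) n = (\<Sum>j\<in>J. c * (A_formal i k (f j) n + A_formal i k (g j) n))"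
  unfolding A_formal_eq
  by (simp add: sum_distrib_left sum_subtractf[symmetric] algebra_simps)

lemma commutator_A_max:
  fixes u :: "(int ^ 'd::finite) ell2"
  assumes v: "(u, v) \<in> A_max k" and w: "(laplacian u, w) \<in> A_max k"
  shows "laplacian (\<i> *\<^sub>C v) - \<i> *\<^sub>C w = comm_op k u"
proof (rule ell2_eqI)
  fix n
  let ?f = "seq u"
  let ?D = "\<lambda>i j l. \<i> * (A_formal i k ?f (n - axis j l) - A_formal i k (\<lambda>n. ?f (n - axis j l)) n)"
  have "seq w n = (\<Sum>i\<in>UNIV. \<Sum>j\<in>UNIV. 1/2 * (A_formal i k (\<lambda>n. ?f (n - axis j 1)) n + A_formal i k (\<lambda>n. ?f (n - axis j (-1))) n))"
    using w by (simp only: A_max_def mem_Collect_eq prod.case A_total_def seq_laplacian[abs_def] A_formal_linear)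
  also have "\<dots> = (\<Sum>j\<in>UNIV. \<Sum>i\<in>UNIV. 1/2 * (A_formal i k (\<lambda>n. ?f (n - axis j 1)) n + A_formal i k (\<lambda>n. ?f (n - axis j (-1))) n))"
    by (rule sum.swap)
  finally have w': "seq w n = \<dots>" .
  have v': "seq (laplacian (\<i> *\<^sub>C v)) n = (\<Sum>j\<in>UNIV. \<Sum>i\<in>UNIV. 1/2 * (\<i> * A_formal i k ?f (n - axis j 1) + \<i> * A_formal i k ?f (n - axis j (-1))))"
    using v by (simp only: A_max_def mem_Collect_eq prod.case seq_laplacian scaleC.rep_eq A_total_def
        sum_distrib_left sum.distrib[symmetric])
  have "seq (laplacian (\<i> *\<^sub>C v) - \<i> *\<^sub>C w) n = (\<Sum>j\<in>UNIV. \<Sum>i\<in>UNIV. 1/2 * (?D i j 1 + ?D i j (-1)))"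
    by (simp only: minus_ell2.rep_eq scaleC.rep_eq v' w' sum_distrib_left sum_subtractf[symmetric])
      (simp add: algebra_simps)
  also have "\<dots> = (\<Sum>j\<in>UNIV. \<Sum>i\<in>UNIV. if i = j then
      1/2 * (- (of_int 1 / 2) * (?f (n - axis j (int k + 1)) - ?f (n - axis j (1 - int k)))
        + - (of_int (- 1) / 2) * (?f (n - axis j (int k + - 1)) - ?f (n - axis j (- 1 - int k)))) else 0)"
    unfolding A_formal_shift by (intro sum.cong refl) simp
  also have "\<dots> = seq (comm_op k u) n"
    by (simp add: comm_op_def sum.delta scaleR_conv_of_real algebra_simps)
  finally show "seq (laplacian (\<i> *\<^sub>C v) - \<i> *\<^sub>C w) n = seq (comm_op k u) n" .
qed

text \<open>The image of the unit sequence at the origin under \<open>A\<^sub>m\<close> has coordinates of size \<open>m / 4\<close> at the sites at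
  distance \<open>m\<close> on the axes. These sites are distinct for distinct \<open>m\<close>, so \<open>m \<rho>\<^sub>m\<close> is square-summable, and
  \<open>\<bar>\<rho>\<^sub>m\<bar> \<le> (m \<rho>\<^sub>m)\<^sup>2 + 1 / (k + 1)\<^sup>2\<close> for \<open>m = (k + 1) \<kappa>\<close> gives absolute summability.\<close>

lemma bounded_commutator_expansion:
  fixes B :: "(int ^ 'd::finite) ell2 \<Rightarrow> (int ^ 'd) ell2"
  assumes \<kappa>: "\<kappa> \<noteq> 0" and B: "is_bounded_commutator laplacian (lin_comb \<kappa> \<rho>) B"
  shows "summable (\<lambda>k. \<bar>\<rho> (Suc k * \<kappa>)\<bar>)"
    and "u \<in> compactly_supported \<Longrightarrow> (\<lambda>k. \<rho> (Suc k * \<kappa>) *\<^sub>R comm_op (Suc k * \<kappa>) u) sums B u"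
proof -
  have ex: "\<exists>f. (\<forall>k. \<rho> (Suc k * \<kappa>) \<noteq> 0 \<longrightarrow> (u, f k) \<in> A_max (Suc k * \<kappa>)) \<and> (\<lambda>k. \<rho> (Suc k * \<kappa>) *\<^sub>R f k) sums v"
    if uv: "(u, v) \<in> lin_comb \<kappa> \<rho>" for u v :: "(int ^ 'd) ell2"
  proof -
    obtain f where f: "\<forall>j\<ge>1. \<rho> (j * \<kappa>) \<noteq> 0 \<longrightarrow> (u, f j) \<in> A_sum j \<kappa>"
      "(\<lambda>k. \<rho> (Suc k * \<kappa>) *\<^sub>R f (Suc k)) sums v"
      using uv by (auto simp: lin_comb_def)
    have "(u, f (Suc k)) \<in> A_max (Suc k * \<kappa>)" if "\<rho> (Suc k * \<kappa>) \<noteq> 0" for k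
      using f(1)[rule_format, of "Suc k"] that A_sum_eq_A_max[of "Suc k" \<kappa>] \<kappa> by auto
    then show ?thesis using f(2) by (intro exI[of _ "\<lambda>k. f (Suc k)"]) auto
  qed
  show "(\<lambda>k. \<rho> (Suc k * \<kappa>) *\<^sub>R comm_op (Suc k * \<kappa>) u) sums B u" if u: "u \<in> compactly_supported"
  proof -
    obtain v w where vw: "(u, v) \<in> lin_comb \<kappa> \<rho>" "(laplacian u, w) \<in> lin_comb \<kappa> \<rho>"
      and Bu: "B u = laplacian (\<i> *\<^sub>C v) - \<i> *\<^sub>C w"
      using B u by (auto simp: is_bounded_commutator_def)
    obtain f where f: "\<And>k. \<rho> (Suc k * \<kappa>) \<noteq> 0 \<Longrightarrow> (u, f k) \<in> A_max (Suc k * \<kappa>)"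
      "(\<lambda>k. \<rho> (Suc k * \<kappa>) *\<^sub>R f k) sums v" using ex[OF vw(1)] by blast
    obtain g where g: "\<And>k. \<rho> (Suc k * \<kappa>) \<noteq> 0 \<Longrightarrow> (laplacian u, g k) \<in> A_max (Suc k * \<kappa>)"
      "(\<lambda>k. \<rho> (Suc k * \<kappa>) *\<^sub>R g k) sums w" using ex[OF vw(2)] by blast
    have "bounded_linear (\<lambda>v. laplacian (\<i> *\<^sub>C v))"
      by (rule bounded_linear_compose[OF bounded_clinearD(1)[OF bounded_clinear_laplacian] bounded_linear_scaleC])
    from sums_diff[OF bounded_linear.sums[OF this f(2)] bounded_linear.sums[OF bounded_linear_scaleC[of \<i>] g(2)]]
    have "(\<lambda>k. laplacian (\<i> *\<^sub>C \<rho> (Suc k * \<kappa>) *\<^sub>R f k) - \<i> *\<^sub>C \<rho> (Suc k * \<kappa>) *\<^sub>R g k) sums B u"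
      by (simp only: Bu)
    moreover have "laplacian (\<i> *\<^sub>C \<rho> (Suc k * \<kappa>) *\<^sub>R f k) - \<i> *\<^sub>C \<rho> (Suc k * \<kappa>) *\<^sub>R g k
        = \<rho> (Suc k * \<kappa>) *\<^sub>R comm_op (Suc k * \<kappa>) u" for k
    proof (cases "\<rho> (Suc k * \<kappa>) = 0")
      case True
      show ?thesis unfolding True by (simp add: bounded_clinearD[OF bounded_clinear_laplacian])
    next
      case False
      have "laplacian (\<i> *\<^sub>C \<rho> (Suc k * \<kappa>) *\<^sub>R f k) - \<i> *\<^sub>C \<rho> (Suc k * \<kappa>) *\<^sub>R g k
          = \<rho> (Suc k * \<kappa>) *\<^sub>R (laplacian (\<i> *\<^sub>C f k) - \<i> *\<^sub>C g k)"
        by (simp only: scaleC_algebra bounded_clinearD[OF bounded_clinear_laplacian] scaleR_diff_right)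
      then show ?thesis using commutator_A_max[OF f(1) g(1)] False by simp
    qed
    ultimately show ?thesis by simp
  qed
  show "summable (\<lambda>k. \<bar>\<rho> (Suc k * \<kappa>)\<bar>)"
  proof -
    have "\<forall>u\<in>compactly_supported. \<exists>v w. (u, v) \<in> lin_comb \<kappa> \<rho> \<and> (laplacian u, w) \<in> lin_comb \<kappa> \<rho> \<and>
        B u = laplacian (\<i> *\<^sub>C v) - \<i> *\<^sub>C w"
      using B unfolding is_bounded_commutator_def by (rule conjunct2)
    from bspec[OF this unit_seq_compactly_supported[of 0]]
    obtain v where v: "(unit_seq 0 :: (int ^ 'd) ell2, v) \<in> lin_comb \<kappa> \<rho>" by (elim exE conjE)
    obtain f where f: "\<And>k. \<rho> (Suc k * \<kappa>) \<noteq> 0 \<Longrightarrow> (unit_seq 0, f k) \<in> A_max (Suc k * \<kappa>)"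
      "(\<lambda>k. \<rho> (Suc k * \<kappa>) *\<^sub>R f k) sums v" using ex[OF v] by blast
    obtain i0 :: 'd where True by blast
    let ?m = "\<lambda>k. Suc k * \<kappa>"
    have coeff: "A_formal i (?m k) (seq (unit_seq 0)) (axis i0 (int (?m K))) =
        (if i = i0 \<and> k = K then of_nat (?m K) / (4 * \<i>) else 0)" for i k K
    proof -
      have 1: "axis i0 (int (?m K)) = axis i (int (?m k)) \<longleftrightarrow> i = i0 \<and> k = K"
      proof
        assume "axis i0 (int (?m K)) = axis i (int (?m k))"
        then have "axis i0 (int (?m K)) $ i0 = axis i (int (?m k)) $ i0" by simp
        then have "int (?m K) = (if i = i0 then int (?m k) else 0)" by (auto simp: axis_def split: if_splits)
        then show "i = i0 \<and> k = K" using \<kappa> by (auto split: if_splits simp del: of_nat_Suc of_nat_mult mult_Suc)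
      qed simp
      have 2: "axis i0 (int (?m K)) + axis i (int (?m k)) \<noteq> 0"
      proof
        assume "axis i0 (int (?m K)) + axis i (int (?m k)) = 0"
        then have "(axis i0 (int (?m K)) + axis i (int (?m k))) $ i0 = 0" by simp
        then have "int (?m K) + (if i = i0 then int (?m k) else 0) = 0" by (auto simp: axis_def split: if_splits)
        moreover have "0 < int (?m K)" "0 \<le> int (?m k)" using \<kappa> by (simp_all only: of_nat_0_less_iff of_nat_0_le_iff) simp
        ultimately show False by (auto split: if_splits)
      qed
      show ?thesis
        unfolding A_formal_eq seq_unit_seq right_minus_eq 1 using 2 by (auto simp: axis_def field_simps)
    qed
    have vK: "seq v (axis i0 (int (?m K))) = of_real (\<rho> (?m K) * real (?m K)) / (4 * \<i>)" for K
    proof -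
      have "(\<lambda>k. seq (\<rho> (?m k) *\<^sub>R f k) (axis i0 (int (?m K)))) sums seq v (axis i0 (int (?m K)))"
        by (rule bounded_linear.sums[OF bounded_linear_coord f(2)])
      moreover have "seq (\<rho> (?m k) *\<^sub>R f k) (axis i0 (int (?m K)))
          = (if k = K then of_real (\<rho> (?m k) * real (?m k)) / (4 * \<i>) else 0)" for k
      proof (cases "\<rho> (?m k) = 0")
        case True
        then show ?thesis by auto
      next
        case False
        from f(1)[OF this] have "seq (f k) = A_total (?m k) (seq (unit_seq 0))" by (simp add: A_max_def)
        then show ?thesis unfolding seq_scaleR by (simp only: A_total_def coeff) simp
      qed
      ultimately have "(\<lambda>k. if k = K then of_real (\<rho> (?m k) * real (?m k)) / (4 * \<i>) else 0) sums seq v (axis i0 (int (?m K)))"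
        by simp
      from sums_unique2[OF this sums_single[of K "\<lambda>k. of_real (\<rho> (?m k) * real (?m k)) / (4 * \<i>)"]]
      show ?thesis .
    qed
    have inj: "inj_on (\<lambda>K. axis i0 (int (?m K))) S" for S
    proof (rule inj_onI)
      fix K L assume "axis i0 (int (?m K)) = axis i0 (int (?m L))"
      then have "axis i0 (int (?m K)) $ i0 = axis i0 (int (?m L)) $ i0" by simp
      then show "K = L" using \<kappa> by (simp del: of_nat_Suc of_nat_mult mult_Suc)
    qed
    have "summable (\<lambda>K. (cmod (seq v (axis i0 (int (?m K)))))\<^sup>2)"
    proof (rule summableI_nonneg_bounded)
      fix n
      have "(\<Sum>K<n. (cmod (seq v (axis i0 (int (?m K)))))\<^sup>2) = (\<Sum>x\<in>(\<lambda>K. axis i0 (int (?m K))) ` {..<n}. (cmod (seq v x))\<^sup>2)"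
        by (subst sum.reindex[OF inj]) simp
      also have "\<dots> \<le> (norm v)\<^sup>2" by (rule finite_sum_le_norm_square) simp
      finally show "(\<Sum>K<n. (cmod (seq v (axis i0 (int (?m K)))))\<^sup>2) \<le> (norm v)\<^sup>2" .
    qed simp
    then have "summable (\<lambda>K. 16 * (cmod (seq v (axis i0 (int (?m K)))))\<^sup>2)" by (rule summable_mult)
    then have 1: "summable (\<lambda>K. (\<rho> (?m K) * real (?m K))\<^sup>2)"
      unfolding vK by (simp add: norm_divide norm_mult power_divide power_mult_distrib del: of_nat_Suc of_nat_mult mult_Suc)
    have 2: "summable (\<lambda>K. 1 / (real (Suc K))\<^sup>2)"
      using inverse_power_summable[of 2, where 'a = real] by (subst summable_Suc_iff) (simp add: inverse_eq_divide)
    show ?thesis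
    proof (rule summable_comparison_test'[OF summable_add[OF 1 2]])
      fix K :: nat
      let ?x = "\<bar>\<rho> (?m K) * real (?m K)\<bar>" and ?y = "1 / real (Suc K)"
      have "real (Suc K) \<le> real (?m K)" using \<kappa> by (simp del: of_nat_Suc mult_Suc)
      then have "\<bar>\<rho> (?m K)\<bar> * real (Suc K) \<le> ?x"
        unfolding abs_mult by (intro mult_mono) auto
      then have "\<bar>\<rho> (?m K)\<bar> \<le> ?x * ?y" by (simp add: field_simps del: of_nat_Suc mult_Suc)
      also have "\<dots> \<le> ?x\<^sup>2 + ?y\<^sup>2"
      proof -
        have "0 \<le> (?x - ?y)\<^sup>2" "0 \<le> ?x * ?y" by auto
        then show ?thesis unfolding power2_diff by linarith
      qed
      finally show "norm \<bar>\<rho> (?m K)\<bar> \<le> (\<rho> (?m K) * real (?m K))\<^sup>2 + 1 / (real (Suc K))\<^sup>2"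
        by (simp add: power_one_over del: of_nat_Suc mult_Suc)
    qed
  qed
qed

section \<open>Approximate eigenvectors and the obstruction to a Mourre estimate\<close>

lemma card_vec_box:
  assumes "\<And>i :: 'd::finite. finite (F i)"
  shows "card {n :: int ^ 'd. \<forall>i. n $ i \<in> F i} = (\<Prod>i\<in>UNIV. card (F i))"
proof -
  have "bij_betw (\<lambda>n i. n $ i) {n :: int ^ 'd. \<forall>i. n $ i \<in> F i} (Pi\<^sub>E UNIV F)"
    by (rule bij_betw_byWitness[where f' = "\<lambda>f. \<chi> i. f i"]) (auto simp: vec_eq_iff)
  then have "card {n :: int ^ 'd. \<forall>i. n $ i \<in> F i} = card (Pi\<^sub>E UNIV F)" by (rule bij_betw_same_card)
  then show ?thesis by (simp add: card_PiE)
qed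

definition box_cube :: "nat \<Rightarrow> (int ^ 'd::finite) set"
  where "box_cube L = {n. \<forall>i. n $ i \<in> {0..<int L}}"

definition phase :: "('d::finite \<Rightarrow> real) \<Rightarrow> int ^ 'd \<Rightarrow> real"
  where "phase \<theta> n = (\<Sum>i\<in>UNIV. of_int (n $ i) * \<theta> i)"

text \<open>The cube has \<open>L\<^sup>d\<close> sites, so these vectors have norm \<open>1\<close> for \<open>L > 0\<close>. They are approximate
  eigenvectors of the Laplacian and of the commutators.\<close>

definition wave :: "nat \<Rightarrow> ('d::finite \<Rightarrow> real) \<Rightarrow> (int ^ 'd) ell2"
  where "wave L \<theta> = Abs_ell2 (\<lambda>n. if n \<in> box_cube L then of_real (1 / sqrt (real (L ^ CARD('d)))) * cis (phase \<theta> n) else 0)"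

lemma card_box_cube: "card (box_cube L :: (int ^ 'd::finite) set) = L ^ CARD('d)"
  unfolding box_cube_def by (subst card_vec_box) auto

lemma finite_box_cube: "finite (box_cube L :: (int ^ 'd::finite) set)"
proof (cases "L = 0")
  case False
  then show ?thesis by (intro card_ge_0_finite) (simp add: card_box_cube)
qed (simp add: box_cube_def)

lemma seq_wave:
  "seq (wave L \<theta>) n = (if n \<in> box_cube L then of_real (1 / sqrt (real (L ^ CARD('d)))) * cis (phase \<theta> n) else 0)"
  for \<theta> :: "'d::finite \<Rightarrow> real"
  unfolding wave_def
  by (subst seq_Abs_ell2_finite) (auto intro: finite_subset[OF _ finite_box_cube])

lemma wave_compactly_supported: "wave L \<theta> \<in> compactly_supported"
  unfolding compactly_supported_def
  by (auto simp: seq_wave intro: finite_subset[OF _ finite_box_cube])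

lemma phase_shift: "phase \<theta> (n - axis i k) = phase \<theta> n - of_int k * \<theta> i"
proof -
  have "phase \<theta> (n - axis i k) = (\<Sum>j\<in>UNIV. of_int (n $ j) * \<theta> j - (if j = i then of_int k * \<theta> i else 0))"
    unfolding phase_def by (rule sum.cong) (auto simp: axis_def algebra_simps)
  then show ?thesis by (simp add: phase_def sum_subtractf)
qed

text \<open>A translation multiplies a plane wave by a phase; the factor in front is the proportion of the cube
  that overlaps with its translate.\<close>

lemma cinner_wave_shift:
  fixes \<theta> :: "'d::finite \<Rightarrow> real"
  assumes L: "0 < L" and k: "\<bar>k\<bar> \<le> int L"
  shows "cinner (wave L \<theta>) (shift_ell2 i k (wave L \<theta>)) = of_real (1 - \<bar>of_int k\<bar> / real L) * cis (- (of_int k * \<theta> i))"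
proof -
  define S where "S = {n :: int ^ 'd. \<forall>j. n $ j \<in> (if j = i then {max 0 k..<min (int L) (int L + k)} else {0..<int L})}"
  have S: "n \<in> S \<longleftrightarrow> n \<in> box_cube L \<and> n - axis i k \<in> box_cube L" for n
    unfolding S_def box_cube_def by (auto simp: axis_def split: if_splits)
  have "card S = (\<Prod>j\<in>(UNIV :: 'd set). if j = i then nat (int L - \<bar>k\<bar>) else L)"
    unfolding S_def by (subst card_vec_box) (auto intro!: prod.cong arg_cong[where f = nat])
  also have "\<dots> = nat (int L - \<bar>k\<bar>) * L ^ (CARD('d) - 1)"
    by (subst prod.remove[of _ i]) (auto simp: card_Diff_singleton)
  finally have "real (card S) = (real L - \<bar>of_int k\<bar>) * real L ^ (CARD('d) - 1)"
    using k by simp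
  moreover have "real L ^ CARD('d) = real L * real L ^ (CARD('d) - 1)"
    by (metis One_nat_def Suc_pred power_Suc zero_less_card_finite)
  ultimately have card: "real (card S) / real (L ^ CARD('d)) = 1 - \<bar>of_int k\<bar> / real L"
    using L by (simp add: field_simps)
  have pt: "cnj (seq (wave L \<theta>) n) * seq (shift_ell2 i k (wave L \<theta>)) n
      = (if n \<in> S then of_real (1 / real (L ^ CARD('d))) * cis (- (of_int k * \<theta> i)) else 0)" for n
  proof (cases "n \<in> S")
    case True
    have "cnj (of_real (1 / sqrt (real (L ^ CARD('d)))) * cis (phase \<theta> n)) *
        (of_real (1 / sqrt (real (L ^ CARD('d)))) * cis (phase \<theta> n - of_int k * \<theta> i))
      = of_real (1 / sqrt (real (L ^ CARD('d))) * (1 / sqrt (real (L ^ CARD('d))))) *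
        (cis (- phase \<theta> n) * cis (phase \<theta> n - of_int k * \<theta> i))"
    proof -
      have "cnj (of_real c * cis p) * (of_real c * cis q) = of_real (c * c) * (cis (- p) * cis q)" for c p q
        by (simp add: cis_cnj mult_ac)
      then show ?thesis .
    qed
    also have "1 / sqrt (real (L ^ CARD('d))) * (1 / sqrt (real (L ^ CARD('d)))) = (1 / real (L ^ CARD('d)) :: real)"
      by (simp add: real_sqrt_mult[symmetric] flip: of_nat_power)
    also have "cis (- phase \<theta> n) * cis (phase \<theta> n - of_int k * \<theta> i) = cis (- (of_int k * \<theta> i))"
      by (simp add: cis_mult)
    finally show ?thesis using True S[of n] by (simp add: seq_wave phase_shift)
  qed (use S[of n] in \<open>auto simp: seq_wave\<close>)
  have "cinner (wave L \<theta>) (shift_ell2 i k (wave L \<theta>))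
      = (\<Sum>n\<in>box_cube L. cnj (seq (wave L \<theta>) n) * seq (shift_ell2 i k (wave L \<theta>)) n)"
    by (rule cinner_finite_left[OF finite_box_cube]) (simp add: seq_wave)
  also have "\<dots> = (\<Sum>n\<in>box_cube L. if n \<in> S then of_real (1 / real (L ^ CARD('d))) * cis (- (of_int k * \<theta> i)) else 0)"
    by (simp only: pt)
  also have "\<dots> = of_nat (card S) * (of_real (1 / real (L ^ CARD('d))) * cis (- (of_int k * \<theta> i)))"
  proof -
    have "box_cube L \<inter> S = S" using S by auto
    then show ?thesis by (simp add: sum.If_cases finite_box_cube)
  qed
  also have "\<dots> = of_real (real (card S) / real (L ^ CARD('d))) * cis (- (of_int k * \<theta> i))"
    by simp
  finally show ?thesis unfolding card .
qed

lemma norm_wave: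
  assumes "0 < L"
  shows "norm (wave L (\<theta> :: 'd::finite \<Rightarrow> real)) = 1"
proof -
  obtain i :: 'd where True by blast
  have "shift_ell2 i 0 (wave L \<theta>) = wave L \<theta>"
    by (rule ell2_eqI) (simp add: axis_def zero_vec_def[symmetric])
  then have "cinner (wave L \<theta>) (wave L \<theta>) = 1"
    using cinner_wave_shift[OF assms, of 0 \<theta> i] by simp
  then have "(norm (wave L \<theta>))\<^sup>2 = 1" by (simp add: norm_square_eq)
  then show ?thesis by (simp add: power2_eq_1_iff) (metis norm_ge_zero not_one_le_zero zero_le_one neg_0_le_iff_le order_trans)
qed

lemma wave_shift_tendsto:
  "(\<lambda>L. cinner (wave L \<theta>) (shift_ell2 i k (wave L \<theta>))) \<longlonglongrightarrow> cis (- (of_int k * \<theta> i))"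
proof (rule Lim_transform_eventually)
  show "(\<lambda>L. complex_of_real (1 - \<bar>of_int k\<bar> / real L) * cis (- (of_int k * \<theta> i))) \<longlonglongrightarrow> cis (- (of_int k * \<theta> i))"
  proof -
    have "(\<lambda>L. complex_of_real (1 - \<bar>of_int k\<bar> / real L) * cis (- (of_int k * \<theta> i)))
        \<longlonglongrightarrow> complex_of_real (1 - 0) * cis (- (of_int k * \<theta> i))"
      by (intro tendsto_intros lim_const_over_n)
    then show ?thesis by simp
  qed
  show "\<forall>\<^sub>F L in sequentially. complex_of_real (1 - \<bar>of_int k\<bar> / real L) * cis (- (of_int k * \<theta> i))
      = cinner (wave L \<theta>) (shift_ell2 i k (wave L \<theta>))"
    by (rule eventually_sequentiallyI[of "Suc (nat \<bar>k\<bar>)"]) (subst cinner_wave_shift, auto)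
qed

lemma wave_shift_norm_tendsto:
  "(\<lambda>L. norm (shift_ell2 i k (wave L \<theta>) - cis (- (of_int k * \<theta> i)) *\<^sub>C wave L \<theta>)) \<longlonglongrightarrow> 0"
proof -
  let ?c = "cis (- (of_int k * \<theta> i))"
  have eq: "(norm (shift_ell2 i k (wave L \<theta>) - ?c *\<^sub>C wave L \<theta>))\<^sup>2
      = 2 - 2 * Re (cnj ?c * cinner (wave L \<theta>) (shift_ell2 i k (wave L \<theta>)))" if "1 \<le> L" for L
  proof -
    let ?a = "shift_ell2 i k (wave L \<theta>)" and ?b = "?c *\<^sub>C wave L \<theta>"
    have n: "norm ?a = 1" "norm ?b = 1" using that by (simp_all add: norm_shift norm_wave)
    have "(norm (?a - ?b))\<^sup>2 = (norm ?a)\<^sup>2 + (norm ?b)\<^sup>2 - 2 * (?b \<bullet> ?a)"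
      unfolding power2_norm_eq_inner by (simp add: inner_diff inner_commute algebra_simps)
    then show ?thesis unfolding n by (simp only: inner_eq_Re_cinner cinner_scaleC) simp
  qed
  have "(\<lambda>L. 2 - 2 * Re (cnj ?c * cinner (wave L \<theta>) (shift_ell2 i k (wave L \<theta>)))) \<longlonglongrightarrow> 2 - 2 * Re (cnj ?c * ?c)"
    by (intro tendsto_intros wave_shift_tendsto)
  moreover have "cnj ?c * ?c = 1" by (simp add: cis_cnj cis_mult)
  ultimately have "(\<lambda>L. 2 - 2 * Re (cnj ?c * cinner (wave L \<theta>) (shift_ell2 i k (wave L \<theta>)))) \<longlonglongrightarrow> 0" by simp
  then have "(\<lambda>L. (norm (shift_ell2 i k (wave L \<theta>) - ?c *\<^sub>C wave L \<theta>))\<^sup>2) \<longlonglongrightarrow> 0"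
    by (rule Lim_transform_eventually) (rule eventually_sequentiallyI[of 1], simp only: eq)
  then show ?thesis using tendsto_real_sqrt by fastforce
qed

lemma wave_laplacian_tendsto:
  fixes \<theta> :: "'d::finite \<Rightarrow> real"
  shows "(\<lambda>L. norm (laplacian (wave L \<theta>) - (\<Sum>i\<in>UNIV. cos (\<theta> i)) *\<^sub>R wave L \<theta>)) \<longlonglongrightarrow> 0"
proof -
  define e where "e L i k = norm (shift_ell2 i k (wave L \<theta>) - cis (- (of_int k * \<theta> i)) *\<^sub>C wave L \<theta>)" for L i k
  have bound: "norm (laplacian (wave L \<theta>) - (\<Sum>i\<in>UNIV. cos (\<theta> i)) *\<^sub>R wave L \<theta>)
      \<le> (\<Sum>i\<in>UNIV. 1/2 * (e L i 1 + e L i (-1)))" for L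
  proof -
    let ?d = "\<lambda>i k. shift_ell2 i k (wave L \<theta>) - cis (- (of_int k * \<theta> i)) *\<^sub>C wave L \<theta>"
    have "laplacian (wave L \<theta>) - (\<Sum>i\<in>UNIV. cos (\<theta> i)) *\<^sub>R wave L \<theta> = (\<Sum>i\<in>UNIV. (1/2) *\<^sub>R (?d i 1 + ?d i (-1)))"
    proof (rule ell2_eqI)
      fix n
      have c: "cis (- \<theta> i) + cis (\<theta> i) = of_real (2 * cos (\<theta> i))" for i by (simp add: complex_eq_iff)
      have "1/2 * (z1 + z2) - of_real (cos (\<theta> i)) * w
        = of_real (1/2) * ((z1 - cis (- (of_int 1 * \<theta> i)) * w) + (z2 - cis (- (of_int (- 1) * \<theta> i)) * w))" for z1 z2 w i
      proof -
        have "(z1 - cis (- \<theta> i) * w) + (z2 - cis (\<theta> i) * w) = z1 + z2 - (cis (- \<theta> i) + cis (\<theta> i)) * w"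
          by (simp add: algebra_simps)
        then show ?thesis unfolding c by (simp add: algebra_simps)
      qed
      then show "seq (laplacian (wave L \<theta>) - (\<Sum>i\<in>UNIV. cos (\<theta> i)) *\<^sub>R wave L \<theta>) n = seq (\<Sum>i\<in>UNIV. (1/2) *\<^sub>R (?d i 1 + ?d i (-1))) n"
        by (simp only: minus_ell2.rep_eq plus_ell2.rep_eq scaleC.rep_eq seq_scaleR seq_sum seq_shift seq_laplacian
            of_real_sum sum_distrib_right sum_subtractf[symmetric])
    qed
    also have "norm \<dots> \<le> (\<Sum>i\<in>UNIV. 1/2 * (e L i 1 + e L i (-1)))"
    proof (rule sum_norm_le)
      fix i
      show "norm ((1/2) *\<^sub>R (?d i 1 + ?d i (-1))) \<le> 1/2 * (e L i 1 + e L i (-1))"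
        using norm_triangle_ineq[of "?d i 1" "?d i (-1)"] by (simp only: norm_scaleR e_def) simp
    qed
    finally show ?thesis .
  qed
  have "(\<lambda>L. \<Sum>i\<in>UNIV. 1/2 * (e L i 1 + e L i (-1))) \<longlonglongrightarrow> (\<Sum>i\<in>(UNIV :: 'd set). 1/2 * (0 + 0))"
    unfolding e_def by (intro tendsto_sum tendsto_mult_left tendsto_add wave_shift_norm_tendsto)
  then have "(\<lambda>L. \<Sum>i\<in>UNIV. 1/2 * (e L i 1 + e L i (-1))) \<longlonglongrightarrow> 0" by simp
  then show ?thesis
    by (rule Lim_null_comparison[rotated]) (simp only: real_norm_def abs_norm_cancel bound eventually_True)
qed

definition comm_symbol :: "nat \<Rightarrow> ('d::finite \<Rightarrow> real) \<Rightarrow> real"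
  where "comm_symbol k \<theta> = (\<Sum>i\<in>UNIV. sin (\<theta> i) * sin (real k * \<theta> i))"

lemma wave_comm_op_tendsto:
  "(\<lambda>L. Re (cinner (wave L \<theta>) (comm_op k (wave L \<theta>)))) \<longlonglongrightarrow> comm_symbol k \<theta>"
proof -
  let ?c = "\<lambda>i k. cis (- (of_int k * \<theta> i))"
  have "(\<lambda>L. cinner (wave L \<theta>) (comm_op k (wave L \<theta>))) \<longlonglongrightarrow>
    (\<Sum>i\<in>UNIV. of_real (1/4) * (?c i (int k - 1) + ?c i (1 - int k) - ?c i (int k + 1) - ?c i (- 1 - int k)))"
    unfolding comm_op_def cinner_sum cinner_scaleR cinner_add cinner_diff
    by (intro tendsto_intros wave_shift_tendsto)
  then have "(\<lambda>L. Re (cinner (wave L \<theta>) (comm_op k (wave L \<theta>)))) \<longlonglongrightarrow>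
    Re (\<Sum>i\<in>UNIV. of_real (1/4) * (?c i (int k - 1) + ?c i (1 - int k) - ?c i (int k + 1) - ?c i (- 1 - int k)))"
    by (intro tendsto_intros)
  also have "Re (\<Sum>i\<in>UNIV. of_real (1/4) * (?c i (int k - 1) + ?c i (1 - int k) - ?c i (int k + 1) - ?c i (- 1 - int k)))
    = comm_symbol k \<theta>"
    unfolding comm_symbol_def Re_sum
  proof (rule sum.cong[OF refl])
    fix i
    have "- (of_int (int k - 1) * \<theta> i) = \<theta> i - real k * \<theta> i" "- (of_int (1 - int k) * \<theta> i) = real k * \<theta> i - \<theta> i"
      "- (of_int (int k + 1) * \<theta> i) = - (real k * \<theta> i + \<theta> i)" "- (of_int (- 1 - int k) * \<theta> i) = real k * \<theta> i + \<theta> i"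
      by (simp_all add: algebra_simps)
    then show "Re (of_real (1/4) * (?c i (int k - 1) + ?c i (1 - int k) - ?c i (int k + 1) - ?c i (- 1 - int k)))
        = sin (\<theta> i) * sin (real k * \<theta> i)"
      by (simp add: cos_add cos_diff algebra_simps)
  qed
  finally show ?thesis .
qed

lemma norm_comm_op_le: "norm (comm_op k (u :: (int ^ 'd::finite) ell2)) \<le> real CARD('d) * norm u"
proof -
  have "norm (comm_op k u) \<le> (\<Sum>i\<in>(UNIV :: 'd set). norm u)"
    unfolding comm_op_def
  proof (rule sum_norm_le)
    fix i :: 'd
    have "norm (shift_ell2 i (int k - 1) u + shift_ell2 i (1 - int k) u - shift_ell2 i (int k + 1) u - shift_ell2 i (- 1 - int k) u)
        \<le> norm u + norm u + norm u + norm u"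
      by (intro order_trans[OF norm_triangle_ineq4] add_mono order_trans[OF norm_triangle_ineq]) (simp_all add: norm_shift)
    then show "norm ((1/4) *\<^sub>R (shift_ell2 i (int k - 1) u + shift_ell2 i (1 - int k) u
        - shift_ell2 i (int k + 1) u - shift_ell2 i (- 1 - int k) u)) \<le> norm u" by simp
  qed
  then show ?thesis by simp
qed

lemma energy_in_spectrum:
  fixes \<theta> :: "'d::finite \<Rightarrow> real"
  shows "complex_of_real (\<Sum>i\<in>UNIV. cos (\<theta> i)) \<in> spectrum (laplacian :: (int ^ 'd) ell2 \<Rightarrow> _)"
proof -
  let ?E = "\<Sum>i\<in>UNIV. cos (\<theta> i)"
  have False if R: "bounded_clinear R" and inv: "\<And>u. R (laplacian u - complex_of_real ?E *\<^sub>C u) = u"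
    for R :: "(int ^ 'd) ell2 \<Rightarrow> (int ^ 'd) ell2"
  proof -
    have "(\<lambda>L. laplacian (wave L \<theta>) - ?E *\<^sub>R wave L \<theta>) \<longlonglongrightarrow> 0"
      using wave_laplacian_tendsto[of \<theta>] by (simp add: tendsto_norm_zero_iff)
    from bounded_clinear_tendsto[OF R this]
    have "(\<lambda>L. wave L \<theta>) \<longlonglongrightarrow> 0"
      unfolding inv[unfolded scaleC_of_real] bounded_clinearD(6)[OF R] .
    then have "(\<lambda>L. norm (wave L \<theta>)) \<longlonglongrightarrow> 0" by (simp add: tendsto_norm_zero_iff)
    moreover have "(\<lambda>L. norm (wave L \<theta>)) \<longlonglongrightarrow> 1"
      by (rule tendsto_eventually, rule eventually_sequentiallyI[of 1]) (simp add: norm_wave)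
    ultimately show False using LIMSEQ_unique by fastforce
  qed
  then show ?thesis unfolding spectrum_def by blast
qed

text \<open>Plane waves of energy \<^term>\<open>E\<close> on large cubes are approximate eigenvectors, so the spectral projection
  hardly changes them, and the lower bound of the projected commutator passes to the limit of its
  expectations, the value of its symbol.\<close>

lemma mourre_estimate_symbol:
  fixes \<theta> :: "'d::finite \<Rightarrow> real"
  assumes \<kappa>: "\<kappa> \<noteq> 0" and E: "E \<in> mourre_set \<kappa> (laplacian :: (int ^ 'd) ell2 \<Rightarrow> _)"
  obtains \<rho> \<gamma> where "0 < \<gamma>" "summable (\<lambda>k. \<bar>\<rho> (Suc k * \<kappa>)\<bar>)"
    "\<And>\<theta> :: 'd \<Rightarrow> real. (\<Sum>i\<in>UNIV. cos (\<theta> i)) = E \<Longrightarrow>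
      summable (\<lambda>k. \<rho> (Suc k * \<kappa>) * comm_symbol (Suc k * \<kappa>) \<theta>) \<and>
      \<gamma> \<le> (\<Sum>k. \<rho> (Suc k * \<kappa>) * comm_symbol (Suc k * \<kappa>) \<theta>)"
proof -
  let ?T = "laplacian :: (int ^ 'd) ell2 \<Rightarrow> _"
  obtain \<rho> B a b \<gamma> where B: "is_bounded_commutator ?T (lin_comb \<kappa> \<rho>) B"
    and ab: "a < E" "E < b" and \<gamma>: "0 < \<gamma>"
    and le: "op_le (\<lambda>u. \<gamma> *\<^sub>R spectral_projection ?T {a<..<b} u)
        (\<lambda>u. spectral_projection ?T {a<..<b} (B (spectral_projection ?T {a<..<b} u)))"
    using E unfolding mourre_set_def by blast
  interpret spectral_resolution ?T "spectral_projection ?T" by (rule spectral_resolution_laplacian)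
  define Q where "Q = spectral_projection ?T {a<..<b}"
  have Q: "bounded_clinear Q" "\<And>u. Q (Q u) = Q u" "\<And>u v. cinner u (Q v) = cinner (Q u) v"
    unfolding Q_def by (simp_all add: clinear idem symmetric)
  have Bc: "bounded_clinear B" using B by (simp add: is_bounded_commutator_def)
  note expansion = bounded_commutator_expansion[OF \<kappa> B]
  have summ: "summable (\<lambda>k. \<bar>\<rho> (Suc k * \<kappa>)\<bar>)" by (rule expansion(1))
  have est: "\<gamma> * (norm (Q u))\<^sup>2 \<le> Re (cinner (Q u) (B (Q u)))" for u
  proof -
    have "cinner u (Q (B (Q u)) - \<gamma> *\<^sub>R Q u) \<in> \<real>\<^sub>\<ge>\<^sub>0" using le by (simp add: op_le_def Q_def)
    then have "0 \<le> Re (cinner u (Q (B (Q u)) - \<gamma> *\<^sub>R Q u))" by (auto elim: nonneg_Reals_cases)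
    moreover have "cinner u (Q u) = of_real ((norm (Q u))\<^sup>2)"
      using Q(3)[of u "Q u"] Q(2)[of u] cinner_self[of "Q u"] by simp
    ultimately show ?thesis by (simp add: cinner_diff Q(3))
  qed
  have lower: "summable (\<lambda>k. \<rho> (Suc k * \<kappa>) * comm_symbol (Suc k * \<kappa>) \<theta>) \<and>
      \<gamma> \<le> (\<Sum>k. \<rho> (Suc k * \<kappa>) * comm_symbol (Suc k * \<kappa>) \<theta>)"
    if \<theta>: "(\<Sum>i\<in>UNIV. cos (\<theta> i)) = E" for \<theta> :: "'d \<Rightarrow> real"
  proof -
    let ?w = "\<lambda>L. wave L \<theta>"
    define \<delta> where "\<delta> = min (E - a) (b - E)"
    have \<delta>: "0 < \<delta>" using ab by (simp add: \<delta>_def)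
    have diff: "(\<lambda>L. Q (?w L) - ?w L) \<longlonglongrightarrow> 0"
    proof (rule Lim_null_comparison)
      show "\<forall>\<^sub>F L in sequentially. norm (Q (?w L) - ?w L) \<le> norm (laplacian (?w L) - E *\<^sub>R ?w L) / \<delta>"
      proof (rule always_eventually, rule allI)
        fix L
        show "norm (Q (?w L) - ?w L) \<le> norm (laplacian (?w L) - E *\<^sub>R ?w L) / \<delta>"
          using norm_minus_P_le[OF ab \<delta>, of "?w L"] \<delta>
          by (simp add: Q_def \<delta>_def field_simps norm_minus_commute)
      qed
      show "(\<lambda>L. norm (laplacian (?w L) - E *\<^sub>R ?w L) / \<delta>) \<longlonglongrightarrow> 0"
        using tendsto_divide[OF wave_laplacian_tendsto[of \<theta>] tendsto_const[of \<delta>]] \<theta> \<delta> by simp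
    qed
    obtain K where K: "\<And>u. norm (B u) \<le> norm u * K"
      using bounded_linear.bounded[OF bounded_clinearD(1)[OF Bc]] by blast
    have n1: "\<forall>\<^sub>F L in sequentially. norm (?w L) = 1"
      by (rule eventually_sequentiallyI[of 1]) (simp add: norm_wave)
    have Qn: "norm (Q u) \<le> norm u" for u unfolding Q_def by (rule norm_P_le) simp
    have 1: "(\<lambda>L. cinner (Q (?w L)) (B (Q (?w L))) - cinner (?w L) (B (?w L))) \<longlonglongrightarrow> 0"
    proof (rule Lim_null_comparison)
      show "\<forall>\<^sub>F L in sequentially. norm (cinner (Q (?w L)) (B (Q (?w L))) - cinner (?w L) (B (?w L)))
          \<le> 2 * K * norm (Q (?w L) - ?w L)"
        using n1
      proof eventually_elim
        fix L assume n: "norm (?w L) = 1"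
        let ?d = "Q (?w L) - ?w L"
        have "0 \<le> norm (B (?w L))" by simp
        also have "\<dots> \<le> K" using K[of "?w L"] n by simp
        finally have K0: "0 \<le> K" .
        have eq: "cinner (Q (?w L)) (B (Q (?w L))) - cinner (?w L) (B (?w L)) = cinner ?d (B (Q (?w L))) + cinner (?w L) (B ?d)"
          by (simp add: cinner_diff bounded_clinearD(4)[OF Bc])
        have "norm (cinner ?d (B (Q (?w L)))) \<le> norm ?d * norm (B (Q (?w L)))" by (rule Cauchy_Schwarz_cinner)
        also have "\<dots> \<le> norm ?d * (1 * K)"
          by (intro mult_left_mono order_trans[OF K] mult_right_mono) (use Qn[of "?w L"] n K0 in auto)
        finally have a: "norm (cinner ?d (B (Q (?w L)))) \<le> K * norm ?d" by (simp add: mult.commute)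
        have "norm (cinner (?w L) (B ?d)) \<le> norm (?w L) * norm (B ?d)" by (rule Cauchy_Schwarz_cinner)
        also have "\<dots> \<le> K * norm ?d" using K[of ?d] n by (simp add: mult.commute)
        finally have b: "norm (cinner (?w L) (B ?d)) \<le> K * norm ?d" .
        show "norm (cinner (Q (?w L)) (B (Q (?w L))) - cinner (?w L) (B (?w L))) \<le> 2 * K * norm ?d"
          unfolding eq using norm_triangle_ineq[of "cinner ?d (B (Q (?w L)))" "cinner (?w L) (B ?d)"] a b by simp
      qed
      have "(\<lambda>L. 2 * K * norm (Q (?w L) - ?w L)) \<longlonglongrightarrow> 2 * K * norm (0 :: (int ^ 'd) ell2)"
        by (intro tendsto_intros diff)
      then show "(\<lambda>L. 2 * K * norm (Q (?w L) - ?w L)) \<longlonglongrightarrow> 0" by simp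
    qed
    define g where "g k = \<rho> (Suc k * \<kappa>) * comm_symbol (Suc k * \<kappa>) \<theta>" for k
    define G where "G k L = \<rho> (Suc k * \<kappa>) * Re (cinner (?w L) (comm_op (Suc k * \<kappa>) (?w L)))" for k L
    have BG: "Re (cinner (?w L) (B (?w L))) = (\<Sum>k. G k L)" for L
    proof -
      have "(\<lambda>k. cinner (?w L) (\<rho> (Suc k * \<kappa>) *\<^sub>R comm_op (Suc k * \<kappa>) (?w L))) sums cinner (?w L) (B (?w L))"
        by (rule bounded_linear.sums[OF bounded_linear_cinner_right expansion(2)[OF wave_compactly_supported]])
      from bounded_linear.sums[OF bounded_linear_Re this] show ?thesis
        by (simp add: G_def sums_iff)
    qed
    have bnd: "norm (G k L) \<le> \<bar>\<rho> (Suc k * \<kappa>)\<bar> * real CARD('d)" if "norm (?w L) = 1" for k L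
    proof -
      have "\<bar>Re (cinner (?w L) (comm_op (Suc k * \<kappa>) (?w L)))\<bar> \<le> norm (?w L) * norm (comm_op (Suc k * \<kappa>) (?w L))"
        by (rule order_trans[OF abs_Re_le_cmod Cauchy_Schwarz_cinner])
      also have "\<dots> \<le> real CARD('d)" using norm_comm_op_le[of "Suc k * \<kappa>" "?w L"] that by simp
      finally show ?thesis unfolding G_def real_norm_def abs_mult by (rule mult_left_mono) simp
    qed
    have "\<forall>\<^sub>F (k, L) in at_top \<times>\<^sub>F sequentially. norm (G k L) \<le> \<bar>\<rho> (Suc k * \<kappa>)\<bar> * real CARD('d)"
      by (rule eventually_mono[OF eventually_prodI[OF eventually_True n1]]) (use bnd in auto)
    moreover have "(\<lambda>L. G k L) \<longlonglongrightarrow> g k" for k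
      unfolding G_def g_def by (intro tendsto_mult_left wave_comm_op_tendsto)
    ultimately have lim: "summable (\<lambda>k. norm (g k))" "(\<lambda>L. \<Sum>k. G k L) \<longlonglongrightarrow> suminf g"
      using tannerys_theorem[of G g sequentially, OF _ _ summable_mult2[OF summ]] by auto
    have 2: "(\<lambda>L. \<gamma> * (norm (Q (?w L)))\<^sup>2) \<longlonglongrightarrow> \<gamma>"
    proof -
      have "(\<lambda>L. norm (Q (?w L)) - norm (?w L)) \<longlonglongrightarrow> 0"
        by (rule Lim_null_comparison[OF _ tendsto_norm_zero[OF diff]])
          (auto intro!: always_eventually norm_triangle_ineq3)
      moreover have "(\<lambda>L. norm (?w L)) \<longlonglongrightarrow> 1" using n1 by (rule tendsto_eventually)
      ultimately have "(\<lambda>L. (norm (Q (?w L)) - norm (?w L)) + norm (?w L)) \<longlonglongrightarrow> 0 + 1" by (rule tendsto_add)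
      then have "(\<lambda>L. norm (Q (?w L))) \<longlonglongrightarrow> 1" by simp
      then have "(\<lambda>L. \<gamma> * (norm (Q (?w L)))\<^sup>2) \<longlonglongrightarrow> \<gamma> * 1\<^sup>2" by (intro tendsto_intros)
      then show ?thesis by simp
    qed
    have "(\<lambda>L. Re (cinner (Q (?w L)) (B (Q (?w L))) - cinner (?w L) (B (?w L))) + (\<Sum>k. G k L)) \<longlonglongrightarrow> Re 0 + suminf g"
      by (intro tendsto_intros 1 lim(2))
    then have 3: "(\<lambda>L. Re (cinner (Q (?w L)) (B (Q (?w L))))) \<longlonglongrightarrow> suminf g" by (simp add: BG)
    have "\<gamma> \<le> suminf g" by (rule LIMSEQ_le[OF 2 3]) (use est in blast)
    moreover have "summable g" by (rule summable_norm_cancel[OF lim(1)])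
    ultimately show ?thesis unfolding g_def by simp
  qed
  show ?thesis by (rule that[OF \<gamma> summ lower])
qed

section \<open>The Mourre estimate above energy 2\<close>

lemma hat_comm_op:
  fixes u :: "(int ^ 'd::finite) ell2"
  assumes u: "u \<in> compactly_supported"
  shows "hat (comm_op k u) \<theta> = comm_symbol k (\<lambda>i. 2 * pi * \<theta> i) * hat u \<theta>"
proof -
  let ?c = "\<lambda>i k. char (axis i k) \<theta>"
  have "hat (comm_op k u) \<theta> = (\<Sum>i\<in>UNIV. hat ((1/4) *\<^sub>R (shift_ell2 i (int k - 1) u + shift_ell2 i (1 - int k) u
    - shift_ell2 i (int k + 1) u - shift_ell2 i (- 1 - int k) u)) \<theta>)"
    unfolding comm_op_def by (intro hat_sum compactly_supported_closed shift_compactly_supported u)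
  also have "\<dots> = (\<Sum>i\<in>UNIV. of_real (1/4) * (?c i (int k - 1) + ?c i (1 - int k) - ?c i (int k + 1) - ?c i (- 1 - int k)) * hat u \<theta>)"
    by (intro sum.cong refl)
      (simp only: hat_scaleR hat_add hat_diff hat_shift compactly_supported_closed shift_compactly_supported u
        distrib_right left_diff_distrib mult.assoc)
  also have "\<dots> = (\<Sum>i\<in>UNIV. of_real (sin (2 * pi * \<theta> i) * sin (real k * (2 * pi * \<theta> i))) * hat u \<theta>)"
  proof (intro sum.cong refl)
    fix i
    let ?t = "2 * pi * \<theta> i"
    have ang: "2 * pi * of_int (int k - 1) * \<theta> i = real k * ?t - ?t" "2 * pi * of_int (1 - int k) * \<theta> i = - (real k * ?t - ?t)"
      "2 * pi * of_int (int k + 1) * \<theta> i = real k * ?t + ?t" "2 * pi * of_int (- 1 - int k) * \<theta> i = - (real k * ?t + ?t)"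
      by (simp_all add: algebra_simps)
    have "?c i (int k - 1) + ?c i (1 - int k) - ?c i (int k + 1) - ?c i (- 1 - int k)
        = of_real (4 * (sin ?t * sin (real k * ?t)))"
    proof -
      have "cis (a - b) + cis (- (a - b)) - cis (a + b) - cis (- (a + b)) = of_real (4 * (sin b * sin a))" for a b
        using cis_add_cis_minus[of "a - b"] cis_add_cis_minus[of "a + b"]
        by (simp add: diff_diff_eq cos_add cos_diff)
      then show ?thesis unfolding char_axis ang .
    qed
    then show "of_real (1/4) * (?c i (int k - 1) + ?c i (1 - int k) - ?c i (int k + 1) - ?c i (- 1 - int k)) * hat u \<theta>
        = of_real (sin ?t * sin (real k * ?t)) * hat u \<theta>" by simp
  qed
  finally show ?thesis by (simp add: comm_symbol_def sum_distrib_right)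
qed

lemma Fourier_forms:
  assumes f: "bounded_symbol f" and w: "w \<in> compactly_supported" "S w \<in> compactly_supported"
    and S: "\<And>\<theta>. hat (S w) \<theta> = of_real (f \<theta>) * hat w \<theta>"
  shows "cinner w (S w) = of_real (\<integral>\<theta>. f \<theta> * (cmod (hat w \<theta>))\<^sup>2 \<partial>torus)"
    and "(norm (S w))\<^sup>2 = (\<integral>\<theta>. (f \<theta>)\<^sup>2 * (cmod (hat w \<theta>))\<^sup>2 \<partial>torus)"
    and "integrable torus (\<lambda>\<theta>. f \<theta> * (cmod (hat w \<theta>))\<^sup>2)"
proof -
  have sq: "cnj z * z = of_real ((cmod z)\<^sup>2)" for z by (simp only: complex_norm_square mult.commute)
  have "cinner w (S w) = (\<integral>\<theta>. of_real (f \<theta> * (cmod (hat w \<theta>))\<^sup>2) \<partial>torus)"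
    unfolding Parseval[OF w] S
    by (intro Bochner_Integration.integral_cong refl) (simp only: of_real_mult sq[symmetric] mult_ac)
  then show "cinner w (S w) = of_real (\<integral>\<theta>. f \<theta> * (cmod (hat w \<theta>))\<^sup>2 \<partial>torus)"
    by (simp only: integral_complex_of_real)
  have pt: "cnj (of_real a * z) * (of_real a * z) = of_real (a\<^sup>2 * (cmod z)\<^sup>2)" for a z
  proof -
    have "cnj (of_real a * z) * (of_real a * z) = (of_real a * of_real a) * (cnj z * z)" by simp
    then show ?thesis by (simp only: sq of_real_mult power2_eq_square)
  qed
  have "cinner (S w) (S w) = (\<integral>\<theta>. of_real ((f \<theta>)\<^sup>2 * (cmod (hat w \<theta>))\<^sup>2) \<partial>torus)"
    unfolding Parseval[OF w(2,2)] S pt ..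
  then have "complex_of_real ((norm (S w))\<^sup>2) = of_real (\<integral>\<theta>. (f \<theta>)\<^sup>2 * (cmod (hat w \<theta>))\<^sup>2 \<partial>torus)"
    by (simp only: cinner_self integral_complex_of_real)
  then show "(norm (S w))\<^sup>2 = (\<integral>\<theta>. (f \<theta>)\<^sup>2 * (cmod (hat w \<theta>))\<^sup>2 \<partial>torus)"
    by (simp only: of_real_eq_iff)
  have "integrable torus (\<lambda>\<theta>. Re (complex_of_real (f \<theta>) * (cnj (hat w \<theta>) * hat w \<theta>)))"
    by (rule integrable_Re[OF symbol_form_integrable[OF f]])
  then show "integrable torus (\<lambda>\<theta>. f \<theta> * (cmod (hat w \<theta>))\<^sup>2)"
    by (simp only: sq of_real_mult[symmetric] Re_complex_of_real)
qed

text \<open>Let \<open>h = x + y + z\<close>. For \<open>h \<ge> 1\<close> replace the affine factor, which is the tangent at \<open>E\<close> of the convex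
  function \<open>(h - 1)(h - 2)\<close>, by this function. The left-hand side becomes the value of the right-hand
  side at \<open>(1, 1, h - 2)\<close>, and in the coordinates \<open>u = 1 - x\<close>, \<open>v = 1 - y\<close>, \<open>w = 1 - z\<close> the difference is
  \<open>6 ((uv + vw + wu)(2 - (u + v + w)) + uvw) \<ge> 0\<close>. For \<open>h < 1\<close> the left-hand side is less than \<open>-4\<close>,
  while each term on the right is at least \<open>-1\<close>.\<close>

lemma cubic_lower_bound:
  fixes x y z E :: real
  assumes x: "\<bar>x\<bar> \<le> 1" and y: "\<bar>y\<bar> \<le> 1" and z: "\<bar>z\<bar> \<le> 1" and E: "2 \<le> E"
  shows "2 * (3 - (x + y + z)) * ((E - 1) * (E - 2) + (2 * E - 3) * (x + y + z - E))
    \<le> 2 * x * (1 - x\<^sup>2) + 2 * y * (1 - y\<^sup>2) + 2 * z * (1 - z\<^sup>2)"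
proof (cases "1 \<le> x + y + z")
  case True
  define u v w where "u = 1 - x" and "v = 1 - y" and "w = 1 - z"
  have uvw: "0 \<le> u" "0 \<le> v" "0 \<le> w" "u + v + w \<le> 2" using x y z True by (auto simp: u_def v_def w_def)
  let ?h = "x + y + z"
  have "(E - 1) * (E - 2) + (2 * E - 3) * (?h - E) = (?h - 1) * (?h - 2) - (?h - E)\<^sup>2"
    by (simp add: power2_eq_square algebra_simps)
  also have "\<dots> \<le> (?h - 1) * (?h - 2)" by simp
  finally have "2 * (3 - ?h) * ((E - 1) * (E - 2) + (2 * E - 3) * (?h - E)) \<le> 2 * (3 - ?h) * ((?h - 1) * (?h - 2))"
    using x y z by (intro mult_left_mono) auto
  also have "\<dots> = 2 * x * (1 - x\<^sup>2) + 2 * y * (1 - y\<^sup>2) + 2 * z * (1 - z\<^sup>2)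
      - 6 * ((u * v + v * w + w * u) * (2 - (u + v + w)) + u * v * w)"
    unfolding u_def v_def w_def by (simp add: power2_eq_square algebra_simps)
  also have "\<dots> \<le> 2 * x * (1 - x\<^sup>2) + 2 * y * (1 - y\<^sup>2) + 2 * z * (1 - z\<^sup>2)"
  proof -
    have "0 \<le> (u * v + v * w + w * u) * (2 - (u + v + w)) + u * v * w" using uvw by simp
    then show ?thesis by (simp only: diff_le_eq le_add_same_cancel1) simp
  qed
  finally show ?thesis .
next
  case False
  have g: "- 1 \<le> 2 * t * (1 - t\<^sup>2)" if t: "\<bar>t\<bar> \<le> 1" for t :: real
  proof (cases "0 \<le> t")
    case True
    then have "0 \<le> 2 * t * (1 - t\<^sup>2)" using t by (simp add: abs_square_le_1)
    then show ?thesis by simp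
  next
    case False
    define r where "r = (t + 1/2)\<^sup>2 * (1 - t)"
    have "0 \<le> r" using False by (simp add: r_def)
    moreover have eq: "2 * t * (1 - t\<^sup>2) = - 1 + (1 + t) / 2 + 2 * r"
      by (simp add: r_def power2_eq_square field_simps)
    moreover have "- 1 \<le> t" using t by (simp add: abs_le_iff)
    ultimately show ?thesis unfolding eq by (simp add: field_simps)
  qed
  let ?h = "x + y + z"
  have "(2 * E - 3) * (?h - E) \<le> (2 * E - 3) * (1 - E)" using E False by (intro mult_left_mono) auto
  then have "(E - 1) * (E - 2) + (2 * E - 3) * (?h - E) \<le> - ((E - 1)\<^sup>2)"
    by (simp add: power2_eq_square algebra_simps)
  also have "1\<^sup>2 \<le> (E - 1)\<^sup>2" using E by (intro power_mono) auto
  then have "- ((E - 1)\<^sup>2) \<le> - 1" by simp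
  finally have "(E - 1) * (E - 2) + (2 * E - 3) * (?h - E) \<le> - 1" .
  then have "2 * (3 - ?h) * ((E - 1) * (E - 2) + (2 * E - 3) * (?h - E)) \<le> 2 * (3 - ?h) * (- 1)"
    using False by (intro mult_left_mono) auto
  also have "\<dots> \<le> - 1 + - 1 + - 1" using False by simp
  also have "\<dots> \<le> 2 * x * (1 - x\<^sup>2) + 2 * y * (1 - y\<^sup>2) + 2 * z * (1 - z\<^sup>2)"
    by (intro add_mono g x y z)
  finally show ?thesis .
qed

text \<open>On the range of the projection onto \<open>(E - r, E + r)\<close> the operator \<open>\<Delta> - E\<close> has norm at most \<open>r\<close>. So the
  quadratic polynomial \<open>p\<^sub>0 + p\<^sub>1 (\<Delta> - E) - p\<^sub>2 (\<Delta> - E)\<^sup>2\<close> below the commutator is at least \<open>p\<^sub>0 / 2\<close> there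
  when \<open>r\<close> is small.\<close>

lemma mourre_above_two:
  assumes E: "2 < E" "E < 3"
  shows "E \<in> mourre_set 2 (laplacian :: (int ^ 3) ell2 \<Rightarrow> _)"
proof -
  let ?T = "laplacian :: (int ^ 3) ell2 \<Rightarrow> _"
  let ?B = "comm_op 2 :: (int ^ 3) ell2 \<Rightarrow> _"
  interpret spectral_resolution ?T "spectral_projection ?T" by (rule spectral_resolution_laplacian)
  \<comment> \<open>The coefficients of the polynomial in the cubic lower bound, expanded at E.\<close>
  define p0 p1 p2 where "p0 = 2 * (3 - E) * ((E - 1) * (E - 2))"
    and "p1 = 2 * ((3 - E) * (2 * E - 3) - (E - 1) * (E - 2))" and "p2 = 2 * (2 * E - 3)"
  have p0: "0 < p0" and p2: "0 < p2" using E by (simp_all add: p0_def p2_def)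
  \<comment> \<open>Small enough that the terms with p1 and p2 use up at most half of p0.\<close>
  define r where "r = p0 / (2 * (\<bar>p1\<bar> + p2 + p0))"
  have r: "0 < r" "r \<le> 1" "r * (\<bar>p1\<bar> + p2) \<le> p0 / 2"
  proof -
    have D: "0 < \<bar>p1\<bar> + p2 + p0" using p0 p2 by simp
    show "0 < r" using D p0 by (simp add: r_def)
    show "r \<le> 1" using D p0 p2 by (simp add: r_def)
    have "r * (\<bar>p1\<bar> + p2) \<le> r * (\<bar>p1\<bar> + p2 + p0)" using \<open>0 < r\<close> p0 by (intro mult_left_mono) auto
    also have "\<dots> = p0 / 2" using D by (simp add: r_def field_simps)
    finally show "r * (\<bar>p1\<bar> + p2) \<le> p0 / 2" .
  qed
  let ?S = "\<lambda>w. ?T w - E *\<^sub>R w"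
  define G where "G \<theta> = comm_symbol 2 (\<lambda>i. 2 * pi * \<theta> i)" for \<theta> :: "3 \<Rightarrow> real"
  have [measurable]: "G \<in> borel_measurable torus" unfolding G_def comm_symbol_def by measurable
  have G: "bounded_symbol G"
  proof (rule bounded_symbolI[of _ "\<Sum>i\<in>(UNIV :: 3 set). 1 * 1"])
    show "\<bar>G \<theta>\<bar> \<le> (\<Sum>i\<in>(UNIV :: 3 set). 1 * 1)" for \<theta>
      unfolding G_def comm_symbol_def
      by (rule order_trans[OF sum_abs], rule sum_mono) (simp only: abs_mult, intro mult_mono, auto)
  qed measurable
  have hE: "bounded_symbol (\<lambda>\<theta> :: 3 \<Rightarrow> real. energy_symbol \<theta> - E)"
    using bounded_symbol_add[OF bounded_symbol_energy bounded_symbol_const[of "- E"]] by simp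
  have ptw: "p0 + p1 * (energy_symbol \<theta> - E) - p2 * (energy_symbol \<theta> - E)\<^sup>2 \<le> G \<theta>" for \<theta> :: "3 \<Rightarrow> real"
  proof -
    let ?x = "\<lambda>i. cos (2 * pi * \<theta> i)"
    have s: "sin t * sin (2 * t) = 2 * cos t * (1 - (cos t)\<^sup>2)" for t :: real
      unfolding sin_double sin_squared_eq[symmetric] by (simp add: power2_eq_square)
    have "G \<theta> = 2 * ?x 1 * (1 - (?x 1)\<^sup>2) + 2 * ?x 2 * (1 - (?x 2)\<^sup>2) + 2 * ?x 3 * (1 - (?x 3)\<^sup>2)"
      unfolding G_def comm_symbol_def sum_3 by (simp only: of_nat_numeral s)
    moreover have "energy_symbol \<theta> = ?x 1 + ?x 2 + ?x 3" by (simp only: energy_symbol_def sum_3)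
    moreover have "p0 + p1 * (h - E) - p2 * (h - E)\<^sup>2 = 2 * (3 - h) * ((E - 1) * (E - 2) + (2 * E - 3) * (h - E))" for h
      unfolding p0_def p1_def p2_def by (simp add: power2_eq_square algebra_simps)
    ultimately show ?thesis
      using cubic_lower_bound[of "?x 1" "?x 2" "?x 3" E] E by simp
  qed
  have S: "bounded_clinear ?S"
    by (intro bounded_clinear_diff bounded_clinear_laplacian bounded_clinear_scaleR bounded_clinear_ident)
  have Bc: "bounded_clinear ?B" by (rule bounded_clinear_comm_op)
  note cont = bounded_clinear_continuous[OF S, of UNIV] bounded_clinear_continuous[OF Bc, of UNIV]
  have fin: "Im (cinner w (?B w)) = 0"
    "p0 * (norm w)\<^sup>2 + p1 * Re (cinner w (?S w)) - p2 * (norm (?S w))\<^sup>2 \<le> Re (cinner w (?B w))"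
    if w: "w \<in> compactly_supported" for w
  proof -
    have Sw: "?S w \<in> compactly_supported" and Bw: "?B w \<in> compactly_supported"
      using w unfolding comm_op_def
      by (intro compactly_supported_closed compactly_supported_sum laplacian_compactly_supported shift_compactly_supported w)+
    have hatS: "hat (?S w) \<theta> = of_real (energy_symbol \<theta> - E) * hat w \<theta>" for \<theta>
      using w by (simp add: hat_diff hat_laplacian hat_scaleR laplacian_compactly_supported compactly_supported_closed algebra_simps)
    note fS = Fourier_forms[of _ w ?S, OF hE w Sw hatS]
    have hatB: "hat (?B w) \<theta> = of_real (G \<theta>) * hat w \<theta>" for \<theta>
      by (simp add: hat_comm_op[OF w] G_def)
    note fB = Fourier_forms[of _ w ?B, OF G w Bw hatB]
    note f1 = Fourier_forms[of "\<lambda>_. 1" w "\<lambda>w. w", OF bounded_symbol_const w w, simplified]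
    show "Im (cinner w (?B w)) = 0" by (simp add: fB(1))
    have sq: "bounded_symbol (\<lambda>\<theta> :: 3 \<Rightarrow> real. (energy_symbol \<theta> - E)\<^sup>2)"
      using bounded_symbol_mult[OF hE hE] by (simp add: power2_eq_square)
    have i2: "integrable torus (\<lambda>\<theta>. (energy_symbol \<theta> - E)\<^sup>2 * (cmod (hat w \<theta>))\<^sup>2)"
    proof -
      have "integrable torus (\<lambda>\<theta>. Re (complex_of_real ((energy_symbol \<theta> - E)\<^sup>2) * (cnj (hat w \<theta>) * hat w \<theta>)))"
        by (rule integrable_Re[OF symbol_form_integrable[OF sq]])
      then show ?thesis
        by (simp only: complex_norm_square[symmetric] mult.commute[of "cnj _"] of_real_mult[symmetric] Re_complex_of_real flip: of_real_power)
    qed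
    have "p0 * (norm w)\<^sup>2 + p1 * Re (cinner w (?S w)) - p2 * (norm (?S w))\<^sup>2
        = (\<integral>\<theta>. p0 * (cmod (hat w \<theta>))\<^sup>2 + p1 * ((energy_symbol \<theta> - E) * (cmod (hat w \<theta>))\<^sup>2)
            - p2 * ((energy_symbol \<theta> - E)\<^sup>2 * (cmod (hat w \<theta>))\<^sup>2) \<partial>torus)"
      using f1 fS i2 by simp
    also have "\<dots> \<le> (\<integral>\<theta>. G \<theta> * (cmod (hat w \<theta>))\<^sup>2 \<partial>torus)"
    proof (rule integral_mono)
      show "p0 * (cmod (hat w \<theta>))\<^sup>2 + p1 * ((energy_symbol \<theta> - E) * (cmod (hat w \<theta>))\<^sup>2)
            - p2 * ((energy_symbol \<theta> - E)\<^sup>2 * (cmod (hat w \<theta>))\<^sup>2) \<le> G \<theta> * (cmod (hat w \<theta>))\<^sup>2" for \<theta>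
        using mult_right_mono[OF ptw[of \<theta>], of "(cmod (hat w \<theta>))\<^sup>2"] by (simp add: algebra_simps)
    qed (use f1 fS fB i2 in auto)
    also have "\<dots> = Re (cinner w (?B w))" by (simp add: fB(1))
    finally show "p0 * (norm w)\<^sup>2 + p1 * Re (cinner w (?S w)) - p2 * (norm (?S w))\<^sup>2 \<le> Re (cinner w (?B w))" .
  qed
  have real: "Im (cinner w (?B w)) = 0" for w
  proof (rule ell2_eq_on_dense[where f = "\<lambda>w. Im (cinner w (?B w))" and g = "\<lambda>_. 0"])
    show "continuous_on UNIV (\<lambda>w. Im (cinner w (?B w)))"
      by (rule continuous_on_Im[OF continuous_on_cinner[OF continuous_on_id cont(2)]])
  qed (auto simp: fin)
  have lower: "p0 * (norm w)\<^sup>2 + p1 * Re (cinner w (?S w)) - p2 * (norm (?S w))\<^sup>2 \<le> Re (cinner w (?B w))" for w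
  proof (rule ell2_le_on_dense[where u = w])
    show "continuous_on UNIV (\<lambda>w. Re (cinner w (?B w)))"
      by (rule continuous_on_Re[OF continuous_on_cinner[OF continuous_on_id cont(2)]])
    show "continuous_on UNIV (\<lambda>w. p0 * (norm w)\<^sup>2 + p1 * Re (cinner w (?S w)) - p2 * (norm (?S w))\<^sup>2)"
      by (intro continuous_on_add continuous_on_diff continuous_on_mult continuous_on_const continuous_on_power
          continuous_on_norm continuous_on_id continuous_on_Re continuous_on_cinner cont(1))
  qed (rule fin)
  define Q where "Q = spectral_projection ?T {E - r<..<E + r}"
  have Q: "\<And>u. Q (Q u) = Q u" "\<And>u v. cinner u (Q v) = cinner (Q u) v"
    unfolding Q_def by (simp_all add: idem symmetric)
  have est: "p0 / 2 * (norm (Q u))\<^sup>2 \<le> Re (cinner (Q u) (?B (Q u)))" for u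
  proof -
    define w where "w = Q u"
    have Sw: "norm (?S w) \<le> r * norm w"
      by (rule norm_T_minus_le) (use r Q in \<open>auto simp: w_def Q_def\<close>)
    have "\<bar>Re (cinner w (?S w))\<bar> \<le> norm w * norm (?S w)"
      by (rule order_trans[OF abs_Re_le_cmod Cauchy_Schwarz_cinner])
    also have "\<dots> \<le> norm w * (r * norm w)" by (intro mult_left_mono Sw) simp
    finally have 1: "\<bar>Re (cinner w (?S w))\<bar> \<le> r * (norm w)\<^sup>2" by (simp add: power2_eq_square mult_ac)
    have "\<bar>p1 * Re (cinner w (?S w))\<bar> \<le> \<bar>p1\<bar> * (r * (norm w)\<^sup>2)"
      unfolding abs_mult by (intro mult_left_mono 1) simp
    moreover have "p2 * (norm (?S w))\<^sup>2 \<le> p2 * (r * (norm w)\<^sup>2)"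
    proof (rule mult_left_mono)
      have "(norm (?S w))\<^sup>2 \<le> (r * norm w)\<^sup>2" by (intro power_mono Sw) simp
      also have "\<dots> = r * (r * (norm w)\<^sup>2)" by (simp add: power2_eq_square)
      also have "\<dots> \<le> 1 * (r * (norm w)\<^sup>2)" using r by (intro mult_right_mono) auto
      finally show "(norm (?S w))\<^sup>2 \<le> r * (norm w)\<^sup>2" by simp
    qed (use p2 in simp)
    moreover have "(r * (\<bar>p1\<bar> + p2)) * (norm w)\<^sup>2 \<le> p0 / 2 * (norm w)\<^sup>2"
      by (intro mult_right_mono r(3)) simp
    ultimately have "p0 / 2 * (norm w)\<^sup>2 \<le> Re (cinner w (?B w))"
      using lower[of w] by (simp add: algebra_simps)
    then show ?thesis by (simp add: w_def)
  qed
  have le: "op_le (\<lambda>u. (p0 / 2) *\<^sub>R Q u) (\<lambda>u. Q (?B (Q u)))"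
    unfolding op_le_def
  proof
    fix u
    have "cinner u (Q u) = of_real ((norm (Q u))\<^sup>2)"
      using Q(2)[of u "Q u"] Q(1)[of u] cinner_self[of "Q u"] by simp
    moreover have "cinner (Q u) (?B (Q u)) = of_real (Re (cinner (Q u) (?B (Q u))))"
      by (simp add: complex_eq_iff real)
    ultimately have eq: "cinner u (Q (?B (Q u)) - (p0 / 2) *\<^sub>R Q u)
        = of_real (Re (cinner (Q u) (?B (Q u))) - p0 / 2 * (norm (Q u))\<^sup>2)"
      by (simp only: cinner_diff cinner_scaleR Q(2) of_real_diff of_real_mult)
    show "cinner u (Q (?B (Q u)) - (p0 / 2) *\<^sub>R Q u) \<in> \<real>\<^sub>\<ge>\<^sub>0"
      unfolding eq nonneg_Reals_of_real_iff using est[of u] by simp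
  qed
  let ?\<rho> = "\<lambda>m :: nat. if m = 2 then 1 else 0 :: real"
  have A: "lin_comb 2 ?\<rho> = (A_max 2 :: ((int ^ 3) ell2 \<times> _) set)" by (rule lin_comb_single) simp
  have comm: "is_bounded_commutator ?T (lin_comb 2 ?\<rho>) ?B"
    unfolding is_bounded_commutator_def A
  proof (intro conjI ballI bounded_clinear_comm_op)
    fix u :: "(int ^ 3) ell2" assume u: "u \<in> compactly_supported"
    obtain v where v: "seq v = A_total 2 (seq u)" using A_total_vector[OF u] .
    obtain w where w: "seq w = A_total 2 (seq (?T u))"
      using A_total_vector[OF laplacian_compactly_supported[OF u]] .
    have vw: "(u, v) \<in> A_max 2" "(?T u, w) \<in> A_max 2" using v w by (simp_all add: A_max_def)
    then show "\<exists>v w. (u, v) \<in> A_max 2 \<and> (?T u, w) \<in> A_max 2 \<and> ?B u = ?T (\<i> *\<^sub>C v) - \<i> *\<^sub>C w"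
      using commutator_A_max[OF vw] by metis
  qed
  have sa: "self_adjoint (closure (lin_comb 2 ?\<rho> :: ((int ^ 3) ell2 \<times> _) set))"
    unfolding A closure_closed[OF closed_A_max] by (rule self_adjoint_A_max) simp
  have "cos (arccos (E / 3)) = E / 3" using E by (intro cos_arccos) auto
  then have "(\<Sum>i\<in>(UNIV :: 3 set). cos (arccos (E / 3))) = E" unfolding sum_3 by simp
  then have spec: "complex_of_real E \<in> spectrum ?T"
    using energy_in_spectrum[of "\<lambda>_ :: 3. arccos (E / 3)"] by (simp only:)
  show ?thesis
    unfolding mourre_set_def mem_Collect_eq
  proof (intro conjI spec exI)
    show "lin_comb 2 ?\<rho> = lin_comb 2 ?\<rho>" ..
    show "E - r < E" "E < E + r" "0 < p0 / 2" using r p0 by auto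
    show "op_le (\<lambda>u. (p0 / 2) *\<^sub>R spectral_projection ?T {E - r<..<E + r} u)
        (\<lambda>u. spectral_projection ?T {E - r<..<E + r} (?B (spectral_projection ?T {E - r<..<E + r} u)))"
      using le by (simp only: Q_def)
  qed (fact sa comm)+
qed

section \<open>The energies and the thresholds\<close>

text \<open>For odd \<open>n = 2k + 1\<close> the two middle points of the progression are opposite and differ by \<open>E\<close>, so
  \<open>X\<^sub>k = -E / 2\<close>; for even \<open>n = 2k\<close> the middle point is \<open>X\<^sub>k = 0\<close>. With \<open>X\<^sub>k = (k + 1) E - 1\<close> both give the same
  formula.\<close>

lemma energy_two:
  assumes n: "1 \<le> n"
  shows "energy 2 n = 2 / (real n + 2)"
  unfolding energy_def
proof (rule the_equality)
  have cheb: "chebyshev_T 2 x = 2 * x * x - 1" for x by (simp add: numeral_2_eq_2)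
  have c0: "cos (pi / real 2) = 0" by simp
  define E where "E = 2 / (real n + 2)"
  define X where "X q = (of_int q + 1) * E - 1" for q :: int
  have "real n + 2 \<noteq> 0" by linarith
  then have E: "0 < E" "E < 1" "(real n + 2) * E = 2"
    using n by (simp_all add: E_def del: distrib_right_numeral)
  have refl: "X (int n - q) = E - X (1 + q)" "X (int n - q) = - X q" for q
    using E(3) by (simp_all add: X_def algebra_simps)
  have "energy_system 2 n E X"
    unfolding energy_system_def c0
  proof (intro conjI)
    show "X 0 = E - 1" "X (int n + 1) = 1" using E(3) by (simp_all add: X_def algebra_simps)
    show "strict_mono_on {0..int n + 1} X"
      using E by (auto simp: strict_mono_on_def X_def)
    show "E \<in> {2 * 0<..<1 + 0}" using E by simp
    have half: "X ((int n - 1) div 2) = - E / 2" "X ((int n + 1) div 2) = E / 2" if odd: "odd n"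
    proof -
      obtain k where k: "n = 2 * k + 1" by (rule oddE[OF odd])
      show "X ((int n - 1) div 2) = - E / 2" "X ((int n + 1) div 2) = E / 2"
        using E(3) by (simp_all add: k X_def field_simps)
    qed
    have mid: "X (int n div 2) = 0" if even: "even n"
    proof -
      obtain k where k: "n = 2 * k" by (rule evenE[OF even])
      show ?thesis using E(3) by (simp add: k X_def field_simps)
    qed
    have cheb_eq: "chebyshev_T 2 (X q) = chebyshev_T 2 (X (int n - q))" for q
      by (simp add: cheb refl(2))
    show "if odd n then
      (\<forall>q\<in>{0..(int n - 1) div 2}. chebyshev_T 2 (X q) = chebyshev_T 2 (X (int n - q))) \<and>
      (\<forall>q\<in>{-1..(int n - 1) div 2}. X (int n - q) = E - X (1 + q)) \<and>
      X ((int n - 1) div 2) < 0 \<and> 0 < X ((int n + 1) div 2)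
    else
      (\<forall>q\<in>{0..int n div 2 - 1}. chebyshev_T 2 (X q) = chebyshev_T 2 (X (int n - q))) \<and>
      (\<forall>q\<in>{-1..int n div 2 - 1}. X (int n - q) = E - X (1 + q)) \<and>
      X (int n div 2) = 0"
      using half mid E(1) cheb_eq refl(1) by (simp only: if_split) auto
  qed
  then show "\<exists>X. energy_system 2 n (2 / (real n + 2)) X" unfolding E_def by blast
next
  fix E assume "\<exists>X. energy_system 2 n E X"
  then obtain X where X: "energy_system 2 n E X" by blast
  have cheb: "chebyshev_T 2 x = 2 * x * x - 1" for x by (simp add: numeral_2_eq_2)
  have X0: "X 0 = E - 1" and mono: "\<And>p q. 0 \<le> p \<Longrightarrow> p < q \<Longrightarrow> q \<le> int n + 1 \<Longrightarrow> X p < X q"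
    using X by (auto simp: energy_system_def strict_mono_on_def)
  have opp: "X (int n - q) = - X q" if "0 \<le> q" "2 * q < int n" "chebyshev_T 2 (X q) = chebyshev_T 2 (X (int n - q))" for q
  proof -
    have "(X q)\<^sup>2 = (X (int n - q))\<^sup>2" using that(3) by (simp add: cheb power2_eq_square)
    then have "X q = X (int n - q) \<or> X q = - X (int n - q)" by (simp add: power2_eq_iff)
    moreover have "X q < X (int n - q)" using that by (intro mono) auto
    ultimately show ?thesis by auto
  qed
  have chain: "X (int p) = (real p + 1) * E - 1"
    if step: "\<And>q. 0 \<le> q \<Longrightarrow> q < int p \<Longrightarrow> X (1 + q) = E + X q" for p
    using step
  proof (induction p)
    case 0
    then show ?case by (simp add: X0)
  next
    case (Suc p)
    then have "X (int p) = (real p + 1) * E - 1" by simp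
    then show ?case using Suc.prems[of "int p"] by (simp add: algebra_simps)
  qed
  show "E = 2 / (real n + 2)"
  proof (cases "odd n")
    case True
    obtain k where k: "n = 2 * k + 1" by (rule oddE[OF True])
    have half: "(int n - 1) div 2 = int k" by (simp add: k)
    have c: "\<forall>q\<in>{0..int k}. chebyshev_T 2 (X q) = chebyshev_T 2 (X (int n - q))"
      and e: "\<forall>q\<in>{-1..int k}. X (int n - q) = E - X (1 + q)"
      using X True unfolding energy_system_def half by auto
    have "X (int k) = (real k + 1) * E - 1"
    proof (rule chain)
      fix q assume q: "0 \<le> q" "q < int k"
      show "X (1 + q) = E + X q" using opp[of q] c[rule_format, of q] e[rule_format, of q] q by (simp add: k)
    qed
    moreover have "X (int n - int k) = - X (int k)" using c by (intro opp) (auto simp: k)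
    moreover have "X (int n - int k) = X (int k + 1)" by (simp add: k)
    moreover have "X (int n - int k) = E - X (1 + int k)" using e by auto
    ultimately have "(2 * real k + 3) * E = 2" by (simp add: algebra_simps)
    then show ?thesis by (simp add: k field_simps)
  next
    case False
    then have "even n" by simp
    then obtain k where k: "n = 2 * k" by (rule evenE)
    have half: "int n div 2 = int k" by (simp add: k)
    have c: "\<forall>q\<in>{0..int k - 1}. chebyshev_T 2 (X q) = chebyshev_T 2 (X (int n - q))"
      and e: "\<forall>q\<in>{-1..int k - 1}. X (int n - q) = E - X (1 + q)" and m: "X (int k) = 0"
      using X False unfolding energy_system_def half by auto
    have "X (int k) = (real k + 1) * E - 1"
    proof (rule chain)
      fix q assume q: "0 \<le> q" "q < int k"
      show "X (1 + q) = E + X q" using opp[of q] c[rule_format, of q] e[rule_format, of q] q by (simp add: k)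
    qed
    then have "(real k + 1) * E = 1" using m by simp
    then show ?thesis by (simp add: k field_simps)
  qed
qed

text \<open>With \<open>x = cos \<theta>\<close> this is the contribution of one coordinate to the symbol of the commutator. Replacing
  \<open>x\<close> by \<open>-x\<close> replaces \<open>\<theta>\<close> by \<open>\<pi> - \<theta>\<close>.\<close>

lemma comm_summand_odd:
  assumes k: "even k" and x: "\<bar>x\<bar> \<le> 1"
  defines "\<phi> \<equiv> \<lambda>x. sin (arccos x) * sin (real k * arccos x)"
  shows "\<phi> (- x) = - \<phi> x" "\<phi> 1 = 0" "\<phi> 0 = 0"
proof -
  obtain j where j: "k = 2 * j" by (rule evenE[OF k])
  have "arccos (- x) = pi - arccos x" using x by (intro arccos_minus) auto
  moreover have "real k * (pi - t) = real j * (2 * pi) - real k * t" for t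
    by (simp add: j algebra_simps)
  moreover have "sin (real j * (2 * pi) - t) = - sin t" for t
    using sin_diff[of "real j * (2 * pi)" t] sin_npi[of "2 * j"] cos_npi[of "2 * j"] by (simp add: mult_ac)
  ultimately show "\<phi> (- x) = - \<phi> x" by (simp add: \<phi>_def)
  show "\<phi> 1 = 0" by (simp add: \<phi>_def)
  have "real k * (pi / 2) = real j * pi" by (simp add: j)
  then show "\<phi> 0 = 0" by (simp add: \<phi>_def arccos_0)
qed

text \<open>Pairing the neighbours \<open>y\<^bsub>p+1\<^esub>\<close> and \<open>-y\<^sub>p\<close> of an arithmetic progression with step \<open>E\<close> gives points of one
  energy at which the symbols have a telescoping sum. The progression joins \<open>-1\<close> to \<open>1\<close>, so the sum is
  \<open>0\<close> for every even \<open>k\<close>, hence for all combinations. The third coordinate \<open>c\<close> contributes nothing to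
  the symbol.\<close>

lemma threshold_energies:
  fixes n :: nat and s c :: real
  assumes s: "s = 1 \<or> s = - 1" and c: "c = 0 \<or> c = 1"
  defines "E \<equiv> 2 / (real n + 2)"
  shows "s * E + c \<in> threshold_set 2 (laplacian :: (int ^ 3) ell2 \<Rightarrow> _)"
proof -
  define y where "y p = real p * E - 1" for p :: nat
  define pt where "pt p i = (if i = 1 then arccos (s * y (Suc p)) else if i = 2 then arccos (s * - y p) else arccos c)"
    for p :: nat and i :: 3
  have "real n + 2 \<noteq> 0" by linarith
  then have E: "0 < E" "(real n + 2) * E = 2" by (simp_all add: E_def del: distrib_right_numeral)
  have y: "\<bar>s * y p\<bar> \<le> 1" if "p \<le> n + 2" for p
  proof -
    have "real p * E \<le> (real n + 2) * E" using that E by (intro mult_right_mono) auto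
    then have "\<bar>y p\<bar> \<le> 1" using E by (auto simp: y_def abs_le_iff)
    then show ?thesis using s by auto
  qed
  have energy: "(\<Sum>i\<in>UNIV. cos (pt p i)) = s * E + c" if "p < n + 2" for p
  proof -
    have "cos (arccos (s * y (Suc p))) = s * y (Suc p)" "cos (arccos (s * - y p)) = s * - y p" "cos (arccos c) = c"
      using y[of p] y[of "Suc p"] that c by (auto intro!: cos_arccos_abs)
    then show ?thesis by (simp add: sum_3 pt_def y_def algebra_simps)
  qed
  have cancel: "(\<Sum>p<n + 2. comm_symbol k (pt p)) = 0" if k: "even k" for k
  proof -
    define \<phi> where "\<phi> x = sin (arccos x) * sin (real k * arccos x)" for x
    note \<phi> = comm_summand_odd[OF k, folded \<phi>_def]
    have "comm_symbol k (pt p) = \<phi> (s * y (Suc p)) - \<phi> (s * y p)" if "p < n + 2" for p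
    proof -
      have "\<phi> (s * - y p) = - \<phi> (s * y p)" using \<phi>(1)[OF y[of p]] that by simp
      moreover have "\<phi> c = 0" using c \<phi>(2,3)[of 0] by auto
      ultimately show ?thesis
        by (simp add: comm_symbol_def sum_3 pt_def \<phi>_def)
    qed
    then have "(\<Sum>p<n + 2. comm_symbol k (pt p)) = (\<Sum>p<n + 2. \<phi> (s * y (Suc p)) - \<phi> (s * y p))" by simp
    also have "\<dots> = \<phi> (s * y (n + 2)) - \<phi> (s * y 0)" by (rule sum_lessThan_telescope)
    also have "\<dots> = \<phi> (s * 1) - \<phi> (s * - 1)" using E by (simp add: y_def add.commute)
    also have "\<dots> = 0" using s \<phi>(1)[of 1] \<phi>(2)[of 0] by auto
    finally show ?thesis .
  qed
  have "s * E + c \<notin> mourre_set 2 (laplacian :: (int ^ 3) ell2 \<Rightarrow> _)"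
  proof
    assume m: "s * E + c \<in> mourre_set 2 (laplacian :: (int ^ 3) ell2 \<Rightarrow> _)"
    have two: "(2 :: nat) \<noteq> 0" by simp
    obtain \<gamma> \<rho> where \<gamma>: "0 < \<gamma>" and "summable (\<lambda>k. \<bar>\<rho> (Suc k * 2)\<bar>)" and
      low: "\<And>\<theta> :: 3 \<Rightarrow> real. (\<Sum>i\<in>UNIV. cos (\<theta> i)) = s * E + c \<Longrightarrow>
        summable (\<lambda>k. \<rho> (Suc k * 2) * comm_symbol (Suc k * 2) \<theta>) \<and>
        \<gamma> \<le> (\<Sum>k. \<rho> (Suc k * 2) * comm_symbol (Suc k * 2) \<theta>)"
      by (rule mourre_estimate_symbol[OF two m]) blast
    have "real (n + 2) * \<gamma> = (\<Sum>p<n + 2. \<gamma>)" by simp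
    also have "\<dots> \<le> (\<Sum>p<n + 2. \<Sum>k. \<rho> (Suc k * 2) * comm_symbol (Suc k * 2) (pt p))"
      by (rule sum_mono) (use low energy in auto)
    also have "\<dots> = (\<Sum>k. \<Sum>p<n + 2. \<rho> (Suc k * 2) * comm_symbol (Suc k * 2) (pt p))"
      by (rule suminf_sum[symmetric]) (use low energy in auto)
    also have "\<dots> = (\<Sum>k. 0)"
      by (rule suminf_cong) (simp only: sum_distrib_left[symmetric] cancel dvd_triv_right mult_zero_right)
    finally have "real (n + 2) * \<gamma> \<le> 0" by simp
    moreover have "0 < real (n + 2) * \<gamma>" using \<gamma> by (intro mult_pos_pos) auto
    ultimately show False by linarith
  qed
  moreover have "complex_of_real (s * E + c) \<in> spectrum (laplacian :: (int ^ 3) ell2 \<Rightarrow> _)"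
    using energy_in_spectrum[of "pt 0"] energy[of 0] by simp
  ultimately show ?thesis by (simp add: threshold_set_def)
qed

theorem theorem1p19:
  fixes \<Delta> :: "(int ^ 3) ell2 \<Rightarrow> (int ^ 3) ell2" and \<kappa> :: nat and \<E> :: "nat \<Rightarrow> real"
  assumes "\<Delta> = laplacian" and "\<kappa> = 2" and "\<And>n. n \<ge> 1 \<Longrightarrow> \<E> n = energy \<kappa> n"
  shows "{2<..<3} \<subseteq> mourre_set \<kappa> \<Delta> \<and>
    {0, 1, 2, 3} \<subseteq> theta0 TYPE(3) \<kappa> \<and>
    ((\<forall>n\<ge>1. \<E> n + 1 \<in> {1<..<2} \<inter> threshold_set \<kappa> \<Delta>) \<and>
      strict_antimono_on {1..} (\<lambda>n. \<E> n + 1) \<and> (\<lambda>n. \<E> n + 1) \<longlonglongrightarrow> 1) \<and>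
    ((\<forall>n\<ge>1. \<E> n \<in> {0<..<1} \<inter> threshold_set \<kappa> \<Delta>) \<and>
      strict_antimono_on {1..} \<E> \<and> \<E> \<longlonglongrightarrow> 0) \<and>
    ((\<forall>n\<ge>1. - \<E> n + 1 \<in> {0<..<1} \<inter> threshold_set \<kappa> \<Delta>) \<and>
      strict_mono_on {1..} (\<lambda>n. - \<E> n + 1) \<and> (\<lambda>n. - \<E> n + 1) \<longlonglongrightarrow> 1)"
proof -
  have \<E>: "\<E> n = 2 / (real n + 2)" if "1 \<le> n" for n
    using assms that energy_two by simp
  have dec: "\<E> n < \<E> m" if "1 \<le> m" "m < n" for m n
    using that by (simp add: \<E> frac_less2)
  have range: "0 < \<E> n" "\<E> n < 1" if "1 \<le> n" for n using that by (simp_all add: \<E>)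
  have thr: "s * \<E> n + c \<in> threshold_set \<kappa> \<Delta>" if "1 \<le> n" "s = 1 \<or> s = - 1" "c = 0 \<or> c = 1" for n s c
    unfolding assms(1,2) \<E>[OF that(1)] by (rule threshold_energies[OF that(2,3)])
  have lim: "\<E> \<longlonglongrightarrow> 0"
  proof (rule Lim_transform_eventually)
    show "(\<lambda>n. 2 / (real n + 2)) \<longlonglongrightarrow> 0"
      using LIMSEQ_ignore_initial_segment[OF lim_const_over_n[of 2], of 2] by (simp add: add.commute)
    show "\<forall>\<^sub>F n in sequentially. 2 / (real n + 2) = \<E> n"
      by (rule eventually_sequentiallyI[of 1]) (simp add: \<E>)
  qed
  have "{2<..<3} \<subseteq> mourre_set \<kappa> \<Delta>"
    using mourre_above_two assms by auto
  moreover have "{0, 1, 2, 3} \<subseteq> theta0 TYPE(3) \<kappa>"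
  proof -
    have "real a + real b + real c \<in> theta0 TYPE(3) 2" if "a \<le> 1" "b \<le> 1" "c \<le> 1" for a b c :: nat
    proof -
      define j where "j i = (if i = 1 then 1 - a else if i = 2 then 1 - b else 1 - c)" for i :: 3
      have cos: "cos (real (1 - t) * pi / real 2) = real t" if "t \<le> 1" for t :: nat
        using that by (cases "t = 0") auto
      have "(\<Sum>q\<in>UNIV. cos (real (j q) * pi / real 2)) = real a + real b + real c"
        using cos that by (simp add: sum_3 j_def del: of_nat_diff)
      moreover have "\<forall>q. j q \<le> 2" by (auto simp: j_def)
      ultimately show ?thesis unfolding theta0_def by (intro CollectI exI[of _ j]) simp
    qed
    from this[of 0 0 0] this[of 1 0 0] this[of 1 1 0] this[of 1 1 1] show ?thesis
      using assms by simp
  qed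
  moreover have "(\<forall>n\<ge>1. \<E> n + 1 \<in> {1<..<2} \<inter> threshold_set \<kappa> \<Delta>)"
    using range thr[of _ 1 1] by auto
  moreover have "(\<forall>n\<ge>1. \<E> n \<in> {0<..<1} \<inter> threshold_set \<kappa> \<Delta>)"
    using range thr[of _ 1 0] by auto
  moreover have "(\<forall>n\<ge>1. - \<E> n + 1 \<in> {0<..<1} \<inter> threshold_set \<kappa> \<Delta>)"
    using range thr[of _ "- 1" 1] by auto
  moreover have "strict_antimono_on {1..} (\<lambda>n. \<E> n + 1)" "strict_antimono_on {1..} \<E>"
    "strict_mono_on {1..} (\<lambda>n. - \<E> n + 1)"
    using dec by (auto simp: monotone_on_def)
  moreover have "(\<lambda>n. \<E> n + 1) \<longlonglongrightarrow> 0 + 1" "(\<lambda>n. - \<E> n + 1) \<longlonglongrightarrow> - 0 + 1"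
    by (intro tendsto_intros lim)+
  ultimately show ?thesis using lim by simp
qed

end
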